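(* Let $L_0=\mathbb{Q}^{(2)}$ and let $K_1,K_2,K_3,\ldots$ be an infinite sequence of cubic number fields (subfields of $\overline{\mathbb{Q}}$) such that $\mathbb{Q}^{(3)}=L_0\prod_{n}K_n$ and such that, with $L_n=L_{n-1}K_n$ for $n\ge 1$, the field $L_n$ is a proper extension of $L_{n-1}$ for every $n\geq 1$. Then the composite ring $$\mathcal{O}_{L_0}\prod_{n=1}^\infty\mathcal{O}_{K_n}$$ has the Northcott property.
   Context: $\overline{\mathbb{Q}}$ is a fixed algebraic closure of $\mathbb{Q}$. $\mathbb{Q}^{(d)}\subseteq\overline{\mathbb{Q}}$ is the composite field of all number fields of degree at most $d$ over $\mathbb{Q}$. For a field $K\subseteq\overline{\mathbb{Q}}$ (possibly of infinite degree over $\mathbb{Q}$), $\mathcal{O}_K$ is its ring of algebraic integers. For subrings $S_i$ of $\overline{\mathbb{Q}}$, the product $\prod_i S_i$ denotes the composite ring, i.e. the smallest subring of $\overline{\mathbb{Q}}$ containing all $S_i$ (for number fields or other algebraic fields this is the compositum). The absolute multiplicative Weil height of $\alpha$ in a number field $K$ is $H(\alpha)=\prod_v\max\{1,|\alpha|_v\}^{d_v/[K:\mathbb{Q}]}$, the product over all places $v$ of $K$, where $|\cdot|_v$ extends the usual archimedean or $p$-adic absolute value on $\mathbb{Q}$ and $d_v=[K_v:\mathbb{Q}_v]$; it is independent of the choice of $K\ni\alpha$. Put $h(\alpha)=\log H(\alpha)$. A set $S\subseteq\overline{\mathbb{Q}}$ has the Northcott property if $\#\{\alpha\in S: h(\alpha)\le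 X\}<\infty$ for every $X\ge 0$. *)

theory Defs
  imports Complex_Main "HOL-Algebra.Algebraic_Closure_Type" "HOL-Algebra.Generated_Rings" "HOL-Algebra.Generated_Fields" "HOL-Algebra.Embedded_Algebras"
    "HOL-Algebra.QuotRing" "HOL-Library.FuncSet"
begin

text \<open>
  The fixed algebraic closure of the rationals is the field of algebraic numbers inside
  the complex numbers; every field and ring below is a subset of \<^typ>\<open>complex\<close>.
\<close>

abbreviation complex_ring :: "complex ring" where
  "complex_ring \<equiv> ring_of_type_algebra"

definition Qbar :: "complex set" where
  "Qbar = {x. algebraic x}"

definition field_degree :: "complex set \<Rightarrow> nat" where
  "field_degree K = ring.dim complex_ring \<rat> K"

definition number_field :: "complex set \<Rightarrow> bool" where
  "number_field K \<longleftrightarrow>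
     subfield K complex_ring \<and> K \<subseteq> Qbar \<and> ring.finite_dimension complex_ring \<rat> K"

definition Q_upto :: "nat \<Rightarrow> complex set" where
  "Q_upto d = generate_field complex_ring (\<Union>{K. number_field K \<and> field_degree K \<le> d})"

definition ring_of_integers :: "complex set \<Rightarrow> complex set" where
  "ring_of_integers K = {x \<in> K. algebraic_int x}"

definition composite_ring :: "complex set set \<Rightarrow> complex set" where
  "composite_ring \<S> = generate_ring complex_ring (\<Union>\<S>)"

definition padic_abs :: "nat \<Rightarrow> rat \<Rightarrow> real" where
  "padic_abs p q =
     (if q = 0 then 0
      else real p powi (int (multiplicity (int p) (snd (quotient_of q)))
                        - int (multiplicity (int p) (fst (quotient_of q)))))"

definition absolute_value_on :: "complex set \<Rightarrow> (complex \<Rightarrow> real) \<Rightarrow> bool" where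
  "absolute_value_on K v \<longleftrightarrow>
     (\<forall>x\<in>K. v x \<ge> 0) \<and>
     (\<forall>x\<in>K. v x = 0 \<longleftrightarrow> x = 0) \<and>
     (\<forall>x\<in>K. \<forall>y\<in>K. v (x * y) = v x * v y) \<and>
     (\<forall>x\<in>K. \<forall>y\<in>K. v (x + y) \<le> v x + v y)"

text \<open>
  A place is represented by the unique absolute value in its class that extends the usual
  archimedean or a \<open>p\<close>-adic absolute value of the rationals. Extensionality outside
  \<open>K\<close> makes distinct functions correspond to distinct places.
\<close>

definition places :: "complex set \<Rightarrow> (complex \<Rightarrow> real) set" where
  "places K = {v \<in> extensional K. absolute_value_on K v \<and>
     ((\<forall>q::rat. v (of_rat q) = \<bar>of_rat q\<bar>) \<or>
      (\<exists>p::nat. Factorial_Ring.prime p \<and> (\<forall>q::rat. v (of_rat q) = padic_abs p q)))}"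

text \<open>
  The completion of \<open>K\<close> at \<open>v\<close> is the ring of \<open>v\<close>-Cauchy sequences in \<open>K\<close> modulo the
  ideal of null sequences. The classes of rational Cauchy sequences form the completion of
  the rationals, as a subfield of it.
\<close>

definition cauchy_seqs :: "complex set \<Rightarrow> (complex \<Rightarrow> real) \<Rightarrow> (nat \<Rightarrow> complex) set" where
  "cauchy_seqs K v =
     {x. (\<forall>n. x n \<in> K) \<and> (\<forall>e>0. \<exists>N. \<forall>m\<ge>N. \<forall>n\<ge>N. v (x m - x n) < e)}"

definition null_seqs :: "complex set \<Rightarrow> (complex \<Rightarrow> real) \<Rightarrow> (nat \<Rightarrow> complex) set" where
  "null_seqs K v = {x. (\<forall>n. x n \<in> K) \<and> (\<lambda>n. v (x n)) \<longlonglongrightarrow> 0}"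

definition cauchy_ring :: "complex set \<Rightarrow> (complex \<Rightarrow> real) \<Rightarrow> (nat \<Rightarrow> complex) ring" where
  "cauchy_ring K v =
     \<lparr>carrier = cauchy_seqs K v,
      monoid.mult = (\<lambda>x y n. x n * y n), one = (\<lambda>n. 1),
      zero = (\<lambda>n. 0), add = (\<lambda>x y n. x n + y n)\<rparr>"

definition completion :: "complex set \<Rightarrow> (complex \<Rightarrow> real) \<Rightarrow> (nat \<Rightarrow> complex) set ring" where
  "completion K v = cauchy_ring K v Quot null_seqs K v"

definition rational_completion ::
  "complex set \<Rightarrow> (complex \<Rightarrow> real) \<Rightarrow> (nat \<Rightarrow> complex) set set" where
  "rational_completion K v =
     (\<lambda>x. null_seqs K v +>\<^bsub>cauchy_ring K v\<^esub> x) ` cauchy_seqs \<rat> v"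

definition local_degree :: "complex set \<Rightarrow> (complex \<Rightarrow> real) \<Rightarrow> nat" where
  "local_degree K v =
     ring.dim (completion K v) (rational_completion K v) (carrier (completion K v))"

text \<open>
  All but finitely many factors of the product over the places are 1; they are omitted so
  that the product ranges over a finite set.
\<close>

definition weil_height_in :: "complex set \<Rightarrow> complex \<Rightarrow> real" where
  "weil_height_in K \<alpha> =
     (\<Prod>v | v \<in> places K \<and> v \<alpha> > 1.
        max 1 (v \<alpha>) powr (real (local_degree K v) / real (field_degree K)))"

text \<open>The height does not depend on the number field containing \<open>\<alpha>\<close>; the field generated
  by \<open>\<alpha>\<close> is used.\<close>

definition weil_height :: "complex \<Rightarrow> real" where
  "weil_height \<alpha> = weil_height_in (generate_field complex_ring {\<alpha>}) \<alpha>"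

definition log_height :: "complex \<Rightarrow> real" where
  "log_height \<alpha> = ln (weil_height \<alpha>)"

definition northcott :: "complex set \<Rightarrow> bool" where
  "northcott S \<longleftrightarrow> S \<subseteq> Qbar \<and> (\<forall>B\<ge>0. finite {\<alpha> \<in> S. log_height \<alpha> \<le> B})"

end

theory Submission
  imports Defs "Jordan_Normal_Form.Char_Poly" "HOL.Hull"
begin

text \<open>
  Write R for the composite ring and \<open>R\<^sub>n\<close> for the ring generated by the integers of \<open>L\<^sub>0\<close> and of the
  first n cubic fields. For an algebraic integer the logarithmic Weil height is the mean, over its
  conjugates x, of log max(1, |x|); a lower bound by half this mean suffices, and it follows from the
  positivity of local degrees (\<open>hm_le_log_height\<close>). All lower bounds for heights have one source
  (\<open>height_bound_by_averaging\<close>): if a difference of conjugates of a, or a product of such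
  differences, is divisible by something large, then the norm of the quotient is a nonzero rational
  integer, so that some conjugates of a must be large on average.

  The first application is to the cubic steps. Let a belong to \<open>R\<^sub>n\<close> but not to the preceding
  ring. Because \<open>L\<^sub>0\<close> has the square roots of all rational numbers, the n-th
  step is cyclic of degree 3. The element a and its square have coordinates in the preceding ring
  with respect to an integral basis of the n-th cubic field; so the discriminant of a over the
  preceding field is divisible by the discriminant of the cubic field, which is thus bounded in
  terms of the height of a. Reduction of binary quadratic forms (\<open>reduced_basis\<close>) turns this
  bound into a small nonrational element of the cubic field (\<open>small_element\<close>). That element is new
  at the n-th step, and only finitely many algebraic integers of degree at most 3 have bounded
  conjugates. So for bounded height only finitely many n occur, and all elements of R of bounded
  height lie in one \<open>L\<^sub>N\<close>.

  The field \<open>L\<^sub>N\<close> is generated by square roots of rational integers over a number field. If the square root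
  of a large prime p is needed to express a, then the automorphism negating that root changes a by
  an element whose square is divisible by p (\<open>height_new_square_root\<close>); so p is bounded in terms of
  the height. The divisibility requires p to be unramified in the field below, which
  is replaced by the elementary notion \<open>tame\<close>; it survives adjunctions of discriminant prime
  to p (\<open>tame_adjoin\<close>). Hence all elements of bounded height lie in one number field
  (\<open>bounded_height_rootfield\<close>), where Northcott's theorem applies (\<open>finite_bounded_height\<close>).

  The Galois theory of the algebraic numbers enters through one fact (\<open>emb_moving\<close>): an
  algebraic number outside a field, of finite or infinite degree, is moved by an automorphism
  over that field.
\<close>

section \<open>Algebraic integers form a ring\<close>

text \<open>A number that stabilises a nonzero finitely generated group of complex numbers is an
  eigenvalue of an integer matrix, hence a root of its monic characteristic polynomial.\<close>

lemma algebraic_int_if_stable_span: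
  fixes z :: complex and b :: "nat \<Rightarrow> complex"
  assumes k: "k < n" "b k \<noteq> 0"
    and st: "\<And>i. i < n \<Longrightarrow> \<exists>c::nat \<Rightarrow> int. z * b i = (\<Sum>j<n. of_int (c j) * b j)"
  shows "algebraic_int z"
proof -
  obtain c where c: "\<And>i. i < n \<Longrightarrow> z * b i = (\<Sum>j<n. of_int (c i j :: int) * b j)"
    using st by metis
  define A where "A = mat n n (\<lambda>(i,j). c i j)"
  have A: "A \<in> carrier_mat n n" by (simp add: A_def)
  define B where "B = map_mat (of_int :: int \<Rightarrow> complex) A"
  have B: "B \<in> carrier_mat n n" using A by (simp add: B_def)
  define v where "v = vec n b"
  have "eigenvector B v z"
    unfolding eigenvector_def
  proof (intro conjI)
    show "v \<in> carrier_vec (dim_row B)" using B by (simp add: v_def)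
    show "v \<noteq> 0\<^sub>v (dim_row B)"
    proof
      assume "v = 0\<^sub>v (dim_row B)"
      hence "v $ k = 0" using k B by simp
      thus False using k by (simp add: v_def)
    qed
    show "B *\<^sub>v v = z \<cdot>\<^sub>v v"
    proof (rule eq_vecI)
      fix i assume "i < dim_vec (z \<cdot>\<^sub>v v)"
      hence i: "i < n" by (simp add: v_def)
      show "(B *\<^sub>v v) $ i = (z \<cdot>\<^sub>v v) $ i"
        using i c[OF i] by (simp add: v_def B_def A_def scalar_prod_def atLeast0LessThan)
    qed (use B in \<open>simp add: v_def\<close>)
  qed
  hence "eigenvalue B z" by (auto simp: eigenvalue_def)
  hence "poly (char_poly B) z = 0" using eigenvalue_root_char_poly[OF B] by simp
  moreover have "char_poly B = map_poly of_int (char_poly A)"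
    unfolding B_def by (rule of_int_hom.char_poly_hom[OF A])
  moreover have "Polynomial.coeff (char_poly A) (Polynomial.degree (char_poly A)) = 1"
    using degree_monic_char_poly[OF A] by simp
  ultimately show ?thesis
    unfolding algebraic_int_altdef_ipoly by metis
qed

lemma algebraic_int_powerE:
  fixes x :: complex
  assumes "algebraic_int x"
  obtains n :: nat and c :: "nat \<Rightarrow> int" where "n > 0" "x ^ n = (\<Sum>i<n. of_int (c i) * x ^ i)"
proof -
  obtain p :: "int poly" where p: "poly (map_poly of_int p) x = 0" "Polynomial.lead_coeff p = 1"
    using assms by (auto simp: algebraic_int_altdef_ipoly)
  define n where "n = Polynomial.degree p"
  have n: "n > 0"
  proof (rule ccontr)
    assume "\<not> n > 0"
    hence "p = [:Polynomial.lead_coeff p:]" by (metis degree_0_id n_def neq0_conv)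
    hence "p = 1" using p by (simp add: one_pCons)
    thus False using p by simp
  qed
  have "0 = (\<Sum>i\<le>n. of_int (Polynomial.coeff p i) * x ^ i)"
    using p by (simp add: poly_altdef degree_map_poly coeff_map_poly n_def)
  also have "\<dots> = x ^ n + (\<Sum>i<n. of_int (Polynomial.coeff p i) * x ^ i)"
    using p by (simp add: n_def lessThan_Suc_atMost[symmetric])
  finally have "x ^ n = (\<Sum>i<n. of_int (- Polynomial.coeff p i) * x ^ i)"
    by (simp add: sum_negf eq_neg_iff_add_eq_0)
  thus ?thesis using that[OF n, of "\<lambda>i. - Polynomial.coeff p i"] by simp
qed

text \<open>The monomials in x and y of bounded degree span a module stable under both numbers;
  pairs of exponents are encoded in a single index by division with remainder.\<close>

lemma algebraic_int_add_mult:
  fixes x y :: complex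
  assumes "algebraic_int x" "algebraic_int y"
  shows "algebraic_int (x + y) \<and> algebraic_int (x * y)"
proof -
  obtain n c where n: "n > 0" and c: "x ^ n = (\<Sum>i<n. of_int (c i :: int) * x ^ i)"
    using algebraic_int_powerE[OF assms(1)] .
  obtain m d where m: "m > 0" and d: "y ^ m = (\<Sum>i<m. of_int (d i :: int) * y ^ i)"
    using algebraic_int_powerE[OF assms(2)] .
  define b where "b k = x ^ (k div m) * y ^ (k mod m)" for k
  define S where "S = {w. \<exists>c::nat\<Rightarrow>int. w = (\<Sum>j<n*m. of_int (c j) * b j)}"
  have S_add: "u + w \<in> S" if u: "u \<in> S" and w: "w \<in> S" for u w
  proof -
    obtain c :: "nat \<Rightarrow> int" where "u = (\<Sum>j<n*m. of_int (c j) * b j)"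
      using u unfolding S_def by blast
    moreover obtain d :: "nat \<Rightarrow> int" where "w = (\<Sum>j<n*m. of_int (d j) * b j)"
      using w unfolding S_def by blast
    ultimately have "u + w = (\<Sum>j<n*m. of_int (c j + d j) * b j)"
      by (simp add: sum.distrib ring_distribs)
    thus ?thesis unfolding S_def by (auto intro!: exI[of _ "\<lambda>j. c j + d j"])
  qed
  have S_scale: "of_int e * w \<in> S" if w: "w \<in> S" for w and e :: int
  proof -
    obtain d :: "nat \<Rightarrow> int" where "w = (\<Sum>j<n*m. of_int (d j) * b j)"
      using w unfolding S_def by blast
    hence "of_int e * w = (\<Sum>j<n*m. of_int (e * d j) * b j)"
      by (simp add: sum_distrib_left mult_ac)
    thus ?thesis unfolding S_def by (auto intro!: exI[of _ "\<lambda>j. e * d j"])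
  qed
  have S_0: "0 \<in> S" unfolding S_def by (auto intro!: exI[of _ "\<lambda>j. 0"])
  have S_sum: "(\<Sum>i\<in>I. of_int (e i) * w i) \<in> S" if "\<And>i. i \<in> I \<Longrightarrow> w i \<in> S" for e :: "nat \<Rightarrow> int" and w I
    using that by (induction I rule: infinite_finite_induct) (auto simp: S_0 intro!: S_add S_scale)
  have b_in: "b k \<in> S" if "k < n * m" for k
    unfolding S_def using that
    by (auto intro!: exI[of _ "\<lambda>j. if j = k then 1 else 0"] simp: if_distrib[of "\<lambda>c. of_int c * _"] cong: if_cong)
  have xy: "x ^ i * y ^ j \<in> S" if "i < n" "j < m" for i j
  proof -
    have "i * m + j < n * m" using that
      by (metis add.commute add_less_cancel_left less_le_trans mult.commute mult_Suc_right mult_le_mono2 Suc_leI)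
    from b_in[OF this] show ?thesis using that by (simp add: b_def)
  qed
  have xS: "x * (x ^ i * y ^ j) \<in> S" if "i < n" "j < m" for i j
  proof (cases "Suc i < n")
    case True thus ?thesis using xy[OF True that(2)] by (simp add: mult_ac)
  next
    case False
    hence "Suc i = n" using that by simp
    hence "x * (x ^ i * y ^ j) = x ^ n * y ^ j" by (metis mult.assoc power_Suc)
    also have "\<dots> = (\<Sum>i<n. of_int (c i) * (x ^ i * y ^ j))" by (simp only: c sum_distrib_right mult.assoc)
    also have "\<dots> \<in> S" by (rule S_sum) (use that xy in auto)
    finally show ?thesis .
  qed
  have yS: "y * (x ^ i * y ^ j) \<in> S" if "i < n" "j < m" for i j
  proof (cases "Suc j < m")
    case True thus ?thesis using xy[OF that(1) True] by (simp add: mult_ac)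
  next
    case False
    hence "Suc j = m" using that by simp
    hence "y * (x ^ i * y ^ j) = x ^ i * y ^ m" by (metis mult.left_commute power_Suc)
    also have "\<dots> = (\<Sum>j<m. of_int (d j) * (x ^ i * y ^ j))" by (simp only: d sum_distrib_left mult.left_commute)
    also have "\<dots> \<in> S" by (rule S_sum) (use that xy in auto)
    finally show ?thesis .
  qed
  have bnd: "k div m < n" "k mod m < m" if "k < n * m" for k
    using that m by (auto simp: less_mult_imp_div_less)
  have xw: "x * w \<in> S" and yw: "y * w \<in> S" if w: "w \<in> S" for w
  proof -
    obtain e where e: "w = (\<Sum>j<n*m. of_int (e j :: int) * b j)" using w by (auto simp: S_def)
    have "x * w = (\<Sum>j<n*m. of_int (e j) * (x * b j))" by (simp add: e sum_distrib_left mult_ac)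
    also have "\<dots> \<in> S" by (rule S_sum) (use xS bnd in \<open>auto simp: b_def\<close>)
    finally show "x * w \<in> S" .
    have "y * w = (\<Sum>j<n*m. of_int (e j) * (y * b j))" by (simp add: e sum_distrib_left mult_ac)
    also have "\<dots> \<in> S" by (rule S_sum) (use yS bnd in \<open>auto simp: b_def\<close>)
    finally show "y * w \<in> S" .
  qed
  have "algebraic_int (x + y)"
  proof (rule algebraic_int_if_stable_span[of 0 "n*m" b])
    fix i assume "i < n * m"
    hence "x * b i + y * b i \<in> S" by (intro S_add xw yw b_in)
    thus "\<exists>c. (x + y) * b i = (\<Sum>j<n * m. of_int (c j) * b j)"
      by (auto simp: S_def ring_distribs)
  qed (use n m in \<open>auto simp: b_def\<close>)
  moreover have "algebraic_int (x * y)"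
  proof (rule algebraic_int_if_stable_span[of 0 "n*m" b])
    fix i assume "i < n * m"
    hence "x * (y * b i) \<in> S" by (intro xw yw b_in)
    thus "\<exists>c. (x * y) * b i = (\<Sum>j<n * m. of_int (c j) * b j)"
      by (auto simp: S_def mult.assoc)
  qed (use n m in \<open>auto simp: b_def\<close>)
  ultimately show ?thesis by simp
qed

lemma algebraic_int_add [intro]: "algebraic_int x \<Longrightarrow> algebraic_int y \<Longrightarrow> algebraic_int (x + y :: complex)"
  and algebraic_int_mult [intro]: "algebraic_int x \<Longrightarrow> algebraic_int y \<Longrightarrow> algebraic_int (x * y :: complex)"
  using algebraic_int_add_mult by auto

lemma algebraic_int_diff [intro]: "algebraic_int x \<Longrightarrow> algebraic_int y \<Longrightarrow> algebraic_int (x - y :: complex)"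
  using algebraic_int_add[of x "-y"] by auto

lemma algebraic_int_power [intro]: "algebraic_int x \<Longrightarrow> algebraic_int ((x::complex) ^ n)"
  by (induction n) auto

lemma algebraic_int_sum [intro]: "(\<And>i. i \<in> A \<Longrightarrow> algebraic_int (f i)) \<Longrightarrow> algebraic_int (sum f A :: complex)"
  by (induction A rule: infinite_finite_induct) auto

lemma algebraic_int_prod [intro]: "(\<And>i. i \<in> A \<Longrightarrow> algebraic_int (f i)) \<Longrightarrow> algebraic_int (prod f A :: complex)"
  by (induction A rule: infinite_finite_induct) auto

lemma algebraic_int_sqrt_of:
  fixes z :: complex
  assumes "algebraic_int (z ^ 2)" shows "algebraic_int z"
proof (rule algebraic_int_root[OF assms, of "[:0,0,1:]"])
  show "poly [:0,0,1:] z = z\<^sup>2" by (simp add: power2_eq_square)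
qed (auto simp: coeff_pCons split: nat.splits)

text \<open>Multiplying an integer equation of degree n with leading coefficient c by the power of c
  with exponent n - 1 turns it into a monic equation for cx.\<close>

lemma algebraic_multiple_integral:
  fixes x :: complex
  assumes "algebraic x"
  obtains c :: int where "c \<noteq> 0" "algebraic_int (of_int c * x)"
proof -
  obtain p :: "int poly" where p: "p \<noteq> 0" "poly (map_poly of_int p) x = 0"
    using algebraicE'[OF assms] by blast
  define n where "n = Polynomial.degree p"
  define c where "c = Polynomial.lead_coeff p"
  have c0: "c \<noteq> 0" using p by (simp add: c_def)
  define a where "a i = Polynomial.coeff p i" for i
  have ev: "(\<Sum>i\<le>n. of_int (a i) * x ^ i) = 0"
    using p by (simp add: poly_altdef degree_map_poly coeff_map_poly n_def a_def)
  have n: "n > 0"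
  proof (rule ccontr)
    assume "\<not> n > 0"
    thus False using ev c0 by (simp add: n_def c_def a_def)
  qed
  define z where "z = of_int c * x"
  define y :: "nat \<Rightarrow> complex" where "y i = of_int (if i < n then - a i * c ^ (n - 1 - i) else 0)" for i
  have "of_int (c ^ (n-1)) * (\<Sum>i\<le>n. of_int (a i) * x ^ i) = z ^ n - (\<Sum>i<n. y i * z ^ i)"
  proof -
    have "of_int (c ^ (n-1)) * (of_int (a n) * x ^ n) = z ^ n"
    proof -
      have "c ^ (n-1) * a n = c ^ n" using n by (simp add: a_def c_def n_def power_eq_if)
      hence "of_int (c ^ (n-1)) * of_int (a n) = (of_int (c ^ n) :: complex)" by (metis of_int_mult)
      thus ?thesis by (simp add: z_def power_mult_distrib mult.assoc[symmetric] del: of_int_power)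
    qed
    moreover have "of_int (c ^ (n-1)) * (of_int (a i) * x ^ i) = - (y i * z ^ i)" if "i < n" for i
    proof -
      have "n - 1 = (n - 1 - i) + i" using that by simp
      hence "c ^ (n - 1) = c ^ (n - 1 - i) * c ^ i" by (metis power_add)
      thus ?thesis using that by (simp add: y_def z_def power_mult_distrib)
    qed
    ultimately show ?thesis
      by (simp add: lessThan_Suc_atMost[symmetric] sum_distrib_left ring_distribs sum_negf)
  qed
  hence eq: "z ^ n = (\<Sum>i<n. y i * z ^ i)" using ev by simp
  have "algebraic_int z"
  proof (rule algebraic_int_if_stable_span[of 0 n "\<lambda>i. z ^ i"])
    fix i assume i: "i < n"
    show "\<exists>c. z * z ^ i = (\<Sum>j<n. of_int (c j) * z ^ j)"
    proof (cases "Suc i < n")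
      case True
      have "z * z ^ i = (\<Sum>j<n. of_int (if j = Suc i then 1 else 0) * z ^ j)"
        using True by (simp add: if_distrib[of "\<lambda>c. of_int c * _"] cong: if_cong)
      thus ?thesis by (intro exI[of _ "\<lambda>j. if j = Suc i then 1 else 0"])
    next
      case False
      hence "Suc i = n" using i by simp
      hence "z * z ^ i = z ^ n" by auto
      thus ?thesis unfolding eq y_def by (intro exI[of _ "\<lambda>i. if i < n then - a i * c ^ (n - 1 - i) else 0"]) simp
    qed
  qed (use n in auto)
  thus ?thesis using that c0 by (simp add: z_def)
qed

lemma algebraic_if_multiple:
  fixes x :: complex
  assumes "c \<noteq> 0" "algebraic (of_int c * x)"
  shows "algebraic x"
proof -
  obtain p where p: "\<And>i. Polynomial.coeff p i \<in> \<int>" "p \<noteq> 0" "poly p (of_int c * x) = 0"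
    using assms(2) unfolding algebraic_def by blast
  let ?q = "pcompose p [:0, of_int c:]"
  show ?thesis
  proof (rule algebraicI)
    show "Polynomial.coeff ?q i \<in> \<int>" for i
      by (rule coeff_pcompose_semiring_closed) (use p in \<open>auto simp: coeff_pCons split: nat.splits\<close>)
    show "?q \<noteq> 0" using p assms(1) by (simp add: pcompose_eq_0_iff)
    show "poly ?q x = 0" using p by (simp add: poly_pcompose mult.commute)
  qed
qed

lemma algebraic_add_mult:
  fixes x y :: complex
  assumes "algebraic x" "algebraic y"
  shows "algebraic (x + y)" "algebraic (x * y)"
proof -
  obtain c :: int where c: "c \<noteq> 0" "algebraic_int (of_int c * x)" using algebraic_multiple_integral[OF assms(1)] .
  obtain d :: int where d: "d \<noteq> 0" "algebraic_int (of_int d * y)" using algebraic_multiple_integral[OF assms(2)] .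
  have "algebraic_int (of_int d * (of_int c * x) + of_int c * (of_int d * y))"
    by (rule algebraic_int_add[OF algebraic_int_mult[OF algebraic_int_of_int c(2)] algebraic_int_mult[OF algebraic_int_of_int d(2)]])
  also have "of_int d * (of_int c * x) + of_int c * (of_int d * y) = of_int (c * d) * (x + y)"
    by (simp add: algebra_simps)
  finally show "algebraic (x + y)"
    using c d by (intro algebraic_if_multiple[of "c * d" "x + y"]) auto
  have "algebraic_int ((of_int c * x) * (of_int d * y))"
    using c(2) d(2) by (rule algebraic_int_mult)
  also have "(of_int c * x) * (of_int d * y) = of_int (c * d) * (x * y)"
    by (simp add: algebra_simps)
  finally show "algebraic (x * y)"
    using c d by (intro algebraic_if_multiple[of "c * d" "x * y"]) auto
qed

section \<open>Embeddings of fields of algebraic numbers\<close>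

definition is_ring :: "complex set \<Rightarrow> bool" where
  "is_ring R \<longleftrightarrow> 1 \<in> R \<and> (\<forall>x\<in>R. \<forall>y\<in>R. x - y \<in> R \<and> x * y \<in> R)"

definition is_field :: "complex set \<Rightarrow> bool" where
  "is_field F \<longleftrightarrow> is_ring F \<and> (\<forall>x\<in>F. inverse x \<in> F)"

lemma is_field_imp_ring [dest]: "is_field F \<Longrightarrow> is_ring F"
  by (simp add: is_field_def)

context
  fixes R assumes R: "is_ring R"
begin

lemma ring_1: "1 \<in> R"
  and ring_diff: "x \<in> R \<Longrightarrow> y \<in> R \<Longrightarrow> x - y \<in> R"
  and ring_mult: "x \<in> R \<Longrightarrow> y \<in> R \<Longrightarrow> x * y \<in> R"
  using R by (auto simp: is_ring_def)

lemma ring_0: "0 \<in> R" using ring_diff[of 1 1] ring_1 by simp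

lemma ring_minus: "x \<in> R \<Longrightarrow> - x \<in> R" using ring_diff[of 0 x] ring_0 by simp

lemma ring_add: "x \<in> R \<Longrightarrow> y \<in> R \<Longrightarrow> x + y \<in> R" using ring_diff[of x "-y"] ring_minus by simp

lemma ring_of_nat: "of_nat n \<in> R" by (induction n) (auto simp: ring_0 intro: ring_add ring_1)

lemma ring_of_int: "of_int n \<in> R"
  by (cases n rule: int_cases2) (auto intro: ring_of_nat ring_minus)

lemma ring_numeral: "numeral n \<in> R" using ring_of_nat[of "numeral n"] by simp

lemma ring_power: "x \<in> R \<Longrightarrow> x ^ n \<in> R" by (induction n) (auto intro: ring_mult ring_1)

lemma ring_sum: "(\<And>i. i \<in> A \<Longrightarrow> f i \<in> R) \<Longrightarrow> sum f A \<in> R"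
  by (induction A rule: infinite_finite_induct) (auto simp: ring_0 intro: ring_add)

lemma ring_prod: "(\<And>i. i \<in> A \<Longrightarrow> f i \<in> R) \<Longrightarrow> prod f A \<in> R"
  by (induction A rule: infinite_finite_induct) (auto simp: ring_1 intro: ring_mult)

lemmas ring_closed = ring_1 ring_0 ring_diff ring_mult ring_minus ring_add ring_of_nat ring_of_int
  ring_numeral ring_power

end

lemma field_inverse: "is_field F \<Longrightarrow> x \<in> F \<Longrightarrow> inverse x \<in> F"
  by (simp add: is_field_def)

lemma field_divide: "is_field F \<Longrightarrow> x \<in> F \<Longrightarrow> y \<in> F \<Longrightarrow> x / y \<in> F"
  by (simp add: divide_inverse field_inverse ring_mult is_field_imp_ring)

lemma field_Rats: "is_field F \<Longrightarrow> x \<in> \<rat> \<Longrightarrow> x \<in> F"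
  by (auto elim!: Rats_cases' intro!: field_divide ring_of_int)

lemma is_field_Qbar: "is_field Qbar"
proof -
  have "x - y \<in> Qbar" if "x \<in> Qbar" "y \<in> Qbar" for x y
    using algebraic_add_mult(1)[of x "-y"] that by (auto simp: Qbar_def)
  thus ?thesis
    by (auto simp: is_field_def is_ring_def Qbar_def intro: algebraic_add_mult rat_imp_algebraic)
qed

lemma is_field_Rats: "is_field (\<rat>)"
  by (auto simp: is_field_def is_ring_def)

lemma Rats_Qbar: "\<rat> \<subseteq> Qbar"
  by (auto simp: Qbar_def rat_imp_algebraic)

lemma algebraic_int_Qbar: "algebraic_int x \<Longrightarrow> x \<in> Qbar"
  by (auto simp: Qbar_def)

definition polys :: "complex set \<Rightarrow> complex poly set" where
  "polys R = {q. \<forall>i. Polynomial.coeff q i \<in> R}"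

lemma polys_mono: "R \<subseteq> S \<Longrightarrow> polys R \<subseteq> polys S"
  by (auto simp: polys_def)

lemma lead_coeff_polys: "q \<in> polys R \<Longrightarrow> Polynomial.coeff q n \<in> R"
  by (simp add: polys_def)

context
  fixes R assumes R: "is_ring R"
begin

lemma polys_diff: "p \<in> polys R \<Longrightarrow> q \<in> polys R \<Longrightarrow> p - q \<in> polys R"
  and polys_smult: "c \<in> R \<Longrightarrow> q \<in> polys R \<Longrightarrow> Polynomial.smult c q \<in> polys R"
  and polys_pCons: "c \<in> R \<Longrightarrow> q \<in> polys R \<Longrightarrow> pCons c q \<in> polys R"
  and polys_monom: "c \<in> R \<Longrightarrow> Polynomial.monom c n \<in> polys R"
  and polys_mult: "p \<in> polys R \<Longrightarrow> q \<in> polys R \<Longrightarrow> p * q \<in> polys R"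
  and polys_0: "0 \<in> polys R"
  using R by (auto simp: polys_def ring_closed coeff_mult coeff_pCons intro!: ring_sum split: nat.splits)

lemma polys_1: "1 \<in> polys R"
  using R by (simp add: one_pCons polys_pCons polys_0 ring_1)

lemma polys_prod: "(\<And>i. i \<in> A \<Longrightarrow> f i \<in> polys R) \<Longrightarrow> prod f A \<in> polys R"
  by (induction A rule: infinite_finite_induct) (auto intro: polys_1 polys_mult)

lemma poly_closed: "q \<in> polys R \<Longrightarrow> x \<in> R \<Longrightarrow> poly q x \<in> R"
  unfolding poly_altdef using R by (intro ring_sum) (auto simp: polys_def intro!: ring_mult ring_power)

end

text \<open>An integer equation with nonzero constant term expresses the inverse of a root as a
  polynomial in the root. This makes rings of algebraic numbers over the rationals into fields.\<close>

lemma algebraic_inverse_poly: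
  assumes "x \<in> Qbar" "x \<noteq> 0"
  obtains r where "r \<in> polys \<rat>" "inverse x = poly r x"
proof -
  obtain p :: "int poly" where p: "p \<noteq> 0" "Polynomial.coeff p 0 \<noteq> 0" "poly (map_poly of_int p) x = 0"
    using algebraicE'_nonzero[of x] assms by (auto simp: Qbar_def)
  obtain c p' where pc: "p = pCons c p'" by (cases p)
  define q where "q = (map_poly of_int p' :: complex poly)"
  have eq: "of_int c + x * poly q x = 0" using p by (simp add: pc map_poly_pCons q_def)
  have c: "c \<noteq> 0" using p by (simp add: pc)
  define r where "r = Polynomial.smult (- inverse (of_int c)) q"
  have "x * poly r x = - (inverse (of_int c) * (x * poly q x))" by (simp add: r_def)
  also have "x * poly q x = - of_int c" using eq by (simp add: eq_neg_iff_add_eq_0 add.commute)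
  finally have "x * poly r x = 1" using c by simp
  hence "inverse x = poly r x" using assms by (simp add: field_simps)
  moreover have "r \<in> polys \<rat>"
    unfolding r_def q_def by (auto simp: polys_def coeff_map_poly)
  ultimately show ?thesis using that by blast
qed

lemma algebraic_ring_is_field:
  assumes "is_ring R" "\<rat> \<subseteq> R" "R \<subseteq> Qbar"
  shows "is_field R"
  unfolding is_field_def
proof (intro conjI ballI)
  fix x assume x: "x \<in> R"
  show "inverse x \<in> R"
  proof (cases "x = 0")
    case False
    then obtain r where "r \<in> polys \<rat>" "inverse x = poly r x"
      using algebraic_inverse_poly[of x] x assms by blast
    thus ?thesis using poly_closed[OF assms(1) _ x] polys_mono[OF assms(2)] by auto
  qed (use ring_0[OF assms(1)] in auto)
qed (rule assms)

definition emb :: "complex set \<Rightarrow> (complex \<Rightarrow> complex) \<Rightarrow> bool" where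
  "emb E s \<longleftrightarrow> s 1 = 1 \<and> (\<forall>x\<in>E. \<forall>y\<in>E. s (x - y) = s x - s y \<and> s (x * y) = s x * s y)"

context
  fixes E s assumes E: "is_ring E" and s: "emb E s"
begin

lemma emb_1: "s 1 = 1"
  and emb_diff: "x \<in> E \<Longrightarrow> y \<in> E \<Longrightarrow> s (x - y) = s x - s y"
  and emb_mult: "x \<in> E \<Longrightarrow> y \<in> E \<Longrightarrow> s (x * y) = s x * s y"
  using s by (auto simp: emb_def)

lemma emb_0: "s 0 = 0" using emb_diff[of 1 1] ring_1[OF E] by simp

lemma emb_minus: "x \<in> E \<Longrightarrow> s (- x) = - s x"
  using emb_diff[of 0 x] ring_0[OF E] emb_0 by simp

lemma emb_add: "x \<in> E \<Longrightarrow> y \<in> E \<Longrightarrow> s (x + y) = s x + s y"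
  using emb_diff[of x "-y"] ring_minus[OF E] emb_minus by simp

lemma emb_of_nat: "s (of_nat n) = of_nat n"
  by (induction n) (auto simp: emb_0 emb_1 emb_add ring_closed[OF E])

lemma emb_of_int: "s (of_int n) = of_int n"
  by (cases n rule: int_cases2) (auto simp: emb_of_nat emb_minus ring_closed[OF E])

lemma emb_numeral: "s (numeral n) = numeral n"
  using emb_of_nat[of "numeral n"] by simp

lemma emb_power: "x \<in> E \<Longrightarrow> s (x ^ n) = s x ^ n"
  by (induction n) (auto simp: emb_1 emb_mult ring_closed[OF E])

lemma emb_sum: "(\<And>i. i \<in> A \<Longrightarrow> f i \<in> E) \<Longrightarrow> s (sum f A) = (\<Sum>i\<in>A. s (f i))"
  by (induction A rule: infinite_finite_induct) (auto simp: emb_0 emb_add ring_sum[OF E])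

lemma emb_prod: "(\<And>i. i \<in> A \<Longrightarrow> f i \<in> E) \<Longrightarrow> s (prod f A) = (\<Prod>i\<in>A. s (f i))"
  by (induction A rule: infinite_finite_induct) (auto simp: emb_1 emb_mult ring_prod[OF E])

lemma emb_poly:
  assumes "q \<in> polys E" "x \<in> E" shows "s (poly q x) = poly (map_poly s q) (s x)"
proof -
  have q: "Polynomial.coeff q i \<in> E" for i using assms(1) by (simp add: polys_def)
  have "s (poly q x) = (\<Sum>i\<le>Polynomial.degree q. s (Polynomial.coeff q i) * s x ^ i)"
    unfolding poly_altdef using q assms(2)
    by (subst emb_sum) (auto simp: emb_mult emb_power ring_closed[OF E])
  also have "\<dots> = (\<Sum>i\<le>Polynomial.degree q. Polynomial.coeff (map_poly s q) i * s x ^ i)"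
    by (simp add: coeff_map_poly emb_0)
  also have "\<dots> = poly (map_poly s q) (s x)"
    by (rule poly_as_sum_of_monoms' [THEN arg_cong[where f = "\<lambda>p. poly p (s x)"], simplified poly_sum poly_monom])
       (simp add: degree_map_poly_le)
  finally show ?thesis .
qed

lemma map_poly_emb_diff: "p \<in> polys E \<Longrightarrow> q \<in> polys E \<Longrightarrow> map_poly s (p - q) = map_poly s p - map_poly s q"
  and map_poly_emb_mult: "p \<in> polys E \<Longrightarrow> q \<in> polys E \<Longrightarrow> map_poly s (p * q) = map_poly s p * map_poly s q"
  by (rule poly_eqI; simp add: coeff_map_poly emb_0 polys_def emb_diff emb_mult coeff_mult emb_sum ring_mult[OF E])+

end

lemma emb_inverse:
  assumes "is_field E" "emb E s" "x \<in> E" shows "s (inverse x) = inverse (s x)"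
proof (cases "x = 0")
  case False
  have "s x * s (inverse x) = s (x * inverse x)"
    using assms by (simp add: emb_mult[of E s] is_field_imp_ring field_inverse)
  also have "\<dots> = 1" using False assms by (simp add: emb_1[of E s] is_field_imp_ring)
  finally show ?thesis by (metis inverse_unique)
qed (use emb_0[OF is_field_imp_ring[OF assms(1)] assms(2)] in auto)

lemma emb_divide:
  assumes "is_field E" "emb E s" "x \<in> E" "y \<in> E" shows "s (x / y) = s x / s y"
  using assms by (simp add: divide_inverse emb_inverse emb_mult[of E] field_inverse is_field_imp_ring)

lemma emb_Rats:
  assumes "is_field E" "emb E s" "x \<in> \<rat>" shows "s x = x"
  using assms(3) by (auto elim!: Rats_cases' simp: emb_divide[OF assms(1,2)] ring_of_int is_field_imp_ring[OF assms(1)] emb_of_int[OF _ assms(2)])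

lemma emb_eq_0:
  assumes "is_field E" "emb E s" "x \<in> E" shows "s x = 0 \<longleftrightarrow> x = 0"
  using emb_inverse[OF assms] emb_mult[OF is_field_imp_ring[OF assms(1)] assms(2) assms(3), of "inverse x"]
    emb_1[OF _ assms(2)] emb_0[OF _ assms(2)] assms(1,3) by (cases "x = 0") (auto simp: field_inverse is_field_imp_ring)

lemma emb_inj:
  assumes "is_field E" "emb E s" shows "inj_on s E"
proof (rule inj_onI)
  fix x y assume xy: "x \<in> E" "y \<in> E" "s x = s y"
  hence "s (x - y) = 0" using emb_diff[of E s x y] assms by auto
  thus "x = y" using emb_eq_0[OF assms, of "x - y"] ring_diff[OF _ xy(1,2)] assms by auto
qed

lemma map_poly_Rats:
  assumes "is_field E" "emb E s" "q \<in> polys \<rat>" shows "map_poly s q = q"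
  using assms emb_Rats[OF assms(1,2)] by (intro poly_eqI) (simp add: coeff_map_poly polys_def)

lemma emb_poly_Rats:
  assumes "is_field E" "emb E s" "q \<in> polys \<rat>" "x \<in> E" shows "s (poly q x) = poly q (s x)"
  using emb_poly[of E s q x] assms polys_mono[of "\<rat>" E] field_Rats[OF assms(1)] map_poly_Rats[OF assms(1-3)]
  by (metis is_field_imp_ring subset_iff)

lemma Qbar_rat_poly:
  assumes "x \<in> Qbar" obtains p where "p \<in> polys \<rat>" "p \<noteq> 0" "poly p x = 0"
  using assms by (auto simp: Qbar_def algebraic_altdef polys_def)

lemma emb_Qbar:
  assumes "is_field E" "emb E s" "x \<in> E" "x \<in> Qbar" shows "s x \<in> Qbar"
proof -
  obtain p where p: "p \<in> polys \<rat>" "p \<noteq> 0" "poly p x = 0" using Qbar_rat_poly[OF assms(4)] .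
  have "poly p (s x) = s (poly p x)" using emb_poly_Rats[OF assms(1,2) p(1) assms(3)] by simp
  also have "\<dots> = 0" using p emb_0[OF _ assms(2)] assms(1) by auto
  finally show ?thesis using p by (auto simp: Qbar_def algebraic_altdef polys_def)
qed

text \<open>Minimality is stated through degrees; irreducibility and unique factorisation over E then
  never enter.\<close>

definition minpoly :: "complex set \<Rightarrow> complex \<Rightarrow> complex poly \<Rightarrow> bool" where
  "minpoly E x f \<longleftrightarrow> f \<in> polys E \<and> Polynomial.lead_coeff f = 1 \<and> poly f x = 0 \<and>
     (\<forall>q\<in>polys E. q \<noteq> 0 \<longrightarrow> poly q x = 0 \<longrightarrow> Polynomial.degree f \<le> Polynomial.degree q)"

lemma minpoly_exists:
  assumes E: "is_field E" and x: "x \<in> Qbar"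
  obtains f where "minpoly E x f"
proof -
  let ?P = "\<lambda>q. q \<in> polys E \<and> q \<noteq> 0 \<and> poly q x = 0"
  obtain p where "p \<in> polys \<rat>" "p \<noteq> 0" "poly p x = 0" using Qbar_rat_poly[OF x] .
  hence "?P p" using polys_mono[of "\<rat>" E] field_Rats[OF E] by auto
  then obtain f where f: "?P f" "\<And>q. ?P q \<Longrightarrow> Polynomial.degree f \<le> Polynomial.degree q"
    using ex_has_least_nat[of ?P p Polynomial.degree] by blast
  let ?f = "Polynomial.smult (inverse (Polynomial.lead_coeff f)) f"
  have "?f \<in> polys E" using f E by (auto intro!: polys_smult field_inverse lead_coeff_polys)
  moreover have "Polynomial.lead_coeff ?f = 1" using f by simp
  ultimately show ?thesis using that[of ?f] f by (auto simp: minpoly_def)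
qed

lemma minpoly_degree_pos: "minpoly E x f \<Longrightarrow> Polynomial.degree f > 0"
  by (rule ccontr) (auto simp: minpoly_def elim!: degree_eq_zeroE)

text \<open>Division by f, one leading term at a time so that all coefficients stay in E and the
  division can be carried along s.\<close>

lemma minpoly_root_transfer:
  assumes E: "is_field E" and s: "emb E s" and f: "minpoly E x f" and y: "poly (map_poly s f) y = 0"
    and q: "q \<in> polys E" "poly q x = 0"
  shows "poly (map_poly s q) y = 0"
  using q
proof (induction "Polynomial.degree q" arbitrary: q rule: less_induct)
  case less
  show ?case
  proof (cases "q = 0")
    case False
    have f': "f \<in> polys E" "Polynomial.lead_coeff f = 1" "poly f x = 0" using f by (auto simp: minpoly_def)
    have df: "Polynomial.degree f \<le> Polynomial.degree q" using f less.prems False by (auto simp: minpoly_def)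
    define m where "m = Polynomial.monom (Polynomial.lead_coeff q) (Polynomial.degree q - Polynomial.degree f)"
    have R: "is_ring E" using E by auto
    have m: "m \<in> polys E" unfolding m_def using less.prems R by (intro polys_monom) (auto intro: lead_coeff_polys)
    define q' where "q' = q - m * f"
    have q': "q' \<in> polys E" unfolding q'_def using R m f' less.prems by (auto intro: polys_diff polys_mult)
    have r': "poly q' x = 0" using less.prems f' by (simp add: q'_def)
    have "poly (map_poly s q') y = 0"
    proof (cases "q' = 0")
      case nz: False
      have m0: "m \<noteq> 0" using False by (simp add: m_def)
      have fnz: "f \<noteq> 0" using f' by auto
      have "Polynomial.degree (m * f) = Polynomial.degree q"
        using m0 fnz df False by (simp add: degree_mult_eq m_def degree_monom_eq)
      moreover have "Polynomial.lead_coeff (m * f) = Polynomial.lead_coeff q"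
        using False f' by (simp add: lead_coeff_mult m_def degree_monom_eq)
      ultimately have c: "Polynomial.coeff q' (Polynomial.degree q) = 0" "Polynomial.degree q' \<le> Polynomial.degree q"
        by (auto simp: q'_def intro: degree_diff_le)
      have "Polynomial.degree q' \<noteq> Polynomial.degree q"
        using c nz by (metis leading_coeff_0_iff)
      hence "Polynomial.degree q' < Polynomial.degree q" using c by simp
      thus ?thesis using less.hyps q' r' by blast
    qed auto
    moreover have "map_poly s q' = map_poly s q - map_poly s m * map_poly s f"
      unfolding q'_def using R s m f' less.prems
      by (simp add: map_poly_emb_diff[of E] map_poly_emb_mult[of E] polys_mult)
    ultimately show ?thesis using y by simp
  qed auto
qed

definition adjoin :: "complex set \<Rightarrow> complex \<Rightarrow> complex set" where
  "adjoin E x = (\<lambda>q. poly q x) ` polys E"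

lemma adjoin_field:
  assumes E: "is_field E" "E \<subseteq> Qbar" and x: "x \<in> Qbar"
  shows "is_field (adjoin E x)" "E \<subseteq> adjoin E x" "x \<in> adjoin E x" "adjoin E x \<subseteq> Qbar"
proof -
  have R: "is_ring E" using E by auto
  show sub: "E \<subseteq> adjoin E x"
  proof
    fix a assume "a \<in> E"
    hence "poly [:a:] x \<in> adjoin E x" unfolding adjoin_def using R by (intro imageI polys_pCons polys_0)
    thus "a \<in> adjoin E x" by simp
  qed
  have "poly [:0,1:] x \<in> adjoin E x" unfolding adjoin_def using R by (intro imageI polys_pCons polys_0 ring_closed)
  thus "x \<in> adjoin E x" by simp
  show Q: "adjoin E x \<subseteq> Qbar"
    using poly_closed[OF is_field_imp_ring[OF is_field_Qbar] _ x] polys_mono[OF E(2)] by (auto simp: adjoin_def)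
  have "is_ring (adjoin E x)"
    unfolding is_ring_def
  proof (intro conjI ballI)
    show "1 \<in> adjoin E x" using sub R ring_1 by blast
    fix a b assume "a \<in> adjoin E x" "b \<in> adjoin E x"
    then obtain p q where pq: "p \<in> polys E" "q \<in> polys E" and ab: "a = poly p x" "b = poly q x"
      by (auto simp: adjoin_def)
    have "a - b = poly (p - q) x" "a * b = poly (p * q) x" using ab by simp_all
    thus "a - b \<in> adjoin E x" "a * b \<in> adjoin E x"
      using polys_diff[OF R] polys_mult[OF R] pq unfolding adjoin_def by blast+
  qed
  thus "is_field (adjoin E x)"
    using algebraic_ring_is_field Q sub field_Rats[OF E(1)] by blast
qed

text \<open>Sending x to any root of the transported minimal polynomial extends an embedding: the value at
  q(x) does not depend on the choice of q by the previous lemma.\<close>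

lemma emb_extend_one:
  assumes E: "is_field E" "E \<subseteq> Qbar" and s: "emb E s" and x: "x \<in> Qbar"
    and f: "minpoly E x f" and y: "poly (map_poly s f) y = 0"
  obtains t where "emb (adjoin E x) t" "\<And>a. a \<in> E \<Longrightarrow> t a = s a" "t x = y"
proof -
  have R: "is_ring E" using E by auto
  define c where "c z = (SOME q. q \<in> polys E \<and> poly q x = z)" for z
  define t where "t z = poly (map_poly s (c z)) y" for z
  have t: "t (poly q x) = poly (map_poly s q) y" if q: "q \<in> polys E" for q
  proof -
    have c: "c (poly q x) \<in> polys E \<and> poly (c (poly q x)) x = poly q x"
      unfolding c_def by (rule someI[of _ q]) (use q in auto)
    have "poly (map_poly s (c (poly q x) - q)) y = 0"
      by (rule minpoly_root_transfer[OF E(1) s f y]) (use c q R in \<open>auto intro: polys_diff\<close>)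
    thus ?thesis unfolding t_def using c q by (simp add: map_poly_emb_diff[OF R s])
  qed
  have tE: "t a = s a" if "a \<in> E" for a
  proof -
    have "t (poly [:a:] x) = poly (map_poly s [:a:]) y" using that R by (intro t polys_pCons polys_0)
    moreover have "map_poly s [:a:] = [:s a:]"
      by (rule poly_eqI) (simp add: coeff_map_poly emb_0[OF R s] coeff_pCons split: nat.splits)
    ultimately show ?thesis by simp
  qed
  have "t (poly [:0,1:] x) = poly (map_poly s [:0,1:]) y" using R by (intro t polys_pCons polys_0 ring_closed)
  hence tx: "t x = y" by (simp add: map_poly_pCons emb_0[OF R s] emb_1[OF R s])
  have "emb (adjoin E x) t"
    unfolding emb_def
  proof (intro conjI ballI)
    show "t 1 = 1" using tE[OF ring_1[OF R]] emb_1[OF R s] by simp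
    fix a b assume "a \<in> adjoin E x" "b \<in> adjoin E x"
    then obtain p q where pq: "p \<in> polys E" "q \<in> polys E" and ab: "a = poly p x" "b = poly q x"
      by (auto simp: adjoin_def)
    have "a - b = poly (p - q) x" "a * b = poly (p * q) x" using ab by simp_all
    thus "t (a - b) = t a - t b" "t (a * b) = t a * t b"
      using t[OF polys_diff[OF R pq]] t[OF polys_mult[OF R pq]] t pq ab
      by (auto simp: map_poly_emb_diff[OF R s] map_poly_emb_mult[OF R s])
  qed
  thus ?thesis using that tE tx by blast
qed

text \<open>Graphs of embeddings are ordered by inclusion, as Zorn's lemma wants. Closure under
  differences reduces single-valuedness to its instance at 0, and the convention that 0 is its own
  inverse lets the closure under inverses hold without exception.\<close>

definition emb_graph :: "(complex \<times> complex) set \<Rightarrow> bool" where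
  "emb_graph g \<longleftrightarrow> (1, 1) \<in> g \<and> (\<forall>a b c d. (a, b) \<in> g \<longrightarrow> (c, d) \<in> g \<longrightarrow> (a - c, b - d) \<in> g \<and> (a * c, b * d) \<in> g) \<and>
     (\<forall>a b. (a, b) \<in> g \<longrightarrow> (inverse a, inverse b) \<in> g) \<and> (\<forall>b. (0, b) \<in> g \<longrightarrow> b = 0) \<and> Domain g \<subseteq> Qbar"

lemma emb_graph_of_emb:
  assumes "is_field E" "E \<subseteq> Qbar" "emb E s" shows "emb_graph ((\<lambda>x. (x, s x)) ` E)"
  using assms emb_1[OF _ assms(3)] emb_diff[OF _ assms(3)] emb_mult[OF _ assms(3)]
    emb_0[OF _ assms(3)] emb_inverse[OF assms(1,3)] 
  unfolding emb_graph_def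
  by (auto simp: image_iff is_field_imp_ring ring_closed field_inverse)

lemma emb_of_graph:
  assumes g: "emb_graph g"
  obtains s where "is_field (Domain g)" "emb (Domain g) s" "g = (\<lambda>x. (x, s x)) ` Domain g"
proof -
  have d: "(a - c, b - d) \<in> g" "(a * c, b * d) \<in> g" if "(a, b) \<in> g" "(c, d) \<in> g" for a b c d
    using g that unfolding emb_graph_def by blast+
  have one: "(1,1) \<in> g" and inv: "(inverse a, inverse b) \<in> g" if "(a, b) \<in> g" for a b
    using g that unfolding emb_graph_def by blast+
  have uniq: "b = c" if "(a, b) \<in> g" "(a, c) \<in> g" for a b c
    using d(1)[OF that] g unfolding emb_graph_def by (metis cancel_comm_monoid_add_class.diff_cancel eq_iff_diff_eq_0)
  have one: "(1,1) \<in> g" using g unfolding emb_graph_def by blast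
  define s where "s x = (THE y. (x, y) \<in> g)" for x
  have s: "(x, y) \<in> g \<Longrightarrow> s x = y" for x y
    unfolding s_def using uniq by blast
  have s': "x \<in> Domain g \<Longrightarrow> (x, s x) \<in> g" for x using s by auto
  have "is_field (Domain g)"
    unfolding is_field_def is_ring_def
  proof (intro conjI ballI)
    show "1 \<in> Domain g" using one by (rule DomainI)
    fix x assume "x \<in> Domain g"
    then obtain a where x: "(x, a) \<in> g" by (rule DomainE)
    show "inverse x \<in> Domain g" using inv[OF x] by (rule DomainI)
    fix y assume "y \<in> Domain g"
    then obtain b where y: "(y, b) \<in> g" by (rule DomainE)
    show "x - y \<in> Domain g" "x * y \<in> Domain g" using d[OF x y] by (auto intro: DomainI)
  qed
  moreover have "emb (Domain g) s"
    unfolding emb_def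
  proof (intro conjI ballI)
    show "s 1 = 1" using one by (rule s)
    fix x y assume "x \<in> Domain g" "y \<in> Domain g"
    hence "(x, s x) \<in> g" "(y, s y) \<in> g" by (auto intro: s')
    thus "s (x - y) = s x - s y" "s (x * y) = s x * s y" using d by (auto intro!: s)
  qed
  moreover have "g = (\<lambda>x. (x, s x)) ` Domain g" using s by (force simp: image_iff)
  ultimately show ?thesis using that by blast
qed

lemma emb_graph_Union:
  assumes "C \<noteq> {}" "\<And>g. g \<in> C \<Longrightarrow> emb_graph g" "\<And>g h. g \<in> C \<Longrightarrow> h \<in> C \<Longrightarrow> g \<subseteq> h \<or> h \<subseteq> g"
  shows "emb_graph (\<Union>C)"
  unfolding emb_graph_def
proof (intro conjI allI impI)
  show "(1,1) \<in> \<Union>C" using assms(1,2) unfolding emb_graph_def by blast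
  fix a b assume ab: "(a, b) \<in> \<Union>C"
  show "(inverse a, inverse b) \<in> \<Union>C" using ab assms(2) unfolding emb_graph_def by blast
  fix c d assume cd: "(c, d) \<in> \<Union>C"
  obtain g where "g \<in> C" "(a, b) \<in> g" "(c, d) \<in> g" using ab cd assms(3) by blast
  thus "(a - c, b - d) \<in> \<Union>C" "(a * c, b * d) \<in> \<Union>C" using assms(2) unfolding emb_graph_def by blast+
next
  fix b assume "(0, b) \<in> \<Union>C" thus "b = 0" using assms(2) unfolding emb_graph_def by blast
next
  show "Domain (\<Union>C) \<subseteq> Qbar" using assms(2) unfolding emb_graph_def by blast
qed

text \<open>A maximal embedding is defined on all algebraic numbers, since a complex root of a
  transported minimal polynomial would extend it otherwise.\<close>

theorem emb_extend:
  assumes E: "is_field E" "E \<subseteq> Qbar" and s: "emb E s"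
  obtains t where "emb Qbar t" "\<And>x. x \<in> E \<Longrightarrow> t x = s x"
proof -
  define g0 where "g0 = (\<lambda>x. (x, s x)) ` E"
  define \<G> where "\<G> = {g. emb_graph g \<and> g0 \<subseteq> g}"
  have g0: "g0 \<in> \<G>" using emb_graph_of_emb[OF E s] by (simp add: \<G>_def g0_def)
  have "\<exists>m\<in>\<G>. \<forall>g\<in>\<G>. m \<subseteq> g \<longrightarrow> g = m"
  proof (rule subset_Zorn_nonempty)
    fix C assume ne: "C \<noteq> {}" and C: "subset.chain \<G> C"
    have sub: "C \<subseteq> \<G>" and ch: "\<And>g h. g \<in> C \<Longrightarrow> h \<in> C \<Longrightarrow> g \<subseteq> h \<or> h \<subseteq> g"
      using C by (auto simp: subset_chain_def)
    have "emb_graph (\<Union>C)" using emb_graph_Union[OF ne _ ch] sub by (auto simp: \<G>_def)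
    thus "\<Union>C \<in> \<G>" using sub ne by (auto simp: \<G>_def)
  qed (use g0 in auto)
  then obtain m where m: "m \<in> \<G>" "\<And>g. g \<in> \<G> \<Longrightarrow> m \<subseteq> g \<Longrightarrow> g = m" by blast
  obtain t where t: "is_field (Domain m)" "emb (Domain m) t" "m = (\<lambda>x. (x, t x)) ` Domain m"
    using emb_of_graph[of m] m by (auto simp: \<G>_def)
  have dQ: "Domain m \<subseteq> Qbar" using m by (simp add: \<G>_def emb_graph_def)
  have "x \<in> Domain m" if x: "x \<in> Qbar" for x
  proof -
    obtain f where f: "minpoly (Domain m) x f" using minpoly_exists[OF t(1) x] .
    have "Polynomial.degree (map_poly t f) = Polynomial.degree f"
      using f emb_1[OF is_field_imp_ring[OF t(1)] t(2)]
      by (intro degree_map_poly) (auto simp: minpoly_def)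
    hence "Polynomial.degree (map_poly t f) > 0" using minpoly_degree_pos[OF f] by simp
    then obtain y where y: "poly (map_poly t f) y = 0" using alg_closed_imp_poly_has_root by blast
    obtain u where u: "emb (adjoin (Domain m) x) u" "\<And>a. a \<in> Domain m \<Longrightarrow> u a = t a"
      using emb_extend_one[OF t(1) dQ t(2) x f y] by metis
    note adj = adjoin_field[OF t(1) dQ x]
    define g where "g = (\<lambda>x. (x, u x)) ` adjoin (Domain m) x"
    have mg: "m \<subseteq> g" 
    proof -
      have "m = (\<lambda>x. (x, u x)) ` Domain m" using u(2) by (subst t(3)) auto
      thus ?thesis unfolding g_def using adj(2) by auto
    qed
    moreover have "g \<in> \<G>"
      using emb_graph_of_emb[OF adj(1,4) u(1)] mg m(1) by (auto simp: \<G>_def g_def)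
    ultimately have "g = m" using m(2) by blast
    moreover have "(x, u x) \<in> g" using adj(3) by (simp add: g_def)
    ultimately show ?thesis by auto
  qed
  hence dm: "Domain m = Qbar" using dQ by auto
  have "t x = s x" if "x \<in> E" for x
  proof -
    have "(x, s x) \<in> m" using m(1) that by (auto simp: \<G>_def g0_def)
    thus ?thesis by (subst (asm) t(3)) auto
  qed
  thus ?thesis using that t(2) dm by auto
qed

text \<open>Separability in characteristic zero: a minimal polynomial with a single root would be
  annihilated together with its derivative.\<close>

theorem emb_moving:
  assumes F: "is_field F" "F \<subseteq> Qbar" and x: "x \<in> Qbar" "x \<notin> F"
  obtains s where "emb Qbar s" "\<And>a. a \<in> F \<Longrightarrow> s a = a" "s x \<noteq> x"
proof -
  have R: "is_ring F" using F by auto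
  have id: "emb F (\<lambda>x. x)" by (simp add: emb_def)
  obtain f where f: "minpoly F x f" using minpoly_exists[OF F(1) x(1)] .
  have fs: "f \<in> polys F" "Polynomial.lead_coeff f = 1" "poly f x = 0" using f by (auto simp: minpoly_def)
  have "\<exists>y. poly f y = 0 \<and> y \<noteq> x"
  proof (rule ccontr)
    assume no: "\<not> ?thesis"
    obtain h where h: "f = [:-x, 1:] * h" using fs(3) by (auto simp: poly_eq_0_iff_dvd)
    have h0: "h \<noteq> 0" using fs h by auto
    show False
    proof (cases "Polynomial.degree h = 0")
      case True
      then obtain c where c: "h = [:c:]" by (auto elim: degree_eq_zeroE)
      have "c = 1" using fs(2) h c by (auto split: if_splits)
      hence "Polynomial.coeff f 0 = -x" using h c by simp
      hence "-x \<in> F" using fs(1) by (metis lead_coeff_polys)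
      thus False using x ring_minus[OF R, of "-x"] by simp
    next
      case False
      then obtain y where y: "poly h y = 0" using alg_closed_imp_poly_has_root by blast
      hence "poly f y = 0" by (simp add: h)
      hence "y = x" using no by blast
      hence hx: "poly h x = 0" using y by simp
      have "poly (pderiv f) x = 0"
        unfolding h pderiv_mult using hx by (simp add: pderiv_pCons)
      moreover have "pderiv f \<in> polys F"
        using fs(1) R by (auto simp: polys_def coeff_pderiv intro!: ring_mult ring_add ring_1 ring_of_nat)
      moreover have "Polynomial.degree (pderiv f) < Polynomial.degree f"
        using minpoly_degree_pos[OF f] by (simp add: degree_pderiv)
      moreover have "pderiv f \<noteq> 0" using minpoly_degree_pos[OF f] by (simp add: pderiv_eq_0_iff)
      ultimately show False using f by (auto simp: minpoly_def)
    qed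
  qed
  then obtain y where y: "poly f y = 0" "y \<noteq> x" by blast
  obtain t where t: "emb (adjoin F x) t" "\<And>a. a \<in> F \<Longrightarrow> t a = a" "t x = y"
    using emb_extend_one[OF F id x(1) f, of y] y by auto
  note adj = adjoin_field[OF F x(1)]
  obtain s where s: "emb Qbar s" "\<And>a. a \<in> adjoin F x \<Longrightarrow> s a = t a"
    using emb_extend[OF adj(1,4) t(1)] by blast
  show ?thesis using that[OF s(1)] s t adj y(2) by (metis subsetD)
qed

section \<open>Galois orbits and averages over conjugates\<close>

text \<open>The absolute Galois group; functions that agree on the algebraic numbers represent the same
  element. Injectivity and surjectivity there follow from the finiteness of orbits.\<close>

definition gal :: "(complex \<Rightarrow> complex) set" where
  "gal = {s. emb Qbar s}"

definition cj :: "complex \<Rightarrow> complex set" where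
  "cj x = (\<lambda>s. s x) ` gal"

lemma Qbar_ring: "is_ring Qbar" using is_field_Qbar by auto

lemmas Qbar_closed = ring_closed[OF Qbar_ring]

lemma gal_emb: "s \<in> gal \<Longrightarrow> emb Qbar s" by (simp add: gal_def)

lemma gal_Qbar: "s \<in> gal \<Longrightarrow> x \<in> Qbar \<Longrightarrow> s x \<in> Qbar"
  using emb_Qbar[OF is_field_Qbar] by (auto simp: gal_def)

lemma
  assumes "s \<in> gal"
  shows gal_0: "s 0 = 0" and gal_1: "s 1 = 1"
    and gal_of_int: "s (of_int n) = of_int n"
    and gal_numeral: "s (numeral k) = numeral k"
    and gal_diff: "x \<in> Qbar \<Longrightarrow> y \<in> Qbar \<Longrightarrow> s (x - y) = s x - s y"
    and gal_add: "x \<in> Qbar \<Longrightarrow> y \<in> Qbar \<Longrightarrow> s (x + y) = s x + s y"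
    and gal_mult: "x \<in> Qbar \<Longrightarrow> y \<in> Qbar \<Longrightarrow> s (x * y) = s x * s y"
    and gal_minus: "x \<in> Qbar \<Longrightarrow> s (- x) = - s x"
    and gal_power: "x \<in> Qbar \<Longrightarrow> s (x ^ m) = s x ^ m"
    and gal_Rats: "x \<in> \<rat> \<Longrightarrow> s x = x"
    and gal_eq_0: "x \<in> Qbar \<Longrightarrow> s x = 0 \<longleftrightarrow> x = 0"
    and gal_inj: "inj_on s Qbar"
    and gal_sum: "(\<And>i. i \<in> A \<Longrightarrow> f i \<in> Qbar) \<Longrightarrow> s (sum f A) = (\<Sum>i\<in>A. s (f i))"
    and gal_prod: "(\<And>i. i \<in> A \<Longrightarrow> f i \<in> Qbar) \<Longrightarrow> s (prod f A) = (\<Prod>i\<in>A. s (f i))"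
    and gal_poly_Rats: "q \<in> polys \<rat> \<Longrightarrow> x \<in> Qbar \<Longrightarrow> s (poly q x) = poly q (s x)"
  by ((fact emb_0[OF Qbar_ring gal_emb[OF assms]] emb_1[OF Qbar_ring gal_emb[OF assms]]
    emb_of_int[OF Qbar_ring gal_emb[OF assms]] emb_numeral[OF Qbar_ring gal_emb[OF assms]]
    emb_diff[OF Qbar_ring gal_emb[OF assms]] emb_add[OF Qbar_ring gal_emb[OF assms]]
    emb_mult[OF Qbar_ring gal_emb[OF assms]] emb_minus[OF Qbar_ring gal_emb[OF assms]]
    emb_power[OF Qbar_ring gal_emb[OF assms]]
    emb_Rats[OF is_field_Qbar gal_emb[OF assms]] emb_eq_0[OF is_field_Qbar gal_emb[OF assms]]
    emb_inj[OF is_field_Qbar gal_emb[OF assms]] emb_sum[OF Qbar_ring gal_emb[OF assms]]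
    emb_prod[OF Qbar_ring gal_emb[OF assms]] emb_poly_Rats[OF is_field_Qbar gal_emb[OF assms]])+)

lemma gal_id: "(\<lambda>x. x) \<in> gal" by (simp add: gal_def emb_def)

lemma gal_cnj: "cnj \<in> gal" by (simp add: gal_def emb_def)

lemma gal_comp: "s \<in> gal \<Longrightarrow> t \<in> gal \<Longrightarrow> (\<lambda>x. s (t x)) \<in> gal"
  unfolding gal_def mem_Collect_eq emb_def using emb_Qbar[OF is_field_Qbar, of t] by (simp add: emb_def)

lemma gal_algebraic_int:
  assumes "s \<in> gal" "algebraic_int x" shows "algebraic_int (s x)"
proof -
  obtain p where p: "Polynomial.lead_coeff p = 1" "\<forall>i. Polynomial.coeff p i \<in> \<int>" "poly p x = 0"
    using assms(2) by (auto simp: algebraic_int.simps)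
  have "p \<in> polys \<rat>" using p Ints_subset_Rats by (auto simp: polys_def)
  hence "poly p (s x) = s (poly p x)" using assms algebraic_int_Qbar by (simp add: gal_poly_Rats)
  hence "poly p (s x) = 0" using p assms by (simp add: gal_0)
  thus ?thesis using p by (auto simp: algebraic_int.simps)
qed

lemma gal_in_cj: "s \<in> gal \<Longrightarrow> s x \<in> cj x"
  unfolding cj_def by (rule imageI)

lemma cj_algebraic_int: "algebraic_int x \<Longrightarrow> y \<in> cj x \<Longrightarrow> algebraic_int y"
  unfolding cj_def by (elim imageE) (simp add: gal_algebraic_int)

lemma cj_nonzero: "x \<in> Qbar \<Longrightarrow> x \<noteq> 0 \<Longrightarrow> y \<in> cj x \<Longrightarrow> y \<noteq> 0"
  unfolding cj_def by (elim imageE) (simp add: gal_eq_0)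

lemma cj_subset_roots:
  assumes "q \<in> polys \<rat>" "poly q x = 0" "x \<in> Qbar"
  shows "cj x \<subseteq> {y. poly q y = 0}"
  using assms gal_poly_Rats gal_0 by (force simp: cj_def)

lemma card_cj_le_degree:
  assumes "q \<in> polys \<rat>" "q \<noteq> 0" "poly q x = 0" "x \<in> Qbar"
  shows "card (cj x) \<le> Polynomial.degree q"
  using card_mono[OF poly_roots_finite[OF assms(2)] cj_subset_roots[OF assms(1,3,4)]]
    card_poly_roots_bound[OF assms(2)] by simp

lemma finite_cj: assumes "x \<in> Qbar" shows "finite (cj x)"
proof -
  obtain p where "p \<in> polys \<rat>" "p \<noteq> 0" "poly p x = 0" using Qbar_rat_poly[OF assms] .
  thus ?thesis using cj_subset_roots[of p x] assms poly_roots_finite[of p] finite_subset by blast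
qed

lemma cj_self: "x \<in> cj x" using gal_id by (force simp: cj_def)

lemma cj_Qbar: "x \<in> Qbar \<Longrightarrow> y \<in> cj x \<Longrightarrow> y \<in> Qbar" by (auto simp: cj_def gal_Qbar)

lemma gal_cj: "s \<in> gal \<Longrightarrow> y \<in> cj x \<Longrightarrow> s y \<in> cj x"
  unfolding cj_def by clarify (rule image_eqI[OF _ gal_comp], rule refl)

lemma card_cj_pos: "x \<in> Qbar \<Longrightarrow> card (cj x) > 0"
  using finite_cj cj_self by (auto simp: card_gt_0_iff)

lemma gal_bij_cj: assumes "s \<in> gal" "x \<in> Qbar" shows "bij_betw s (cj x) (cj x)"
proof -
  have inj: "inj_on s (cj x)" using gal_inj[OF assms(1)] cj_Qbar[OF assms(2)] by (meson inj_on_subset subsetI)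
  thus ?thesis using endo_inj_surj[OF finite_cj[OF assms(2)] _ inj] gal_cj[OF assms(1)] by (auto simp: bij_betw_def)
qed

text \<open>An embedding permutes each finite set of conjugates, and is therefore onto.\<close>

lemma gal_inverse:
  assumes s: "s \<in> gal"
  obtains t where "t \<in> gal" "\<And>x. x \<in> Qbar \<Longrightarrow> t (s x) = x" "\<And>x. x \<in> Qbar \<Longrightarrow> s (t x) = x"
proof -
  define t where "t = inv_into Qbar s"
  have surj: "\<exists>x\<in>Qbar. y = s x" if "y \<in> Qbar" for y
    using gal_bij_cj[OF s that] cj_self[of y] cj_Qbar[OF that] by (force simp: bij_betw_def)
  have t1: "t (s x) = x" if "x \<in> Qbar" for x
    unfolding t_def using gal_inj[OF s] that by simp
  have t2: "s (t x) = x" and t3: "t x \<in> Qbar" if "x \<in> Qbar" for x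
    using surj[OF that] t1 by auto
  have "t (x - y) = t x - t y \<and> t (x * y) = t x * t y" if "x \<in> Qbar" "y \<in> Qbar" for x y
  proof -
    have "s (t x - t y) = x - y" "s (t x * t y) = x * y"
      using that t2 t3 s by (simp_all add: gal_diff gal_mult)
    thus ?thesis using t1[of "t x - t y"] t1[of "t x * t y"] t3 that Qbar_closed by auto
  qed
  moreover have "t 1 = 1" using t1[of 1] Qbar_closed(1) gal_1[OF s] by simp
  ultimately have "t \<in> gal" by (simp add: gal_def emb_def)
  thus ?thesis using that t1 t2 by blast
qed

lemma cj_gal: assumes "s \<in> gal" "x \<in> Qbar" shows "cj (s x) = cj x"
proof
  have *: "cj (s y) \<subseteq> cj y" if "s \<in> gal" for s y
    unfolding cj_def by clarify (rule image_eqI[OF _ gal_comp[OF _ that]], rule refl)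
  show "cj (s x) \<subseteq> cj x" by (rule *[OF assms(1)])
  obtain t where t: "t \<in> gal" "\<And>x. x \<in> Qbar \<Longrightarrow> t (s x) = x" using gal_inverse[OF assms(1)] by metis
  have "cj (t (s x)) \<subseteq> cj (s x)" by (rule *[OF t(1)])
  thus "cj x \<subseteq> cj (s x)" using t(2)[OF assms(2)] by simp
qed

text \<open>The fixed field of the Galois group is the field of rationals, because any other algebraic
  number can be moved over the rationals.\<close>

lemma gal_fixed_Rats:
  assumes "x \<in> Qbar" "\<And>s. s \<in> gal \<Longrightarrow> s x = x" shows "x \<in> \<rat>"
proof (rule ccontr)
  assume "x \<notin> \<rat>"
  then obtain s where "emb Qbar s" "s x \<noteq> x"
    using emb_moving[OF is_field_Rats Rats_Qbar assms(1)] by metis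
  thus False using assms(2) by (auto simp: gal_def)
qed

lemma algebraic_int_fixed:
  assumes "algebraic_int x" "\<And>s. s \<in> gal \<Longrightarrow> s x = x"
  obtains n :: int where "x = of_int n"
proof -
  have "x \<in> \<rat>" using assms algebraic_int_Qbar by (intro gal_fixed_Rats)
  hence "x \<in> \<int>" by (rule rational_algebraic_int_is_int[OF assms(1)])
  thus ?thesis using that by (auto elim: Ints_cases)
qed

definition orb :: "complex list \<Rightarrow> complex list set" where
  "orb xs = (\<lambda>s. map s xs) ` gal"

lemma finite_orb: assumes "set xs \<subseteq> Qbar" shows "finite (orb xs)"
proof -
  have "orb xs \<subseteq> {ys. set ys \<subseteq> (\<Union>x\<in>set xs. cj x) \<and> length ys = length xs}"
    unfolding orb_def using gal_in_cj by fastforce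
  moreover have "finite (\<Union>x\<in>set xs. cj x)" using assms finite_cj by auto
  ultimately show ?thesis using finite_lists_length_eq finite_subset by blast
qed

text \<open>The group acts transitively on an orbit of tuples and on the conjugates of an entry, so
  the projection to that entry has fibres of constant size.\<close>

lemma orb_projection_mean:
  fixes f :: "complex \<Rightarrow> real"
  assumes xs: "set xs \<subseteq> Qbar" and i: "i < length xs"
  shows "(\<Sum>t\<in>orb xs. f (t ! i)) / card (orb xs) = (\<Sum>y\<in>cj (xs ! i). f y) / card (cj (xs ! i))"
proof -
  define x where "x = xs ! i"
  have x: "x \<in> Qbar" using xs i by (auto simp: x_def)
  define T where "T y = {t \<in> orb xs. t ! i = y}" for y
  have finT: "finite (T y)" for y using finite_orb[OF xs] by (simp add: T_def)
  have le: "card (T y) \<le> card (T z)" if y: "y \<in> cj x" and z: "z \<in> cj x" for y z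
  proof -
    obtain a b where a: "a \<in> gal" "y = a x" and b: "b \<in> gal" "z = b x" using y z by (auto simp: cj_def)
    obtain a' where a': "a' \<in> gal" "\<And>u. u \<in> Qbar \<Longrightarrow> a' (a u) = u" using gal_inverse[OF a(1)] by metis
    define s where "s u = b (a' u)" for u
    have s: "s \<in> gal" unfolding s_def using gal_comp[OF b(1) a'(1)] .
    have sy: "s y = z" using a a' b x by (simp add: s_def)
    have Q: "set t \<subseteq> Qbar" if t: "t \<in> orb xs" for t 
    proof -
      obtain c where c: "c \<in> gal" "t = map c xs" using t unfolding orb_def by (elim imageE)
      have "c v \<in> Qbar" if "v \<in> set xs" for v
        by (rule gal_Qbar[OF c(1)]) (use xs that in auto)
      thus ?thesis unfolding c(2) by (simp add: image_subset_iff)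
    qed
    have "inj_on (map s) (T y)"
    proof (rule inj_onI)
      fix t u assume tu: "t \<in> T y" "u \<in> T y" "map s t = map s u"
      hence "set t \<union> set u \<subseteq> Qbar" using Q by (simp add: T_def)
      hence "inj_on s (set t \<union> set u)" by (rule inj_on_subset[OF gal_inj[OF s]])
      thus "t = u" by (rule map_inj_on[OF tu(3)])
    qed
    moreover have "map s ` T y \<subseteq> T z"
    proof
      fix v assume "v \<in> map s ` T y"
      then obtain t where t: "t \<in> orb xs" "t ! i = y" "v = map s t" by (auto simp: T_def)
      moreover obtain c where "c \<in> gal" "t = map c xs" using t(1) unfolding orb_def by (elim imageE)
      ultimately have c: "c \<in> gal" "v = map s (map c xs)" "map c xs ! i = y" by simp_all
      have "v = map (\<lambda>u. s (c u)) xs" using c by simp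
      hence "v \<in> orb xs" unfolding orb_def by (rule image_eqI[OF _ gal_comp[OF s c(1)]])
      moreover have "v ! i = z" using c i sy by simp
      ultimately show "v \<in> T z" by (simp add: T_def)
    qed
    ultimately show ?thesis using card_inj_on_le finT by blast
  qed
  define k where "k = card (T x)"
  have k: "card (T y) = k" if "y \<in> cj x" for y
    using le[OF that cj_self] le[OF cj_self that] by (simp add: k_def)
  have sum: "(\<Sum>t\<in>orb xs. g (t ! i)) = k * (\<Sum>y\<in>cj x. g y)" for g :: "complex \<Rightarrow> real"
  proof -
    have "(\<lambda>t. t ! i) ` orb xs \<subseteq> cj x" using i gal_in_cj by (auto simp: orb_def x_def)
    hence "(\<Sum>t\<in>orb xs. g (t ! i)) = (\<Sum>y\<in>cj x. \<Sum>t | t \<in> orb xs \<and> t ! i = y. g (t ! i))"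
      by (rule sum.group[OF finite_orb[OF xs] finite_cj[OF x], symmetric])
    also have "\<dots> = (\<Sum>y\<in>cj x. \<Sum>t\<in>T y. g y)" by (intro sum.cong) (auto simp: T_def)
    also have "\<dots> = k * (\<Sum>y\<in>cj x. g y)" using k by (simp add: sum_distrib_left)
    finally show ?thesis .
  qed
  have "card (orb xs) > 0" using finite_orb[OF xs] gal_id by (auto simp: card_gt_0_iff orb_def)
  moreover have "card (orb xs) = k * card (cj x)" using sum[of "\<lambda>_. 1"] by (metis of_nat_eq_iff of_nat_mult real_of_card)
  ultimately show ?thesis using sum[of f] card_cj_pos[OF x] by (simp add: x_def[symmetric] field_simps)
qed

text \<open>For algebraic integers this is the logarithmic Weil height.\<close>

definition hm :: "complex \<Rightarrow> real" where
  "hm x = (\<Sum>y\<in>cj x. ln (max 1 (cmod y))) / card (cj x)"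

lemma hm_gal: "s \<in> gal \<Longrightarrow> x \<in> Qbar \<Longrightarrow> hm (s x) = hm x"
  by (simp add: hm_def cj_gal)

text \<open>The product of the conjugates is a nonzero rational integer.\<close>

lemma norm_log_nonneg:
  assumes z: "algebraic_int z" "z \<noteq> 0"
  shows "(\<Sum>y\<in>cj z. ln (cmod y)) \<ge> 0"
proof -
  have zQ: "z \<in> Qbar" using z by (simp add: algebraic_int_Qbar)
  define P where "P = (\<Prod>y\<in>cj z. y)"
  have int: "algebraic_int P" unfolding P_def using z by (intro algebraic_int_prod) (rule cj_algebraic_int)
  have "s P = P" if s: "s \<in> gal" for s
  proof -
    have "s P = (\<Prod>y\<in>cj z. s y)" unfolding P_def using s cj_Qbar[OF zQ] by (subst gal_prod) auto
    also have "\<dots> = P" unfolding P_def by (rule prod.reindex_bij_betw[OF gal_bij_cj[OF s zQ]])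
    finally show ?thesis .
  qed
  then obtain n where n: "P = of_int n" using algebraic_int_fixed[OF int] by blast
  have nz: "y \<noteq> 0" if "y \<in> cj z" for y using cj_nonzero[OF zQ z(2) that] .
  hence "P \<noteq> 0" using finite_cj[OF zQ] by (auto simp: P_def)
  hence "n \<noteq> 0" using n by auto
  hence "1 \<le> \<bar>n\<bar>" by linarith
  hence "1 \<le> real_of_int \<bar>n\<bar>" by linarith
  hence "cmod P \<ge> 1" by (simp add: n)
  hence "0 \<le> ln (cmod P)" by simp
  also have "\<dots> = (\<Sum>y\<in>cj z. ln (cmod y))"
    unfolding P_def prod_norm[symmetric] using nz finite_cj[OF zQ] by (subst ln_prod) auto
  finally show ?thesis .
qed

text \<open>The source of every height bound below: an estimate of a nonzero algebraic integer
  by conjugates of given numbers, valid in each embedding, survives averaging over embeddings,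
  where the left-hand side becomes nonnegative because norms are nonzero integers.\<close>

lemma height_bound_by_averaging:
  assumes z: "algebraic_int z" "z \<noteq> 0" and xs: "set xs \<subseteq> Qbar"
    and le: "\<And>s. s \<in> gal \<Longrightarrow> ln (cmod (s z)) \<le> C + w * (\<Sum>i<length xs. ln (max 1 (cmod (s (xs ! i)))))"
  shows "0 \<le> C + w * (\<Sum>i<length xs. hm (xs ! i))"
proof -
  have zQ: "z \<in> Qbar" using z by (simp add: algebraic_int_Qbar)
  let ?l = "z # xs"
  have l: "set ?l \<subseteq> Qbar" using xs zQ by simp
  define N where "N = real (card (orb ?l))"
  have "orb ?l \<noteq> {}" using gal_id unfolding orb_def by blast
  hence N: "N > 0" using finite_orb[OF l] unfolding N_def of_nat_0_less_iff card_gt_0_iff by blast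
  have "0 \<le> (\<Sum>y\<in>cj (?l ! 0). ln (cmod y)) / card (cj (?l ! 0))"
    using norm_log_nonneg[OF z] by simp
  also have "\<dots> = (\<Sum>t\<in>orb ?l. ln (cmod (t ! 0))) / N"
    unfolding N_def by (rule orb_projection_mean[OF l, symmetric]) simp
  also have "\<dots> \<le> (\<Sum>t\<in>orb ?l. C + w * (\<Sum>i<length xs. ln (max 1 (cmod (t ! Suc i))))) / N"
  proof (intro divide_right_mono sum_mono)
    fix t assume "t \<in> orb ?l"
    then obtain s where s: "s \<in> gal" and t: "t = map s ?l" unfolding orb_def by (elim imageE)
    have sums: "(\<Sum>i<length xs. ln (max 1 (cmod (t ! Suc i)))) = (\<Sum>i<length xs. ln (max 1 (cmod (s (xs ! i)))))"
      by (rule sum.cong) (simp_all add: t)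
    have t0: "t ! 0 = s z" by (simp add: t)
    show "ln (cmod (t ! 0)) \<le> C + w * (\<Sum>i<length xs. ln (max 1 (cmod (t ! Suc i))))"
      unfolding sums t0 by (rule le[OF s])
  qed (use N in simp)
  also have "(\<Sum>t\<in>orb ?l. C + w * (\<Sum>i<length xs. ln (max 1 (cmod (t ! Suc i)))))
      = N * C + w * (\<Sum>t\<in>orb ?l. \<Sum>i<length xs. ln (max 1 (cmod (t ! Suc i))))"
    unfolding sum.distrib sum_distrib_left[symmetric] by (simp add: N_def)
  also have "(\<Sum>t\<in>orb ?l. \<Sum>i<length xs. ln (max 1 (cmod (t ! Suc i))))
      = (\<Sum>i<length xs. \<Sum>t\<in>orb ?l. ln (max 1 (cmod (t ! Suc i))))" by (rule sum.swap)
  also have "(N * C + w * \<dots>) / N = C + w * ((\<Sum>i<length xs. \<Sum>t\<in>orb ?l. ln (max 1 (cmod (t ! Suc i)))) / N)"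
    using N by (simp only: add_divide_distrib) simp
  also have "(\<Sum>i<length xs. \<Sum>t\<in>orb ?l. ln (max 1 (cmod (t ! Suc i)))) / N
      = (\<Sum>i<length xs. (\<Sum>t\<in>orb ?l. ln (max 1 (cmod (t ! Suc i)))) / N)"
    by (rule sum_divide_distrib)
  also have "(\<Sum>i<length xs. (\<Sum>t\<in>orb ?l. ln (max 1 (cmod (t ! Suc i)))) / N) = (\<Sum>i<length xs. hm (xs ! i))"
  proof (rule sum.cong[OF refl])
    fix i assume "i \<in> {..<length xs}"
    hence i: "Suc i < length ?l" by simp
    show "(\<Sum>t\<in>orb ?l. ln (max 1 (cmod (t ! Suc i)))) / N = hm (xs ! i)"
      unfolding N_def hm_def
      by (rule orb_projection_mean[OF l i, of "\<lambda>y. ln (max 1 (cmod y))", unfolded nth_Cons_Suc])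
  qed
  finally show ?thesis .
qed

lemma map_poly_gal_prod:
  assumes s: "s \<in> gal" and f: "\<And>i. i \<in> A \<Longrightarrow> f i \<in> polys Qbar"
  shows "map_poly s (prod f A) = (\<Prod>i\<in>A. map_poly s (f i))"
  using f
proof (induction A rule: infinite_finite_induct)
  case (insert a A)
  have "map_poly s (f a * prod f A) = map_poly s (f a) * map_poly s (prod f A)"
    by (rule map_poly_emb_mult[OF Qbar_ring gal_emb[OF s]]) (use insert.prems in \<open>auto intro!: polys_prod[OF Qbar_ring]\<close>)
  thus ?case using insert by simp
qed (auto simp: map_poly_1 gal_1[OF s] one_pCons map_poly_pCons gal_0[OF s])

lemma map_poly_gal_linear:
  assumes "s \<in> gal" "y \<in> Qbar" shows "map_poly s [:-y, 1:] = [:-s y, 1:]"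
  using assms by (intro poly_eqI) (simp add: coeff_map_poly gal_0 gal_1 gal_minus coeff_pCons split: nat.splits)


text \<open>The minimal polynomial over the rationals, known through its roots.\<close>

definition cpoly :: "complex \<Rightarrow> complex poly" where
  "cpoly x = (\<Prod>y\<in>cj x. [:-y, 1:])"

lemma cpoly_lead: "Polynomial.lead_coeff (cpoly x) = 1"
  unfolding cpoly_def by (simp add: lead_coeff_prod)

lemma degree_cpoly: "x \<in> Qbar \<Longrightarrow> Polynomial.degree (cpoly x) = card (cj x)"
  unfolding cpoly_def by (subst degree_prod_eq_sum_degree) auto

lemma poly_cpoly: "x \<in> Qbar \<Longrightarrow> poly (cpoly x) y = 0 \<longleftrightarrow> y \<in> cj x"
  unfolding cpoly_def using finite_cj by (auto simp: poly_prod)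

lemma linear_polys: "is_ring R \<Longrightarrow> y \<in> R \<Longrightarrow> [:-y, 1:] \<in> polys R"
  by (intro polys_pCons polys_0 ring_closed)

lemma cpoly_Rats: assumes x: "x \<in> Qbar" shows "cpoly x \<in> polys \<rat>"
  unfolding polys_def
proof (rule, rule)
  fix i
  have lin: "[:-y, 1:] \<in> polys Qbar" if "y \<in> cj x" for y
    using linear_polys[OF Qbar_ring cj_Qbar[OF x that]] .
  have Q: "cpoly x \<in> polys Qbar" unfolding cpoly_def using lin by (rule polys_prod[OF Qbar_ring])
  show "Polynomial.coeff (cpoly x) i \<in> \<rat>"
  proof (rule gal_fixed_Rats)
    show "Polynomial.coeff (cpoly x) i \<in> Qbar" using Q by (rule lead_coeff_polys)
    fix s assume s: "s \<in> gal"
    have "map_poly s (cpoly x) = (\<Prod>y\<in>cj x. map_poly s [:-y, 1:])"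
      unfolding cpoly_def using lin by (rule map_poly_gal_prod[OF s])
    also have "\<dots> = (\<Prod>y\<in>cj x. [:-s y, 1:])"
      by (rule prod.cong[OF refl]) (rule map_poly_gal_linear[OF s cj_Qbar[OF x]])
    also have "\<dots> = cpoly x" unfolding cpoly_def
      by (rule prod.reindex_bij_betw[OF gal_bij_cj[OF s x], of "\<lambda>y. [:-y, 1:]"])
    finally show "s (Polynomial.coeff (cpoly x) i) = Polynomial.coeff (cpoly x) i"
      using gal_0[OF s] by (metis coeff_map_poly)
  qed
qed

lemma coeff_prod_linear_integral:
  fixes A :: "complex set"
  assumes "\<And>y. y \<in> A \<Longrightarrow> algebraic_int y"
  shows "algebraic_int (Polynomial.coeff (\<Prod>y\<in>A. [:-y, 1:]) i)"
proof -
  have R: "is_ring {x. algebraic_int x}" by (auto simp: is_ring_def)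
  have "(\<Prod>y\<in>A. [:-y, 1:]) \<in> polys {x. algebraic_int x}"
    using assms by (intro polys_prod[OF R] linear_polys[OF R]) simp
  thus ?thesis by (simp add: polys_def)
qed

lemma cpoly_Ints: assumes x: "algebraic_int x" shows "cpoly x \<in> polys \<int>"
  unfolding polys_def
proof (rule, rule)
  fix i
  have "algebraic_int (Polynomial.coeff (cpoly x) i)"
    unfolding cpoly_def using x by (intro coeff_prod_linear_integral) (rule cj_algebraic_int)
  moreover have "Polynomial.coeff (cpoly x) i \<in> \<rat>"
    using cpoly_Rats[OF algebraic_int_Qbar[OF x]] by (simp add: polys_def)
  ultimately show "Polynomial.coeff (cpoly x) i \<in> \<int>" by (rule rational_algebraic_int_is_int)
qed

lemma coeff_prod_linear_bound:
  assumes "finite A" "\<And>y. y \<in> A \<Longrightarrow> cmod y \<le> r" "r \<ge> 0"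
  shows "cmod (Polynomial.coeff (\<Prod>y\<in>A. [:-y, 1:]) i) \<le> (1 + r) ^ card A"
  using assms(1,2)
proof (induction A arbitrary: i rule: finite_induct)
  case empty
  thus ?case by (cases "i = 0") auto
next
  case (insert a A)
  define P where "P = (\<Prod>y\<in>A. [:-y, 1:])"
  have IH: "cmod (Polynomial.coeff P i) \<le> (1 + r) ^ card A" for i unfolding P_def using insert by auto
  have eq: "[:-a, 1:] * P = pCons 0 P - Polynomial.smult a P" by simp
  have "cmod (Polynomial.coeff ([:-a, 1:] * P) i) \<le> cmod (Polynomial.coeff (pCons 0 P) i) + cmod (a * Polynomial.coeff P i)"
    unfolding eq coeff_diff coeff_smult by (rule norm_triangle_ineq4)
  also have "\<dots> \<le> (1 + r) ^ card A + r * (1 + r) ^ card A"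
  proof (rule add_mono)
    show "cmod (Polynomial.coeff (pCons 0 P) i) \<le> (1 + r) ^ card A"
      using IH assms(3) by (auto simp: coeff_pCons split: nat.splits)
    show "cmod (a * Polynomial.coeff P i) \<le> r * (1 + r) ^ card A"
      unfolding norm_mult using IH insert.prems assms(3) by (intro mult_mono) auto
  qed
  also have "\<dots> = (1 + r) ^ card (insert a A)" using insert by (simp add: algebra_simps)
  finally show ?case using insert by (simp add: P_def del: mult_pCons_left)
qed

lemma finite_int_polys:
  "finite {p :: complex poly. p \<in> polys \<int> \<and> Polynomial.degree p \<le> d \<and> (\<forall>i. cmod (Polynomial.coeff p i) \<le> M)}"
proof -
  let ?I = "of_int ` {-\<lceil>M\<rceil>..\<lceil>M\<rceil>} :: complex set"
  have "{p. p \<in> polys \<int> \<and> Polynomial.degree p \<le> d \<and> (\<forall>i. cmod (Polynomial.coeff p i) \<le> M)}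
      \<subseteq> Poly ` {xs. set xs \<subseteq> ?I \<and> length xs \<le> Suc d}"
  proof
    fix p assume "p \<in> {p. p \<in> polys \<int> \<and> Polynomial.degree p \<le> d \<and> (\<forall>i. cmod (Polynomial.coeff p i) \<le> M)}"
    hence p: "\<And>i. Polynomial.coeff p i \<in> \<int>" "Polynomial.degree p \<le> d" "\<And>i. cmod (Polynomial.coeff p i) \<le> M"
      by (auto simp: polys_def)
    have "Polynomial.coeff p i \<in> ?I" for i
    proof -
      obtain n where n: "Polynomial.coeff p i = of_int n" using p(1)[of i] by (auto elim: Ints_cases)
      hence "\<bar>real_of_int n\<bar> \<le> M" using p(3)[of i] by simp
      hence "n \<in> {-\<lceil>M\<rceil>..\<lceil>M\<rceil>}" by simp linarith
      thus ?thesis using n by simp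
    qed
    hence "set (coeffs p) \<subseteq> ?I" by (auto simp: coeffs_def)
    moreover have "length (coeffs p) \<le> Suc d" using p(2) by (simp add: coeffs_def)
    moreover have "p = Poly (coeffs p)" by simp
    ultimately show "p \<in> Poly ` {xs. set xs \<subseteq> ?I \<and> length xs \<le> Suc d}" by blast
  qed
  moreover have "finite {xs. set xs \<subseteq> ?I \<and> length xs \<le> Suc d}" by (rule finite_lists_length_le) simp
  ultimately show ?thesis using finite_subset by blast
qed

text \<open>The minimal polynomials of these numbers have bounded integer coefficients.\<close>

theorem finite_bounded_conjugates:
  "finite {x. algebraic_int x \<and> card (cj x) \<le> d \<and> (\<forall>y\<in>cj x. cmod y \<le> r)}" (is "finite ?S")
proof -
  define r' where "r' = max 0 r"
  let ?P = "{p. p \<in> polys \<int> \<and> Polynomial.degree p \<le> d \<and> (\<forall>i. cmod (Polynomial.coeff p i) \<le> (1 + r') ^ d)}"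
  have "?S \<subseteq> (\<Union>p\<in>?P - {0}. {x. poly p x = 0})"
  proof
    fix x assume x: "x \<in> ?S"
    hence Q: "x \<in> Qbar" by (auto intro: algebraic_int_Qbar)
    have "cmod (Polynomial.coeff (cpoly x) i) \<le> (1 + r') ^ d" for i
    proof -
      have "cmod (Polynomial.coeff (cpoly x) i) \<le> (1 + r') ^ card (cj x)"
        unfolding cpoly_def using x finite_cj[OF Q] by (intro coeff_prod_linear_bound) (auto simp: r'_def)
      also have "\<dots> \<le> (1 + r') ^ d" using x by (intro power_increasing) (auto simp: r'_def)
      finally show ?thesis .
    qed
    hence "cpoly x \<in> ?P" using x cpoly_Ints degree_cpoly[OF Q] by auto
    moreover have "cpoly x \<noteq> 0" using cpoly_lead[of x] by auto
    moreover have "poly (cpoly x) x = 0" using poly_cpoly[OF Q] cj_self by simp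
    ultimately show "x \<in> (\<Union>p\<in>?P - {0}. {x. poly p x = 0})" by blast
  qed
  moreover have "finite (\<Union>p\<in>?P - {0}. {x. poly p x = 0})"
    using finite_int_polys poly_roots_finite by (intro finite_UN_I finite_Diff) auto
  ultimately show ?thesis by (rule finite_subset)
qed

text \<open>A height bound controls every conjugate as soon as the degree is bounded.\<close>

lemma finite_bounded_height:
  "finite {x. algebraic_int x \<and> card (cj x) \<le> d \<and> hm x \<le> B}"
proof (rule finite_subset[OF _ finite_bounded_conjugates[of d "exp (d * max 0 B)"]], safe)
  fix x y assume x: "algebraic_int x" "card (cj x) \<le> d" "hm x \<le> B" and y: "y \<in> cj x"
  have Q: "x \<in> Qbar" using x by (auto intro: algebraic_int_Qbar)
  have "ln (max 1 (cmod y)) \<le> (\<Sum>y\<in>cj x. ln (max 1 (cmod y)))"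
    using finite_cj[OF Q] y by (intro member_le_sum) auto
  also have "\<dots> = card (cj x) * hm x" using card_cj_pos[OF Q] by (simp add: hm_def)
  also have "\<dots> \<le> card (cj x) * max 0 B" using x by (intro mult_left_mono) auto
  also have "\<dots> \<le> d * max 0 B" using x by (intro mult_right_mono) auto
  finally have le: "ln (max 1 (cmod y)) \<le> d * max 0 B" .
  have "cmod y \<le> max 1 (cmod y)" by simp
  also have "\<dots> = exp (ln (max 1 (cmod y)))" by (subst exp_ln) auto
  also have "\<dots> \<le> exp (d * max 0 B)" using le by (simp only: exp_le_cancel_iff)
  finally show "cmod y \<le> exp (d * max 0 B)" .
qed

section \<open>Generated fields\<close>

lemma is_field_hull: "is_field (is_field hull S)"
  unfolding hull_def is_field_def[of "\<Inter> _"] is_ring_def[of "\<Inter> _"]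
  by (simp add: ring_closed field_inverse is_field_imp_ring)

lemma field_hull_minimal: "S \<subseteq> F \<Longrightarrow> is_field F \<Longrightarrow> is_field hull S \<subseteq> F"
  by (rule hull_minimal)

lemma field_hull_Qbar: "S \<subseteq> Qbar \<Longrightarrow> is_field hull S \<subseteq> Qbar"
  by (rule field_hull_minimal) (simp_all add: is_field_Qbar)

lemma field_hull_inc: "x \<in> S \<Longrightarrow> x \<in> is_field hull S"
  by (rule hull_inc)

lemma gal_eq_on_hull:
  assumes s: "s \<in> gal" and t: "t \<in> gal" and S: "S \<subseteq> Qbar" and eq: "\<And>x. x \<in> S \<Longrightarrow> s x = t x"
    and x: "x \<in> is_field hull S"
  shows "s x = t x"
proof -
  let ?E = "{x \<in> Qbar. s x = t x}"
  have "is_field ?E"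
    unfolding is_field_def is_ring_def
  proof (intro conjI ballI)
    show "1 \<in> ?E" by (simp add: Qbar_closed gal_1[OF s] gal_1[OF t])
    fix x assume x: "x \<in> ?E"
    show "inverse x \<in> ?E"
      using x field_inverse[OF is_field_Qbar, of x]
      by (simp add: emb_inverse[OF is_field_Qbar gal_emb[OF s]] emb_inverse[OF is_field_Qbar gal_emb[OF t]])
    fix y assume y: "y \<in> ?E"
    show "x - y \<in> ?E" "x * y \<in> ?E"
      using x y by (simp_all add: Qbar_closed gal_diff[OF s] gal_diff[OF t] gal_mult[OF s] gal_mult[OF t])
  qed
  hence "is_field hull S \<subseteq> ?E" using eq S by (intro field_hull_minimal) auto
  thus ?thesis using x by auto
qed

text \<open>A conjugate of an element is determined by the effect of an automorphism on the generators, for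
  which there are finitely many possibilities.\<close>

lemma bounded_degree_hull:
  assumes "finite S" "S \<subseteq> Qbar"
  obtains d where "\<And>x. x \<in> is_field hull S \<Longrightarrow> card (cj x) \<le> d"
proof -
  define T where "T = (\<lambda>s. restrict s S) ` gal"
  have "T \<subseteq> PiE S cj"
  proof
    fix r assume "r \<in> T"
    then obtain s where s: "s \<in> gal" "r = restrict s S" unfolding T_def by (elim imageE)
    show "r \<in> PiE S cj" unfolding s(2) restrict_PiE_iff using gal_in_cj[OF s(1)] by blast
  qed
  moreover have "finite (PiE S cj)" using assms(2) by (intro finite_PiE[OF assms(1)] finite_cj) auto
  ultimately have fin: "finite T" by (rule finite_subset)
  define c where "c r = (SOME s. s \<in> gal \<and> restrict s S = r)" for r
  have "card (cj x) \<le> card T" if x: "x \<in> is_field hull S" for x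
  proof -
    have "cj x \<subseteq> (\<lambda>r. c r x) ` T"
    proof
      fix y assume "y \<in> cj x"
      then obtain s where s: "s \<in> gal" "y = s x" unfolding cj_def by (elim imageE)
      have "c (restrict s S) \<in> gal \<and> restrict (c (restrict s S)) S = restrict s S"
        unfolding c_def by (rule someI[of _ s]) (use s in simp)
      hence c: "c (restrict s S) \<in> gal" "restrict (c (restrict s S)) S = restrict s S" by simp_all
      have "c (restrict s S) u = s u" if "u \<in> S" for u using fun_cong[OF c(2), of u] that by simp
      hence "c (restrict s S) x = s x" using gal_eq_on_hull[OF c(1) s(1) assms(2) _ x] by simp
      hence "y = c (restrict s S) x" using s(2) by simp
      moreover have "restrict s S \<in> T" unfolding T_def using s(1) by (rule imageI)
      ultimately show "y \<in> (\<lambda>r. c r x) ` T" by (rule image_eqI)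
    qed
    thus ?thesis by (rule surj_card_le[OF fin])
  qed
  thus ?thesis by (rule that)
qed

lemma fixed_mem_field:
  assumes "is_field F" "F \<subseteq> Qbar" "x \<in> Qbar"
    and "\<And>s. s \<in> gal \<Longrightarrow> (\<And>a. a \<in> F \<Longrightarrow> s a = a) \<Longrightarrow> s x = x"
  shows "x \<in> F"
proof (rule ccontr)
  assume "x \<notin> F"
  then obtain s where "emb Qbar s" "\<And>a. a \<in> F \<Longrightarrow> s a = a" "s x \<noteq> x"
    using emb_moving[OF assms(1-3)] by metis
  thus False using assms(4)[of s] by (simp add: gal_def)
qed

section \<open>Primes that do not ramify\<close>

text \<open>Up to sign, the discriminant of the minimal polynomial of t.\<close>

definition discr :: "complex \<Rightarrow> complex" where
  "discr t = (\<Prod>x\<in>cj t. \<Prod>y\<in>cj t - {x}. x - y)"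

lemma discr_int:
  assumes t: "algebraic_int t"
  obtains D :: int where "D \<noteq> 0" "discr t = of_int D"
proof -
  have Q: "t \<in> Qbar" using algebraic_int_Qbar[OF t] .
  have int: "algebraic_int (discr t)"
    unfolding discr_def using cj_algebraic_int[OF t] by (intro algebraic_int_prod algebraic_int_diff) auto
  have "s (discr t) = discr t" if s: "s \<in> gal" for s
  proof -
    have bij: "bij_betw s (cj t) (cj t)" using gal_bij_cj[OF s Q] .
    have inner: "s (\<Prod>y\<in>cj t - {x}. x - y) = (\<Prod>y\<in>cj t - {s x}. s x - y)" if x: "x \<in> cj t" for x
    proof -
      have "s (\<Prod>y\<in>cj t - {x}. x - y) = (\<Prod>y\<in>cj t - {x}. s (x - y))"
        using s by (rule gal_prod) (use x cj_Qbar[OF Q] in \<open>auto intro: Qbar_closed\<close>)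
      also have "\<dots> = (\<Prod>y\<in>cj t - {x}. s x - s y)"
        using x cj_Qbar[OF Q] by (intro prod.cong[OF refl] gal_diff[OF s]) auto
      also have "\<dots> = (\<Prod>y\<in>cj t - {s x}. s x - y)"
        using bij_betw_DiffI[OF bij, of "{x}" "{s x}"] x bij
        by (intro prod.reindex_bij_betw) (auto simp: bij_betw_def)
      finally show ?thesis .
    qed
    have "s (discr t) = (\<Prod>x\<in>cj t. s (\<Prod>y\<in>cj t - {x}. x - y))"
      unfolding discr_def using s
      by (rule gal_prod) (use cj_Qbar[OF Q] in \<open>auto intro!: Qbar_closed ring_prod[OF Qbar_ring]\<close>)
    also have "\<dots> = (\<Prod>x\<in>cj t. \<Prod>y\<in>cj t - {s x}. s x - y)" using inner by simp
    also have "\<dots> = discr t"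
      unfolding discr_def by (rule prod.reindex_bij_betw[OF bij, of "\<lambda>x. \<Prod>y\<in>cj t - {x}. x - y"])
    finally show ?thesis .
  qed
  then obtain D where D: "discr t = of_int D" using algebraic_int_fixed[OF int] by blast
  moreover have "discr t \<noteq> 0" unfolding discr_def using finite_cj[OF Q] by auto
  ultimately show ?thesis using that by auto
qed

text \<open>A substitute for p being unramified in F: no element of F has a square root of p
  in its denominator, up to denominators prime to p. Unlike ramification it makes sense in
  fields of infinite degree and passes to subfields trivially.\<close>

definition tame :: "int \<Rightarrow> complex set \<Rightarrow> bool" where
  "tame p F \<longleftrightarrow> (\<forall>g\<in>F. algebraic_int (g ^ 2 * of_int p) \<longrightarrow>
     (\<exists>e. Rings.coprime e p \<and> algebraic_int (of_int e * g)))"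

lemma tame_mono: "tame p F \<Longrightarrow> E \<subseteq> F \<Longrightarrow> tame p E"
  unfolding tame_def by blast

text \<open>If the square of g times p is an integer, then gp is an integer whose square is divisible by p.\<close>

lemma tame_Rats:
  assumes p: "Factorial_Ring.prime p" shows "tame p \<rat>"
  unfolding tame_def
proof (intro ballI impI)
  fix g :: complex assume g: "g \<in> \<rat>" and int: "algebraic_int (g ^ 2 * of_int p)"
  have "algebraic_int ((g * of_int p) ^ 2)"
    using algebraic_int_mult[OF int algebraic_int_of_int[of p]] by (simp add: power2_eq_square mult_ac)
  hence "algebraic_int (g * of_int p)" by (rule algebraic_int_sqrt_of)
  hence "g * of_int p \<in> \<int>" using g by (intro rational_algebraic_int_is_int) auto
  then obtain n where n: "g * of_int p = of_int n" by (elim Ints_cases)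
  have "g ^ 2 * of_int p \<in> \<int>" using g int by (intro rational_algebraic_int_is_int) auto
  then obtain m where m: "g ^ 2 * of_int p = of_int m" by (elim Ints_cases)
  have "of_int (n ^ 2) = (g * of_int p) ^ 2" by (simp add: n)
  also have "\<dots> = of_int (p * m)" by (simp add: m[symmetric] power2_eq_square mult_ac)
  finally have "n ^ 2 = p * m" by (simp only: of_int_eq_iff)
  hence "p dvd n" using p by (metis dvd_triv_left prime_dvd_power)
  then obtain k where "n = p * k" by (elim dvdE)
  hence "g = of_int k" using n p by (simp add: mult.commute)
  thus "\<exists>e. Rings.coprime e p \<and> algebraic_int (of_int e * g)" by (intro exI[of _ 1]) auto
qed

text \<open>With f the minimal polynomial of t over F and g = q(t), the polynomial
  \<open>\<Sum> q(x) f / (X - x)\<close>, summed over the roots x of f, has coefficients in F and takes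
  the value \<open>g f'(t)\<close> at t. The hypothesis on g passes to these coefficients because a
  product of two square roots of integral elements is integral.\<close>

lemma tame_adjoin:
  assumes F: "is_field F" "F \<subseteq> Qbar" and tame: "tame p F" and t: "algebraic_int t"
    and D: "discr t = of_int D" "Rings.coprime D p"
  shows "tame p (adjoin F t)"
  unfolding tame_def
proof (intro ballI impI)
  have R: "is_ring F" using F by auto
  have tQ: "t \<in> Qbar" using algebraic_int_Qbar[OF t] .
  fix g assume g: "g \<in> adjoin F t" and gint: "algebraic_int (g ^ 2 * of_int p)"
  obtain q where q: "q \<in> polys F" "g = poly q t" using g by (auto simp: adjoin_def)
  define G where "G = {s \<in> gal. \<forall>a\<in>F. s a = a}"
  have Gg: "s \<in> gal" if "s \<in> G" for s using that by (simp add: G_def)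
  define C where "C = (\<lambda>s. s t) ` G"
  have Ccj: "C \<subseteq> cj t" unfolding C_def by (rule image_subsetI) (rule gal_in_cj[OF Gg])
  have finC: "finite C" using Ccj finite_cj[OF tQ] finite_subset by blast
  have CQ: "x \<in> Qbar" if "x \<in> C" for x using that Ccj cj_Qbar[OF tQ] by blast
  have Cint: "algebraic_int x" if "x \<in> C" for x using that Ccj cj_algebraic_int[OF t] by blast
  have "(\<lambda>x. x) \<in> G" by (simp add: G_def gal_id)
  hence tC: "t \<in> C" unfolding C_def by (rule rev_image_eqI) simp
  have bij: "bij_betw s C C" if s: "s \<in> G" for s
  proof -
    have "s ` C \<subseteq> C"
    proof
      fix y assume "y \<in> s ` C"
      then obtain u where u: "u \<in> G" "y = s (u t)" by (auto simp: C_def)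
      have "(\<lambda>x. s (u x)) \<in> G" using s u gal_comp[of s u] by (simp add: G_def)
      thus "y \<in> C" unfolding C_def u(2) by (rule rev_image_eqI) simp
    qed
    moreover have "inj_on s C" using gal_inj[OF Gg[OF s]] CQ by (meson inj_on_subset subsetI)
    ultimately show ?thesis using endo_inj_surj[OF finC] by (simp add: bij_betw_def)
  qed
  have sq: "s (poly q x) = poly q (s x)" if s: "s \<in> G" and x: "x \<in> Qbar" for s x
  proof -
    have "map_poly s q = q" using s q(1) by (intro poly_eqI) (auto simp: coeff_map_poly gal_0 G_def polys_def)
    thus ?thesis using emb_poly[OF Qbar_ring gal_emb[OF Gg[OF s]] _ x] q(1) polys_mono[OF F(2)] by auto
  qed
  define h where "h x = (\<Prod>y\<in>C-{x}. [:-y, 1:])" for x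
  have hint: "algebraic_int (Polynomial.coeff (h x) i)" for x i
    unfolding h_def using Cint by (intro coeff_prod_linear_integral) auto
  define P where "P = (\<Sum>x\<in>C. Polynomial.smult (poly q x) (h x))"
  have cP: "Polynomial.coeff P i = (\<Sum>x\<in>C. poly q x * Polynomial.coeff (h x) i)" for i
    by (simp add: P_def coeff_sum)
  have qQ: "poly q x \<in> Qbar" if "x \<in> C" for x
    using poly_closed[OF Qbar_ring _ CQ[OF that]] q(1) polys_mono[OF F(2)] by auto
  have cF: "Polynomial.coeff P i \<in> F" for i
  proof (rule fixed_mem_field[OF F])
    show "Polynomial.coeff P i \<in> Qbar"
      unfolding cP by (intro ring_sum[OF Qbar_ring] Qbar_closed qQ algebraic_int_Qbar hint)
    fix s assume "s \<in> gal" "\<And>a. a \<in> F \<Longrightarrow> s a = a"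
    hence s: "s \<in> G" by (simp add: G_def)
    note sg = Gg[OF s]
    have hs: "s (Polynomial.coeff (h x) i) = Polynomial.coeff (h (s x)) i" if x: "x \<in> C" for x
    proof -
      have "map_poly s (h x) = (\<Prod>y\<in>C-{x}. map_poly s [:-y, 1:])"
        unfolding h_def using sg by (rule map_poly_gal_prod) (use CQ in \<open>auto intro!: linear_polys[OF Qbar_ring]\<close>)
      also have "\<dots> = (\<Prod>y\<in>C-{x}. [:-s y, 1:])"
        by (rule prod.cong[OF refl]) (rule map_poly_gal_linear[OF sg], use CQ in auto)
      also have "\<dots> = h (s x)"
        unfolding h_def using bij_betw_DiffI[OF bij[OF s], of "{x}" "{s x}"] x bij[OF s]
        by (intro prod.reindex_bij_betw[of s _ _ "\<lambda>y. [:-y, 1:]"]) (auto simp: bij_betw_def)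
      finally show ?thesis using gal_0[OF sg] by (metis coeff_map_poly)
    qed
    have "s (Polynomial.coeff P i) = (\<Sum>x\<in>C. s (poly q x * Polynomial.coeff (h x) i))"
      unfolding cP by (rule gal_sum[OF sg]) (intro Qbar_closed qQ algebraic_int_Qbar hint)
    also have "\<dots> = (\<Sum>x\<in>C. poly q (s x) * Polynomial.coeff (h (s x)) i)"
    proof (rule sum.cong[OF refl])
      fix x assume x: "x \<in> C"
      have "s (poly q x * Polynomial.coeff (h x) i) = s (poly q x) * s (Polynomial.coeff (h x) i)"
        by (rule gal_mult[OF sg qQ[OF x] algebraic_int_Qbar[OF hint]])
      thus "s (poly q x * Polynomial.coeff (h x) i) = poly q (s x) * Polynomial.coeff (h (s x)) i"
        by (simp add: hs[OF x] sq[OF s CQ[OF x]])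
    qed
    also have "\<dots> = Polynomial.coeff P i"
      unfolding cP by (rule sum.reindex_bij_betw[OF bij[OF s], of "\<lambda>x. poly q x * Polynomial.coeff (h x) i"])
    finally show "s (Polynomial.coeff P i) = Polynomial.coeff P i" .
  qed
  have qint: "algebraic_int (poly q x ^ 2 * of_int p)" if "x \<in> C" for x
  proof -
    obtain s where s: "s \<in> G" "x = s t" using \<open>x \<in> C\<close> by (auto simp: C_def)
    have gQ: "g \<in> Qbar" using qQ[OF tC] q by simp
    have "s (g ^ 2 * of_int p) = poly q x ^ 2 * of_int p"
      using gQ s sq[OF s(1) tQ] q(2) Gg[OF s(1)]
      by (simp add: gal_mult gal_power gal_of_int Qbar_closed)
    thus ?thesis using gal_algebraic_int[OF Gg[OF s(1)] gint] by simp
  qed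
  have cross: "algebraic_int (poly q x * poly q y * of_int p)" if "x \<in> C" "y \<in> C" for x y
  proof (rule algebraic_int_sqrt_of)
    have "algebraic_int ((poly q x ^ 2 * of_int p) * (poly q y ^ 2 * of_int p))"
      using that by (intro algebraic_int_mult qint)
    thus "algebraic_int ((poly q x * poly q y * of_int p) ^ 2)"
      by (simp add: power2_eq_square mult_ac)
  qed
  have cint: "algebraic_int (Polynomial.coeff P i ^ 2 * of_int p)" for i
  proof -
    have "Polynomial.coeff P i ^ 2 * of_int p = (\<Sum>x\<in>C. \<Sum>y\<in>C. (poly q x * poly q y * of_int p) *
        (Polynomial.coeff (h x) i * Polynomial.coeff (h y) i))"
      unfolding cP power2_eq_square sum_product
      by (simp only: sum_distrib_right, intro sum.cong refl, simp add: mult_ac)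
    also have "algebraic_int \<dots>"
      by (intro algebraic_int_sum algebraic_int_mult cross hint)
    finally show ?thesis .
  qed
  have "\<exists>e. Rings.coprime e p \<and> algebraic_int (of_int e * Polynomial.coeff P i)" for i
    using tame cF cint by (simp add: tame_def)
  then obtain e where e: "\<And>i. Rings.coprime (e i) p" "\<And>i. algebraic_int (of_int (e i) * Polynomial.coeff P i)"
    by metis
  define n where "n = Polynomial.degree P"
  define E where "E = (\<Prod>i\<le>n. e i)"
  have E: "Rings.coprime E p" unfolding E_def using e(1) by (intro prod_coprime_left) auto
  have Eint: "algebraic_int (of_int E * poly P t)"
  proof -
    have "of_int E * poly P t = (\<Sum>i\<le>n. of_int (\<Prod>j\<in>{..n}-{i}. e j) * (of_int (e i) * Polynomial.coeff P i) * t ^ i)"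
      unfolding poly_altdef n_def[symmetric] sum_distrib_left E_def
      by (intro sum.cong refl) (simp add: prod.remove[of "{..n}"] mult_ac)
    also have "algebraic_int \<dots>"
      by (rule algebraic_int_sum)
         (rule algebraic_int_mult[OF algebraic_int_mult[OF algebraic_int_of_int e(2)] algebraic_int_power[OF t]])
    finally show ?thesis .
  qed
  define f' where "f' = (\<Prod>y\<in>C-{t}. t - y)"
  have Pt: "poly P t = g * f'"
  proof -
    have "poly (h x) t = 0" if "x \<in> C - {t}" for x
      unfolding h_def poly_prod using that finC tC by (intro prod_zero) auto
    hence "poly P t = poly q t * poly (h t) t"
      unfolding P_def poly_sum using finC tC by (subst sum.remove[of C t]) auto
    thus ?thesis by (simp add: q(2) h_def f'_def poly_prod)
  qed
  obtain w where w: "algebraic_int w" "discr t = f' * w"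
  proof -
    have fin: "finite (cj t)" using finite_cj[OF tQ] .
    have "discr t = (\<Prod>y\<in>cj t - {t}. t - y) * (\<Prod>x\<in>cj t - {t}. \<Prod>y\<in>cj t - {x}. x - y)"
      unfolding discr_def using fin cj_self by (rule prod.remove)
    also have "(\<Prod>y\<in>cj t - {t}. t - y) = (\<Prod>y\<in>cj t - {t} - (C - {t}). t - y) * f'"
      unfolding f'_def using fin Ccj by (intro prod.subset_diff) auto
    finally have "discr t = f' * ((\<Prod>y\<in>cj t - {t} - (C - {t}). t - y) * (\<Prod>x\<in>cj t - {t}. \<Prod>y\<in>cj t - {x}. x - y))"
      by (simp add: mult_ac)
    moreover have "algebraic_int ((\<Prod>y\<in>cj t - {t} - (C - {t}). t - y) * (\<Prod>x\<in>cj t - {t}. \<Prod>y\<in>cj t - {x}. x - y))"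
      using cj_algebraic_int[OF t] t
      by (intro algebraic_int_mult algebraic_int_prod algebraic_int_diff) auto
    ultimately show ?thesis using that by blast
  qed
  have eq: "of_int (D * E) * g = w * (of_int E * poly P t)"
    using D(1) w(2) by (simp add: Pt mult_ac)
  have "algebraic_int (of_int (D * E) * g)" unfolding eq by (rule algebraic_int_mult[OF w(1) Eint])
  moreover have "Rings.coprime (D * E) p" using D(2) E by simp
  ultimately show "\<exists>e. Rings.coprime e p \<and> algebraic_int (of_int e * g)" by blast
qed

lemma hull_insert_adjoin:
  assumes "S \<subseteq> Qbar" "x \<in> Qbar"
  shows "is_field hull (insert x S) \<subseteq> adjoin (is_field hull S) x"
proof -
  note adj = adjoin_field[OF is_field_hull field_hull_Qbar[OF assms(1)] assms(2)]
  show ?thesis using adj(1,2,3) by (intro field_hull_minimal) (auto intro: field_hull_inc)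
qed

lemma hull_Rats: "is_field hull {} = \<rat>"
proof
  show "is_field hull {} \<subseteq> \<rat>" using is_field_Rats by (intro field_hull_minimal) auto
  show "\<rat> \<subseteq> is_field hull {}" using field_Rats[OF is_field_hull] by auto
qed

text \<open>Adjoining one integral generator spoils at most the primes dividing its discriminant.\<close>

lemma tame_finitely_generated:
  assumes "finite M" "\<And>x. x \<in> M \<Longrightarrow> algebraic_int x"
  obtains N :: nat where "\<And>p. Factorial_Ring.prime p \<Longrightarrow> int N < p \<Longrightarrow> tame p (is_field hull M)"
  using assms
proof (induction M arbitrary: thesis rule: finite_induct)
  case empty
  thus ?case using tame_Rats by (simp add: hull_Rats)
next
  case (insert x M)
  obtain N :: nat where N: "\<And>p. Factorial_Ring.prime p \<Longrightarrow> int N < p \<Longrightarrow> tame p (is_field hull M)"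
    using insert by blast
  have x: "algebraic_int x" and MQ: "M \<subseteq> Qbar" using insert.prems algebraic_int_Qbar by auto
  obtain D where D: "D \<noteq> 0" "discr x = of_int D" using discr_int[OF x] .
  show ?case
  proof (rule insert.prems(1)[of "N + nat \<bar>D\<bar>"])
    fix p :: int assume p: "Factorial_Ring.prime p" "int (N + nat \<bar>D\<bar>) < p"
    have "\<not> p dvd D" using p D(1) zdvd_imp_le[of p "\<bar>D\<bar>"] by auto
    hence "Rings.coprime D p" using p(1) by (metis coprime_commute prime_imp_coprime)
    moreover have "tame p (is_field hull M)" using N p by simp
    ultimately have "tame p (adjoin (is_field hull M) x)"
      using tame_adjoin[OF is_field_hull field_hull_Qbar[OF MQ] _ x D(2)] by blast
    thus "tame p (is_field hull (insert x M))"
      using hull_insert_adjoin[OF MQ algebraic_int_Qbar[OF x]] tame_mono by blast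
  qed
qed

section \<open>Square roots of rational integers\<close>

definition sq :: "nat \<Rightarrow> complex" where "sq n = complex_of_real (sqrt (real n))"

lemma sq_squared: "sq n ^ 2 = of_nat n"
  by (simp add: sq_def of_real_power[symmetric] del: of_real_power)

lemma sq_mult: "sq (m * n) = sq m * sq n"
  by (simp add: sq_def real_sqrt_mult)

lemma sq_int: "algebraic_int (sq n)"
  by (rule algebraic_int_sqrt_of) (simp add: sq_squared)

lemma gal_sq: "s \<in> gal \<Longrightarrow> s (sq n) = sq n \<or> s (sq n) = - sq n"
  using gal_power[of s "sq n" 2] algebraic_int_Qbar[OF sq_int] gal_of_int[of s "int n"]
  by (simp add: sq_squared power2_eq_iff[symmetric])

lemma discr_sq: "discr (sq n) = 1 \<or> discr (sq n) = of_int (- 4 * int n)"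
proof -
  have "cj (sq n) \<subseteq> {sq n, - sq n}" using gal_sq by (auto simp: cj_def)
  moreover have "sq n \<in> cj (sq n)" by (rule cj_self)
  moreover have "A = {a} \<or> A = {a, b} \<and> a \<noteq> b" if "A \<subseteq> {a, b}" "a \<in> A" for A and a b :: complex
    using that by blast
  ultimately consider "cj (sq n) = {sq n}" | "cj (sq n) = {sq n, - sq n}" "sq n \<noteq> - sq n" by metis
  thus ?thesis
  proof cases
    case 2
    have "{sq n, - sq n} - {sq n} = {- sq n}" "{sq n, - sq n} - {- sq n} = {sq n}" using 2 by auto
    hence "discr (sq n) = - 4 * sq n ^ 2" using 2 unfolding discr_def by (simp add: power2_eq_square)
    thus ?thesis by (simp add: sq_squared)
  qed (simp add: discr_def)
qed

definition rootfield :: "complex set \<Rightarrow> nat \<Rightarrow> complex set" where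
  "rootfield M j = is_field hull (M \<union> sq ` {..j})"

lemma rootfield_field: "is_field (rootfield M j)"
  by (simp add: rootfield_def is_field_hull)

lemma rootfield_Qbar: "M \<subseteq> Qbar \<Longrightarrow> rootfield M j \<subseteq> Qbar"
  unfolding rootfield_def using algebraic_int_Qbar[OF sq_int] by (intro field_hull_Qbar) auto

lemma rootfield_mono: "i \<le> j \<Longrightarrow> rootfield M i \<subseteq> rootfield M j"
  unfolding rootfield_def by (intro hull_mono) auto

lemma rootfield_Suc:
  assumes "M \<subseteq> Qbar" shows "rootfield M (Suc j) \<subseteq> adjoin (rootfield M j) (sq (Suc j))"
proof -
  have "M \<union> sq ` {..Suc j} = insert (sq (Suc j)) (M \<union> sq ` {..j})" by (auto simp: atMost_Suc)
  thus ?thesis unfolding rootfield_def using assms algebraic_int_Qbar[OF sq_int]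
    by (simp only:) (intro hull_insert_adjoin, auto)
qed

text \<open>The number discr (sq n) is 1 or -4n, and so prime to an odd p larger than n.\<close>

lemma rootfield_tame:
  assumes M: "M \<subseteq> Qbar" and p: "Factorial_Ring.prime p" "p > 2" and tame: "tame p (is_field hull M)"
    and j: "int j < p"
  shows "tame p (rootfield M j)"
  using j
proof (induction j)
  case 0
  have "sq 0 \<in> is_field hull M" using ring_0[OF is_field_imp_ring[OF is_field_hull]] by (simp add: sq_def)
  hence "rootfield M 0 \<subseteq> is_field hull M"
    unfolding rootfield_def using is_field_hull by (intro field_hull_minimal) (auto intro: field_hull_inc)
  thus ?case using tame tame_mono by blast
next
  case (Suc j)
  obtain D where D: "D \<noteq> 0" "discr (sq (Suc j)) = of_int D" using discr_int[OF sq_int] .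
  have D': "D = 1 \<or> D = - 4 * int (Suc j)"
    using discr_sq[of "Suc j"] unfolding D(2) by (metis of_int_1 of_int_eq_iff)
  have "Rings.coprime D p"
    using D'
  proof
    assume D4: "D = - 4 * int (Suc j)"
    have "\<not> p dvd int (Suc j)" using zdvd_imp_le[of p "int (Suc j)"] Suc.prems by auto
    moreover have "\<not> p dvd 4" 
    proof
      assume "p dvd 4"
      hence "p dvd 2 * 2" by simp
      hence "p dvd 2" using p(1) by (metis prime_dvd_multD)
      thus False using zdvd_imp_le[of p 2] p(2) by simp
    qed
    ultimately have "\<not> p dvd D" using p(1) unfolding D4 by (metis dvd_minus_iff mult_minus_left prime_dvd_mult_iff)
    thus ?thesis using p(1) by (metis coprime_commute prime_imp_coprime)
  qed simp
  moreover have "tame p (rootfield M j)" using Suc by simp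
  ultimately have "tame p (adjoin (rootfield M j) (sq (Suc j)))"
    using tame_adjoin[OF rootfield_field rootfield_Qbar[OF M] _ sq_int D(2)] by blast
  thus ?case using rootfield_Suc[OF M] tame_mono by blast
qed

lemma adjoin_sqrt:
  assumes F: "is_field F" and x: "x ^ 2 \<in> F" and y: "y \<in> adjoin F x"
  obtains a b where "a \<in> F" "b \<in> F" "y = a + b * x"
proof -
  have R: "is_ring F" using F by auto
  have "\<exists>a b. a \<in> F \<and> b \<in> F \<and> poly q x = a + b * x" if "q \<in> polys F" for q
    using that
  proof (induction q)
    case 0 thus ?case using ring_0[OF R] by (intro exI[of _ 0]) auto
  next
    case (pCons c q)
    have c: "c \<in> F" "q \<in> polys F"
      using pCons.prems by (auto simp: polys_def coeff_pCons split: nat.splits)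
    then obtain a b where ab: "a \<in> F" "b \<in> F" "poly q x = a + b * x" using pCons.IH by blast
    have "poly (pCons c q) x = (c + b * x ^ 2) + a * x"
      by (simp add: ab power2_eq_square algebra_simps)
    moreover have "c + b * x ^ 2 \<in> F" using ab c x R by (intro ring_add ring_mult)
    ultimately show ?case using ab by blast
  qed
  thus ?thesis using y that by (auto simp: adjoin_def)
qed

lemma ln_norm_diff_le:
  fixes x y :: complex
  assumes "x \<noteq> y"
  shows "ln (cmod (x - y)) \<le> ln 2 + ln (max 1 (cmod x)) + ln (max 1 (cmod y))"
proof -
  let ?a = "max 1 (cmod x)" and ?b = "max 1 (cmod y)"
  have "cmod (x - y) \<le> cmod x + cmod y" by (rule norm_triangle_ineq4)
  also have "\<dots> \<le> ?a * ?b + ?a * ?b"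
    by (intro add_mono order.trans[OF _ mult_mono[of "cmod x" ?a 1 ?b]] order.trans[OF _ mult_mono[of 1 ?a "cmod y" ?b]]) auto
  finally have "ln (cmod (x - y)) \<le> ln (2 * ?a * ?b)" using assms by (subst ln_le_cancel_iff) auto
  also have "\<dots> = ln 2 + ln ?a + ln ?b"
  proof -
    have "ln (2 * a * b) = ln 2 + ln a + ln b" if "a > 0" "b > 0" for a b :: real
      using that by (simp add: ln_mult)
    thus ?thesis by (simp add: less_max_iff_disj)
  qed
  finally show ?thesis .
qed

text \<open>Write a = c + b * sq p with b and c in F. An automorphism over F that negates the root of p
  changes a by 2b times that root. As p is tame in F, the number 2b is integral, so the square of
  the difference of a and its image is divisible by p.\<close>

lemma height_new_square_root:
  assumes F: "is_field F" "F \<subseteq> Qbar" and p: "Factorial_Ring.prime p" and tame: "tame (int p) F"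
    and new: "sq p \<notin> F" and a: "algebraic_int a" "a \<in> adjoin F (sq p)" "a \<notin> F"
  shows "ln p \<le> 2 * ln 2 + 4 * hm a"
proof -
  have R: "is_ring F" using F by auto
  have pQ: "sq p \<in> Qbar" using algebraic_int_Qbar[OF sq_int] .
  have pos: "p > 0" using p prime_gt_0_nat by blast
  obtain c b where cb: "c \<in> F" "b \<in> F" "a = c + b * sq p"
  proof (rule adjoin_sqrt[OF F(1) _ a(2)])
    show "sq p ^ 2 \<in> F" unfolding sq_squared by (rule ring_of_nat[OF R])
  qed
  have b0: "b \<noteq> 0" using cb a(3) by auto
  obtain s where s0: "emb Qbar s" and s': "\<And>u. u \<in> F \<Longrightarrow> s u = u" "s (sq p) \<noteq> sq p"
    using emb_moving[OF F pQ new] by metis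
  have s: "s \<in> gal" "\<And>u. u \<in> F \<Longrightarrow> s u = u" "s (sq p) \<noteq> sq p" using s0 s' by (simp_all add: gal_def)
  have sp: "s (sq p) = - sq p" using gal_sq[OF s(1)] s(3) by blast
  have Q: "b \<in> Qbar" "c \<in> Qbar" using cb F by auto
  have sa: "s a = c - b * sq p"
    using cb Q pQ s sp by (simp add: gal_add gal_mult Qbar_closed)
  define g where "g = 2 * b"
  define z where "z = g ^ 2"
  have pz: "of_int (int p) * z = (a - s a) ^ 2"
  proof -
    have "(a - s a) ^ 2 = (g * sq p) ^ 2" unfolding sa g_def by (simp add: cb(3) power_mult_distrib)
    also have "\<dots> = of_int (int p) * z" unfolding z_def by (simp add: power_mult_distrib sq_squared)
    finally show ?thesis by simp
  qed
  have pint: "algebraic_int (of_int (int p) * z)"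
    unfolding pz using a(1) gal_algebraic_int[OF s(1) a(1)] by auto
  have "g \<in> F" unfolding g_def using cb by (intro ring_mult[OF R] ring_numeral[OF R])
  then obtain e where e: "Rings.coprime e (int p)" "algebraic_int (of_int e * g)"
    using tame pint by (auto simp: tame_def z_def mult.commute)
  have eint: "algebraic_int (of_int (e ^ 2) * z)"
    using algebraic_int_power[OF e(2), of 2] by (simp add: z_def power_mult_distrib)
  have "Rings.coprime (e ^ 2) (int p)" using e(1) by simp
  then obtain u v where uv: "u * e ^ 2 + v * int p = 1" using bezout_int[of "e ^ 2" "int p"] by auto
  have "of_int u * (of_int (e ^ 2) * z) + of_int v * (of_int (int p) * z) = of_int (u * e ^ 2 + v * int p) * z"
    by (simp add: algebra_simps)
  also have "\<dots> = z" using uv by simp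
  finally have zint: "algebraic_int z" using pint eint
    by (metis algebraic_int_add algebraic_int_mult algebraic_int_of_int)
  have z0: "z \<noteq> 0" using b0 by (simp add: z_def g_def)
  have aQ: "a \<in> Qbar" and saQ: "s a \<in> Qbar"
    using algebraic_int_Qbar[OF a(1)] gal_Qbar[OF s(1)] by auto
  have "0 \<le> (2 * ln 2 - ln p) + 2 * (\<Sum>i<length [a, s a]. hm ([a, s a] ! i))"
  proof (rule height_bound_by_averaging[OF zint z0])
    show "set [a, s a] \<subseteq> Qbar" using aQ saQ by simp
    fix t assume t: "t \<in> gal"
    have zQ: "z \<in> Qbar" using algebraic_int_Qbar[OF zint] .
    have tz0: "t z \<noteq> 0" using gal_eq_0[OF t zQ] z0 by simp
    have "of_int (int p) * t z = t (of_int (int p) * z)"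
      using gal_mult[OF t Qbar_closed(8)[of "int p"] zQ] gal_of_int[OF t, of "int p"] by simp
    also have "\<dots> = (t a - t (s a)) ^ 2"
      unfolding pz using aQ saQ t by (simp add: gal_power gal_diff Qbar_closed)
    finally have eq: "of_int (int p) * t z = (t a - t (s a)) ^ 2" .
    have ne: "t a \<noteq> t (s a)" using eq tz0 pos by auto
    have "real p * cmod (t z) = cmod (t a - t (s a)) ^ 2"
      using arg_cong[OF eq, of cmod] by (simp add: norm_mult norm_power)
    hence "ln (real p * cmod (t z)) = ln (cmod (t a - t (s a)) ^ 2)" by simp
    hence "ln p + ln (cmod (t z)) = 2 * ln (cmod (t a - t (s a)))"
      using pos tz0 ne by (simp add: ln_mult ln_realpow)
    also have "\<dots> \<le> 2 * (ln 2 + ln (max 1 (cmod (t a))) + ln (max 1 (cmod (t (s a)))))"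
      using ln_norm_diff_le[OF ne] by simp
    finally show "ln (cmod (t z)) \<le> (2 * ln 2 - ln p) + 2 * (\<Sum>i<length [a, s a]. ln (max 1 (cmod (t ([a, s a] ! i)))))"
      by simp
  qed
  moreover have "hm (s a) = hm a" by (rule hm_gal[OF s(1) aQ])
  ultimately show ?thesis by simp
qed

text \<open>The least j for which a lies in the j-th field is a prime or small, because the square root of a
  product of smaller numbers is already present at the preceding stage. The height bound for a new
  square root then limits j.\<close>

theorem bounded_height_rootfield:
  assumes M: "finite M" "\<And>x. x \<in> M \<Longrightarrow> algebraic_int x"
  obtains J where "\<And>a j. algebraic_int a \<Longrightarrow> a \<in> rootfield M j \<Longrightarrow> hm a \<le> B \<Longrightarrow> a \<in> rootfield M J"
proof -
  have MQ: "M \<subseteq> Qbar" using M(2) algebraic_int_Qbar by blast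
  obtain N where N: "\<And>p. Factorial_Ring.prime p \<Longrightarrow> int N < p \<Longrightarrow> tame p (is_field hull M)"
    using tame_finitely_generated[OF M] by blast
  define J where "J = N + 2 + nat \<lceil>exp (2 * ln 2 + 4 * B)\<rceil>"
  have "a \<in> rootfield M J" if a: "algebraic_int a" "a \<in> rootfield M j" "hm a \<le> B" for a j
  proof -
    define i where "i = (LEAST i. a \<in> rootfield M i)"
    have i: "a \<in> rootfield M i" unfolding i_def using a(2) by (rule LeastI)
    show ?thesis
    proof (cases "i \<le> J")
      case True thus ?thesis using i rootfield_mono by blast
    next
      case False
      then obtain k where k: "i = Suc k" by (cases i) auto
      have nk: "a \<notin> rootfield M k" using not_less_Least[of k "\<lambda>i. a \<in> rootfield M i"] k by (simp add: i_def)
      have adj: "a \<in> adjoin (rootfield M k) (sq i)" using rootfield_Suc[OF MQ, of k] i k by auto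
      have new: "sq i \<notin> rootfield M k"
      proof
        assume "sq i \<in> rootfield M k"
        moreover obtain q where "q \<in> polys (rootfield M k)" "a = poly q (sq i)"
          using adj unfolding adjoin_def by (elim imageE)
        ultimately show False
          using poly_closed[OF is_field_imp_ring[OF rootfield_field], of q M k "sq i"] nk by simp
      qed
      have "Factorial_Ring.prime i"
      proof (rule ccontr)
        assume np: "\<not> Factorial_Ring.prime i"
        obtain u v where uv: "i = u * v" "u < i" "v < i"
        proof -
          have "i > 1" using False by (simp add: J_def)
          then obtain u where u: "u dvd i" "u \<noteq> 1" "u \<noteq> i" using np by (auto simp: prime_nat_iff)
          then obtain v where v: "i = u * v" by (elim dvdE)
          have "v \<noteq> 0" using v \<open>i > 1\<close> by (intro notI) simp
          hence "v dvd i" "v \<noteq> i" using u v \<open>i > 1\<close> by auto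
          hence "u < i" "v < i" using u \<open>i > 1\<close> dvd_imp_le[of u i] dvd_imp_le[of v i] by linarith+
          thus ?thesis using that v by blast
        qed
        have "sq u \<in> rootfield M k" "sq v \<in> rootfield M k"
          unfolding rootfield_def using uv(2,3) unfolding k by (intro field_hull_inc UnI2 imageI; simp)+
        hence "sq i \<in> rootfield M k"
          unfolding uv(1) sq_mult by (rule ring_mult[OF is_field_imp_ring[OF rootfield_field]])
        thus False using new by simp
      qed
      hence p: "Factorial_Ring.prime i" "Factorial_Ring.prime (int i)" by simp_all
      have "tame (int i) (rootfield M k)"
        using rootfield_tame[OF MQ p(2) _ N[OF p(2)]] False k by (simp add: J_def)
      hence "ln i \<le> 2 * ln 2 + 4 * hm a"
        by (rule height_new_square_root[OF rootfield_field rootfield_Qbar[OF MQ] p(1) _ new a(1) adj nk])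
      hence "ln i \<le> 2 * ln 2 + 4 * B" using a(3) by simp
      hence "exp (ln i) \<le> exp (2 * ln 2 + 4 * B)" by (simp only: exp_le_cancel_iff)
      hence "real i \<le> exp (2 * ln 2 + 4 * B)" using False by simp
      moreover have "real J < real i" using False by simp
      ultimately show ?thesis unfolding J_def by linarith
    qed
  qed
  thus ?thesis using that by blast
qed

corollary finite_bounded_height_rootfield:
  assumes M: "finite M" "\<And>x. x \<in> M \<Longrightarrow> algebraic_int x"
  shows "finite {a. algebraic_int a \<and> (\<exists>j. a \<in> rootfield M j) \<and> hm a \<le> B}"
proof -
  have MQ: "M \<subseteq> Qbar" using M(2) algebraic_int_Qbar by blast
  obtain J where J: "\<And>a j. algebraic_int a \<Longrightarrow> a \<in> rootfield M j \<Longrightarrow> hm a \<le> B \<Longrightarrow> a \<in> rootfield M J"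
    using bounded_height_rootfield[OF M] by blast
  have "finite (M \<union> sq ` {..J})" "M \<union> sq ` {..J} \<subseteq> Qbar"
    using M(1) MQ algebraic_int_Qbar[OF sq_int] by auto
  then obtain d where d: "\<And>x. x \<in> rootfield M J \<Longrightarrow> card (cj x) \<le> d"
    unfolding rootfield_def using bounded_degree_hull by metis
  show ?thesis by (rule finite_subset[OF _ finite_bounded_height[of d B]]) (use J d in blast)
qed

section \<open>Cubic extensions\<close>

text \<open>One step of the tower of cubic fields. Since F has all square roots of rational numbers, k
  generates a cyclic cubic extension of F, and s induces a generator of its Galois group.\<close>

locale cubic_step =
  fixes F :: "complex set" and k :: complex and s :: "complex \<Rightarrow> complex"
  assumes F: "is_field F" "F \<subseteq> Qbar"
    and k: "algebraic_int k" and deg: "card (cj k) = 3"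
    and s: "s \<in> gal" and fixF: "\<And>a. a \<in> F \<Longrightarrow> s a = a" and moves: "s k \<noteq> k"
    and roots: "\<And>x. x ^ 2 \<in> \<rat> \<Longrightarrow> x \<in> F"
begin

lemma kQ: "k \<in> Qbar" using k by (rule algebraic_int_Qbar)

definition K where "K = adjoin \<rat> k"

text \<open>The trace of the cubic field: s, its square and the identity induce the three embeddings.\<close>

definition tr where "tr x = x + s x + s (s x)"

definition wedge where "wedge x y = x * s y - y * s x"

text \<open>The three conjugates: s fixes the square root of the discriminant of k, which lies in F,
  so it acts on them as an even permutation.\<close>

lemma conjugates: "cj k = {k, s k, s (s k)}" "s (s k) \<noteq> k" "s (s k) \<noteq> s k" "s (s (s k)) = k"
proof -
  have fin: "finite (cj k)" using finite_cj[OF kQ] .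
  have mem: "k \<in> cj k" "s k \<in> cj k" "s (s k) \<in> cj k" using cj_self gal_cj[OF s] by auto
  have memQ: "x \<in> Qbar" if "x \<in> cj k" for x using cj_Qbar[OF kQ that] .
  have inj: "x = y" if "s x = s y" "x \<in> cj k" "y \<in> cj k" for x y
    using gal_inj[OF s] that memQ by (auto simp: inj_on_def)
  show ne2: "s (s k) \<noteq> s k" using inj[of "s k" k] mem moves by auto
  show ne: "s (s k) \<noteq> k"
  proof
    assume ssk: "s (s k) = k"
    have "card (cj k - {k, s k}) = 1" using fin mem deg moves by (simp add: card_Diff_subset)
    then obtain t where t: "cj k - {k, s k} = {t}" by (auto simp: card_1_singleton_iff)
    hence cjk: "cj k = {k, s k, t}" "t \<noteq> k" "t \<noteq> s k" using mem by auto
    have "s t \<in> cj k" using gal_cj[OF s] cjk(1) by blast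
    moreover have "s t \<noteq> k" "s t \<noteq> s k" using inj[of t "s k"] inj[of t k] ssk mem cjk by auto
    ultimately have st: "s t = t" using cjk by auto
    define V where "V = (k - s k) * (s k - t) * (t - k)"
    have "{k, s k, t} - {k} = {s k, t}" "{k, s k, t} - {s k} = {k, t}" "{k, s k, t} - {t} = {k, s k}"
      using cjk moves by auto
    hence "discr k = - (V ^ 2)"
      unfolding discr_def cjk(1) V_def using cjk moves
      by (simp add: power2_eq_square algebra_simps)
    moreover obtain D where "D \<noteq> 0" "discr k = of_int D" using discr_int[OF k] .
    ultimately have V2: "V ^ 2 = of_int (- D)" "V \<noteq> 0" by (auto simp: minus_equation_iff)
    have "V \<in> F" using V2 by (intro roots) simp
    hence "s V = V" by (rule fixF)
    moreover have tQ: "t \<in> Qbar" "s k \<in> Qbar" using memQ cjk by auto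
    have "s V = - V"
      unfolding V_def using kQ tQ ssk st
      by (simp add: gal_mult[OF s] gal_diff[OF s] Qbar_closed) (simp add: algebra_simps)
    ultimately show False using V2(2) by simp
  qed
  have "{k, s k, s (s k)} \<subseteq> cj k" "card {k, s k, s (s k)} = card (cj k)"
    using mem ne ne2 moves deg by auto
  thus cjk: "cj k = {k, s k, s (s k)}" using card_subset_eq[OF fin] by blast
  have "s (s (s k)) \<in> cj k" using mem gal_cj[OF s] by blast
  moreover have "s (s (s k)) \<noteq> s k" "s (s (s k)) \<noteq> s (s k)"
    using inj[of "s (s k)" k] inj[of "s (s k)" "s k"] mem ne ne2 by auto
  ultimately show "s (s (s k)) = k" using cjk by auto
qed

lemma K_field: "is_field K" "K \<subseteq> Qbar" "k \<in> K" "\<rat> \<subseteq> K"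
  unfolding K_def using adjoin_field[OF is_field_Rats Rats_Qbar kQ] by auto

lemmas K_ring = is_field_imp_ring[OF K_field(1)]

lemma K_Qbar: "x \<in> K \<Longrightarrow> x \<in> Qbar" using K_field(2) by auto

lemma sQ: "x \<in> Qbar \<Longrightarrow> s x \<in> Qbar" by (rule gal_Qbar[OF s])

lemmas s_simps = gal_diff[OF s] gal_add[OF s] gal_mult[OF s] gal_power[OF s] gal_minus[OF s]
  gal_0[OF s] gal_1[OF s] gal_numeral[OF s] gal_of_int[OF s] Qbar_closed sQ K_Qbar

lemma K_poly:
  assumes "x \<in> K"
  obtains q where "q \<in> polys \<rat>" "x = poly q k" "\<And>t. t \<in> gal \<Longrightarrow> t x = poly q (t k)"
    "s (s x) = poly q (s (s k))"
proof -
  obtain q where q: "q \<in> polys \<rat>" "x = poly q k" using assms unfolding K_def adjoin_def by (elim imageE)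
  have t: "t x = poly q (t k)" if "t \<in> gal" for t unfolding q(2) by (rule gal_poly_Rats[OF that q(1) kQ])
  have "s (s x) = poly q (s (s k))" unfolding t[OF s] by (rule gal_poly_Rats[OF s q(1) sQ[OF kQ]])
  thus ?thesis using that q t by blast
qed

lemma s3: assumes "x \<in> K" shows "s (s (s x)) = x"
proof -
  obtain q where q: "q \<in> polys \<rat>" "x = poly q k" "s (s x) = poly q (s (s k))" using K_poly[OF assms] by metis
  have "s (s (s x)) = poly q (s (s (s k)))" unfolding q(3) by (rule gal_poly_Rats[OF s q(1) sQ[OF sQ[OF kQ]]])
  thus ?thesis using q(2) conjugates(4) by simp
qed

lemma sum_conjugates: "(\<Sum>z\<in>cj k. f z) = f k + f (s k) + f (s (s k))"
  unfolding conjugates(1) using conjugates(2,3) moves by (simp add: add.assoc)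

lemma tr_Rats: assumes "x \<in> K" shows "tr x \<in> \<rat>"
proof -
  obtain q where q: "q \<in> polys \<rat>" "x = poly q k" "\<And>t. t \<in> gal \<Longrightarrow> t x = poly q (t k)"
    "s (s x) = poly q (s (s k))" using K_poly[OF assms] by metis
  have eq: "tr x = (\<Sum>z\<in>cj k. poly q z)"
    unfolding sum_conjugates tr_def q(4) unfolding q(3)[OF s] using q(2) by simp
  have pQ: "poly q z \<in> Qbar" if "z \<in> cj k" for z
    using poly_closed[OF Qbar_ring _ cj_Qbar[OF kQ that]] q(1) polys_mono[OF Rats_Qbar] by auto
  show ?thesis
  proof (rule gal_fixed_Rats)
    show "tr x \<in> Qbar" unfolding eq using pQ by (intro ring_sum[OF Qbar_ring])
    fix t assume t: "t \<in> gal"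
    have "t (tr x) = (\<Sum>z\<in>cj k. t (poly q z))" unfolding eq using t pQ by (intro gal_sum)
    also have "\<dots> = (\<Sum>z\<in>cj k. poly q (t z))"
      using gal_poly_Rats[OF t q(1) cj_Qbar[OF kQ]] by simp
    also have "\<dots> = tr x" unfolding eq by (rule sum.reindex_bij_betw[OF gal_bij_cj[OF t kQ]])
    finally show "t (tr x) = tr x" .
  qed
qed

lemma tr_add: "x \<in> K \<Longrightarrow> y \<in> K \<Longrightarrow> tr (x + y) = tr x + tr y"
  and tr_diff: "x \<in> K \<Longrightarrow> y \<in> K \<Longrightarrow> tr (x - y) = tr x - tr y"
  by (simp_all add: tr_def s_simps)

lemma s_Rats: "r \<in> \<rat> \<Longrightarrow> s r = r" by (rule gal_Rats[OF s])

lemma tr_scale: "r \<in> \<rat> \<Longrightarrow> x \<in> K \<Longrightarrow> tr (r * x) = r * tr x"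
  using Rats_Qbar by (simp add: tr_def s_simps s_Rats subset_iff algebra_simps)

lemma tr_of_Rat: "r \<in> \<rat> \<Longrightarrow> tr r = 3 * r"
  by (simp add: tr_def s_Rats)

definition OK where "OK = {x \<in> K. algebraic_int x}"

lemma OK_ring: "is_ring OK"
  unfolding OK_def is_ring_def using K_ring by (auto intro: ring_closed)

lemma OK_K: "x \<in> OK \<Longrightarrow> x \<in> K" and OK_int: "x \<in> OK \<Longrightarrow> algebraic_int x" by (simp_all add: OK_def)

lemma k_OK: "k \<in> OK" using k K_field(3) by (simp add: OK_def)

lemma tr_int: assumes "x \<in> OK" obtains n :: int where "tr x = of_int n"
proof -
  note i = OK_int[OF assms]
  have "algebraic_int (tr x)" unfolding tr_def
    by (rule algebraic_int_add[OF algebraic_int_add[OF i gal_algebraic_int[OF s i]]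
          gal_algebraic_int[OF s gal_algebraic_int[OF s i]]])
  hence "tr x \<in> \<int>" using tr_Rats[OF OK_K[OF assms]] by (rule rational_algebraic_int_is_int)
  thus ?thesis using that by (auto elim: Ints_cases)
qed

text \<open>Integers modulo the rational integers, realised as a lattice of elements of trace zero.\<close>

definition traceless where "traceless x = 3 * x - tr x"

definition lattice where "lattice = traceless ` OK"

lemma traceless_K: "x \<in> K \<Longrightarrow> traceless x \<in> K"
  unfolding traceless_def using K_ring tr_Rats K_field(4) by (auto intro!: ring_closed)

lemma tr_traceless: assumes "x \<in> K" shows "tr (traceless x) = 0"
proof -
  have "tr (3 * x - tr x) = tr (3 * x) - tr (tr x)"
    using assms K_ring tr_Rats K_field(4) by (intro tr_diff ring_mult ring_numeral) auto
  thus ?thesis using assms tr_Rats[OF assms] by (simp add: traceless_def tr_scale tr_of_Rat)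
qed

lemma lattice_K: "y \<in> lattice \<Longrightarrow> y \<in> K"
  by (auto simp: lattice_def intro: traceless_K OK_K)

lemma lattice_tr: "y \<in> lattice \<Longrightarrow> tr y = 0"
  by (auto simp: lattice_def intro: tr_traceless OK_K)

lemma lattice_int: assumes "y \<in> lattice" shows "algebraic_int y"
proof -
  obtain x where x: "x \<in> OK" "y = traceless x" using assms unfolding lattice_def by (elim imageE)
  obtain n where "tr x = of_int n" using tr_int[OF x(1)] .
  thus ?thesis unfolding x(2) traceless_def using OK_int[OF x(1)] by auto
qed

lemma lattice_combination:
  assumes "y \<in> lattice" "z \<in> lattice" shows "y - of_int n * z \<in> lattice"
proof -
  obtain x x' where x: "x \<in> OK" "y = traceless x" "x' \<in> OK" "z = traceless x'"
    using assms unfolding lattice_def by blast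
  have "tr (x - of_int n * x') = tr x - of_int n * tr x'"
    using OK_K x(1,3) K_ring by (subst tr_diff) (auto simp: tr_scale intro!: ring_mult ring_of_int)
  hence "y - of_int n * z = traceless (x - of_int n * x')"
    by (simp add: x traceless_def algebra_simps)
  moreover have "x - of_int n * x' \<in> OK" using x OK_ring by (intro ring_diff ring_mult ring_of_int)
  ultimately show ?thesis unfolding lattice_def by (rule image_eqI)
qed

lemma tr_zero: "tr y = 0 \<Longrightarrow> s (s y) = - y - s y"
  by (simp add: tr_def add_eq_0_iff algebra_simps)

definition herm where "herm x y = x * cnj y + s x * cnj (s y) + s (s x) * cnj (s (s y))"

definition size where "size x = (cmod x)\<^sup>2 + (cmod (s x))\<^sup>2 + (cmod (s (s x)))\<^sup>2"

text \<open>Complex conjugation permutes the three embeddings of K, so the Hermitian form is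
  real on K, and symmetric.\<close>

lemma herm_real:
  assumes "x \<in> K" "y \<in> K" shows "herm x y \<in> \<real>"
proof -
  obtain q where q: "q \<in> polys \<rat>" "x = poly q k" "\<And>t. t \<in> gal \<Longrightarrow> t x = poly q (t k)"
    "s (s x) = poly q (s (s k))" using K_poly[OF assms(1)] by metis
  obtain r where r: "r \<in> polys \<rat>" "y = poly r k" "\<And>t. t \<in> gal \<Longrightarrow> t y = poly r (t k)"
    "s (s y) = poly r (s (s k))" using K_poly[OF assms(2)] by metis
  define f where "f z = poly q z * cnj (poly r z)" for z
  have eq: "herm x y = (\<Sum>z\<in>cj k. f z)"
    unfolding sum_conjugates herm_def q(4) r(4) f_def unfolding q(3)[OF s] r(3)[OF s] using q(2) r(2) by simp
  have "cnj (f z) = f (cnj z)" if "z \<in> cj k" for z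
    using gal_poly_Rats[OF gal_cnj q(1) cj_Qbar[OF kQ that]] gal_poly_Rats[OF gal_cnj r(1) cj_Qbar[OF kQ that]]
    by (simp add: f_def)
  hence "cnj (herm x y) = (\<Sum>z\<in>cj k. f (cnj z))" unfolding eq by simp
  also have "\<dots> = herm x y" unfolding eq by (rule sum.reindex_bij_betw[OF gal_bij_cj[OF gal_cnj kQ]])
  finally show ?thesis by (simp add: Reals_cnj_iff)
qed

lemma size_herm: "complex_of_real (size x) = herm x x"
  by (simp add: size_def herm_def complex_norm_square del: of_real_power) 

lemma herm_of_real:
  assumes "x \<in> K" "y \<in> K" shows "herm x y = complex_of_real (Re (herm x y))"
  using herm_real[OF assms] by (metis of_real_Re)

lemma herm_sym:
  assumes "x \<in> K" "y \<in> K" shows "herm y x = herm x y"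
proof -
  have "herm y x = cnj (herm x y)" by (simp add: herm_def mult.commute)
  thus ?thesis using herm_real[OF assms] by (simp add: Reals_cnj_iff)
qed

text \<open>Lagrange's identity for vectors in three dimensional space orthogonal to (1,1,1): their
  three minors agree up to sign.\<close>

lemma gram_wedge:
  assumes "x \<in> K" "y \<in> K" "tr x = 0" "tr y = 0"
  shows "3 * (cmod (wedge x y))\<^sup>2 = size x * size y - (Re (herm x y))\<^sup>2"
proof -
  have "complex_of_real (3 * (cmod (wedge x y))\<^sup>2) = 3 * (wedge x y * cnj (wedge x y))"
    by (simp add: complex_norm_square del: of_real_power)
  also have "\<dots> = herm x x * herm y y - herm x y * herm y x"
    unfolding herm_def wedge_def tr_zero[OF assms(3)] tr_zero[OF assms(4)]
    by (simp add: algebra_simps)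
  also have "\<dots> = complex_of_real (size x * size y - (Re (herm x y))\<^sup>2)"
    unfolding herm_sym[OF assms(1,2)] size_herm[symmetric]
    by (subst (1 2) herm_of_real[OF assms(1,2)]) (simp add: power2_eq_square)
  finally show ?thesis by (simp only: of_real_eq_iff)
qed

lemma size_combination:
  assumes "x \<in> K" "y \<in> K" "a \<in> \<rat>" "b \<in> \<rat>"
  shows "size (a * x + b * y) = (Re a)\<^sup>2 * size x + 2 * Re a * Re b * Re (herm x y) + (Re b)\<^sup>2 * size y"
proof -
  have ab: "complex_of_real (Re a) = a" "complex_of_real (Re b) = b" "cnj a = a" "cnj b = b"
    using assms(3,4) by (auto elim!: Rats_cases')
  have Q: "a \<in> Qbar" "b \<in> Qbar" using assms(3,4) Rats_Qbar by auto
  have "complex_of_real (size (a * x + b * y)) = a ^ 2 * herm x x + a * b * herm x y + a * b * herm y x + b ^ 2 * herm y y"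
    unfolding size_herm herm_def using assms Q
    by (simp add: s_simps s_Rats ab) (simp add: algebra_simps power2_eq_square)
  also have "\<dots> = a ^ 2 * complex_of_real (size x) + 2 * a * b * complex_of_real (Re (herm x y)) + b ^ 2 * complex_of_real (size y)"
    unfolding herm_sym[OF assms(1,2)] size_herm[symmetric] herm_of_real[OF assms(1,2), symmetric] by simp
  also have "\<dots> = complex_of_real ((Re a)\<^sup>2 * size x + 2 * Re a * Re b * Re (herm x y) + (Re b)\<^sup>2 * size y)"
    by (simp add: ab)
  finally show ?thesis by (simp only: of_real_eq_iff)
qed

lemma size_pos: assumes "x \<noteq> 0" shows "size x > 0"
  using assms by (simp add: size_def add_pos_nonneg)

lemma wedge_linear:
  assumes "x \<in> K" "y \<in> K" "z \<in> K" "a \<in> \<rat>" "b \<in> \<rat>"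
  shows "wedge (a * x + b * y) z = a * wedge x z + b * wedge y z"
    "wedge z (a * x + b * y) = a * wedge z x + b * wedge z y"
  using assms Rats_Qbar by (simp_all add: wedge_def s_simps s_Rats subset_iff algebra_simps)

lemma wedge_self: "wedge x x = 0" by (simp add: wedge_def)

lemma cj_K_subset: assumes "x \<in> K" shows "cj x \<subseteq> {x, s x, s (s x)}"
proof
  obtain q where q: "x = poly q k" "\<And>t. t \<in> gal \<Longrightarrow> t x = poly q (t k)"
    "s (s x) = poly q (s (s k))" using K_poly[OF assms] by metis
  fix z assume "z \<in> cj x"
  then obtain t where t: "t \<in> gal" "z = t x" unfolding cj_def by (elim imageE)
  have "t k \<in> {k, s k, s (s k)}" using gal_in_cj[OF t(1), of k] conjugates(1) by simp
  thus "z \<in> {x, s x, s (s x)}" unfolding t(2) q(3) unfolding q(2)[OF t(1)] q(2)[OF s] using q(1) by auto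
qed

lemma cj_K_card: assumes "x \<in> K" shows "card (cj x) \<le> 3"
proof -
  have "card (cj x) \<le> card {x, s x, s (s x)}" by (rule card_mono[OF _ cj_K_subset[OF assms]]) simp
  also have "\<dots> \<le> 3" by (simp add: card_insert_if)
  finally show ?thesis .
qed

lemma cj_K_size: assumes "x \<in> K" "z \<in> cj x" shows "(cmod z)\<^sup>2 \<le> size x"
  using cj_K_subset[OF assms(1)] assms(2) by (auto simp: size_def)

lemma finite_lattice_ball: "finite {y \<in> lattice. size y \<le> r}"
proof (rule finite_subset[OF _ finite_bounded_conjugates[of 3 "sqrt (max 0 r)"]], safe)
  fix y z assume y: "y \<in> lattice" "size y \<le> r"
  show "algebraic_int y" "card (cj y) \<le> 3"
    by (rule lattice_int[OF y(1)], rule cj_K_card[OF lattice_K[OF y(1)]])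
  assume "z \<in> cj y"
  hence "(cmod z)\<^sup>2 \<le> size y" by (rule cj_K_size[OF lattice_K[OF y(1)]])
  also have "\<dots> \<le> max 0 r" using y(2) by simp
  finally have "(cmod z)\<^sup>2 \<le> max 0 r" .
  thus "cmod z \<le> sqrt (max 0 r)" by (rule real_le_rsqrt)
qed

text \<open>The values of the form need not be integers, so minima come from the finiteness of balls.\<close>

lemma lattice_minimum:
  assumes "S \<subseteq> lattice" "S \<noteq> {}"
  obtains y where "y \<in> S" "\<And>z. z \<in> S \<Longrightarrow> size y \<le> size z"
proof -
  obtain x where x: "x \<in> S" using assms(2) by blast
  let ?T = "{y \<in> S. size y \<le> size x}"
  have fin: "finite (size ` ?T)"
    by (rule finite_imageI, rule finite_subset[OF _ finite_lattice_ball[of "size x"]]) (use assms(1) in blast)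
  have "Min (size ` ?T) \<in> size ` ?T" using fin x by (intro Min_in) auto
  then obtain y where y: "y \<in> ?T" "Min (size ` ?T) = size y" by (rule imageE)
  have "size y \<le> size z" if z: "z \<in> S" for z
  proof (cases "size z \<le> size x")
    case True
    hence "size z \<in> size ` ?T" using z by simp
    thus ?thesis using Min_le[OF fin] y(2) by simp
  qed (use y(1) in simp)
  moreover have "y \<in> S" using y(1) by simp
  ultimately show ?thesis using that by metis
qed

lemma K_coordinates:
  assumes "x \<in> K"
  obtains a b c where "a \<in> \<rat>" "b \<in> \<rat>" "c \<in> \<rat>" "x = a + b * k + c * k ^ 2"
proof -
  define r where "r i = - Polynomial.coeff (cpoly k) i" for i
  have r: "r i \<in> \<rat>" for i using cpoly_Rats[OF kQ] by (simp add: r_def polys_def)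
  have "0 = poly (cpoly k) k" using poly_cpoly[OF kQ] cj_self by simp
  also have "\<dots> = (\<Sum>i\<le>3. Polynomial.coeff (cpoly k) i * k ^ i)"
    unfolding poly_altdef degree_cpoly[OF kQ] deg by simp
  also have "\<dots> = k ^ 3 - (r 0 + r 1 * k + r 2 * k ^ 2)"
    using cpoly_lead[of k] unfolding degree_cpoly[OF kQ] deg
    by (simp add: r_def eval_nat_numeral)
  finally have k3: "k ^ 3 = r 0 + r 1 * k + r 2 * k ^ 2" by simp
  have "\<exists>a b c. a \<in> \<rat> \<and> b \<in> \<rat> \<and> c \<in> \<rat> \<and> poly q k = a + b * k + c * k ^ 2" if "q \<in> polys \<rat>" for q
    using that
  proof (induction q)
    case 0 thus ?case by (intro exI[of _ 0]) auto
  next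
    case (pCons d q)
    have d: "d \<in> \<rat>" "q \<in> polys \<rat>"
      using pCons.prems by (auto simp: polys_def coeff_pCons split: nat.splits)
    then obtain a b c where abc: "a \<in> \<rat>" "b \<in> \<rat>" "c \<in> \<rat>" "poly q k = a + b * k + c * k ^ 2"
      using pCons.IH by blast
    have "poly (pCons d q) k = d + a * k + b * k ^ 2 + c * k ^ 3"
      by (simp add: abc algebra_simps eval_nat_numeral)
    also have "\<dots> = (d + c * r 0) + (a + c * r 1) * k + (b + c * r 2) * k ^ 2"
      unfolding k3 by (simp add: algebra_simps)
    finally have "poly (pCons d q) k = (d + c * r 0) + (a + c * r 1) * k + (b + c * r 2) * k ^ 2" .
    moreover have "d + c * r 0 \<in> \<rat>" "a + c * r 1 \<in> \<rat>" "b + c * r 2 \<in> \<rat>" using abc d r by auto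
    ultimately show ?case by blast
  qed
  moreover obtain q where "q \<in> polys \<rat>" "x = poly q k" using assms unfolding K_def adjoin_def by (elim imageE)
  ultimately show ?thesis using that by metis
qed

text \<open>Three times the Vandermonde determinant of the conjugates of k. It spans the values of the
  alternating form on the lattice over the rationals, and its square is a rational number.\<close>

definition disc_root where "disc_root = wedge (traceless k) (traceless (k ^ 2))"

lemma disc_root: "disc_root \<noteq> 0" "disc_root ^ 2 \<in> \<rat>"
proof -
  define V where "V = (k - s k) * (s k - s (s k)) * (s (s k) - k)"
  have sets: "{k, s k, s (s k)} - {k} = {s k, s (s k)}" "{k, s k, s (s k)} - {s k} = {k, s (s k)}"
    "{k, s k, s (s k)} - {s (s k)} = {k, s k}"
    using conjugates(2,3) moves by auto
  have d: "discr k = - (V ^ 2)"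
    unfolding discr_def conjugates(1) V_def using conjugates(2,3) moves sets
    by (simp add: power2_eq_square algebra_simps)
  have st: "s (traceless (k ^ i)) = 3 * s k ^ i - tr (k ^ i)" for i
    unfolding traceless_def using tr_Rats[of "k ^ i"] K_ring K_field(3) Rats_Qbar kQ
    by (simp add: s_simps s_Rats ring_power subset_iff)
  have trk: "tr (k ^ i) = k ^ i + s k ^ i + s (s k) ^ i" for i
    by (simp add: tr_def s_simps kQ)
  have "disc_root = 3 * V"
    unfolding disc_root_def wedge_def st st[of 1, simplified] unfolding traceless_def trk trk[of 1, simplified] V_def
    by (simp add: power2_eq_square algebra_simps)
  moreover obtain D where "D \<noteq> 0" "discr k = of_int D" using discr_int[OF k] .
  ultimately have "disc_root ^ 2 = of_int (- 9 * D)" "D \<noteq> 0"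
    using d by (auto simp: power_mult_distrib minus_equation_iff)
  thus "disc_root \<noteq> 0" "disc_root ^ 2 \<in> \<rat>" by auto
qed

lemma lattice_coordinates:
  assumes "y \<in> lattice"
  obtains b c where "b \<in> \<rat>" "c \<in> \<rat>" "y = b * traceless k + c * traceless (k ^ 2)"
proof -
  obtain x where x: "x \<in> OK" "y = traceless x" using assms unfolding lattice_def by (elim imageE)
  obtain a b c where abc: "a \<in> \<rat>" "b \<in> \<rat>" "c \<in> \<rat>" "x = a + b * k + c * k ^ 2"
    using K_coordinates[OF OK_K[OF x(1)]] .
  have in_K: "a \<in> K" "b * k \<in> K" "c * k ^ 2 \<in> K" "k ^ 2 \<in> K"
    using abc K_field(3,4) K_ring by (auto intro!: ring_mult ring_power)
  have "tr x = 3 * a + b * tr k + c * tr (k ^ 2)"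
    unfolding abc(4) using in_K K_ring abc K_field(3)
    by (simp add: tr_add ring_add tr_scale tr_of_Rat)
  hence "y = b * traceless k + c * traceless (k ^ 2)"
    by (simp add: x(2) traceless_def abc(4) algebra_simps)
  thus ?thesis using that abc by blast
qed

lemma basis_K: "traceless k \<in> K" "traceless (k ^ 2) \<in> K"
  using K_field(3) K_ring by (auto intro!: traceless_K ring_power)

lemma lattice_wedge:
  assumes "y \<in> lattice" "z \<in> lattice"
  obtains r where "r \<in> \<rat>" "wedge y z = r * disc_root"
proof -
  obtain b c where y: "b \<in> \<rat>" "c \<in> \<rat>" "y = b * traceless k + c * traceless (k ^ 2)"
    using lattice_coordinates[OF assms(1)] .
  obtain b' c' where z: "b' \<in> \<rat>" "c' \<in> \<rat>" "z = b' * traceless k + c' * traceless (k ^ 2)"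
    using lattice_coordinates[OF assms(2)] .
  have anti: "wedge (traceless (k ^ 2)) (traceless k) = - disc_root" by (simp add: disc_root_def wedge_def)
  have "wedge y z = b * wedge (traceless k) z + c * wedge (traceless (k ^ 2)) z"
    unfolding y(3) by (rule wedge_linear(1)[OF basis_K lattice_K[OF assms(2)] y(1,2)])
  also have "wedge (traceless k) z = c' * disc_root"
    unfolding z(3) using wedge_linear(2)[OF basis_K basis_K(1) z(1,2)] by (simp add: wedge_self disc_root_def)
  also have "wedge (traceless (k ^ 2)) z = - b' * disc_root"
    unfolding z(3) using wedge_linear(2)[OF basis_K basis_K(2) z(1,2)] anti by (simp add: wedge_self)
  finally have "wedge y z = (b * c' - c * b') * disc_root" by (simp add: algebra_simps)
  moreover have "b * c' - c * b' \<in> \<rat>" using y z by auto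
  ultimately show ?thesis using that by blast
qed

lemma cramer: "wedge x y * z = wedge z y * x + wedge x z * y"
  by (simp add: wedge_def algebra_simps)

text \<open>Reduction of a positive definite binary quadratic form: a shortest vector and a shortest
  vector independent of it form a basis, and are nearly orthogonal.\<close>

lemma reduced_basis:
  obtains y1 y2 where "y1 \<in> lattice" "y2 \<in> lattice" "y1 \<noteq> 0" "wedge y1 y2 \<noteq> 0"
    "(size y1)\<^sup>2 \<le> 4 * (cmod (wedge y1 y2))\<^sup>2"
    "\<And>y. y \<in> lattice \<Longrightarrow> \<exists>m n :: int. y = of_int m * y1 + of_int n * y2"
proof -
  have L: "traceless k \<in> lattice" "traceless (k ^ 2) \<in> lattice"
    unfolding lattice_def using k_OK ring_power[OF OK_ring k_OK] by auto
  have "wedge 0 y = 0" for y by (simp add: wedge_def gal_0[OF s])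
  hence ne1: "traceless k \<noteq> 0" using disc_root(1) unfolding disc_root_def by auto
  have sub1: "lattice - {0} \<subseteq> lattice" and ne_1: "lattice - {0} \<noteq> {}" using L(1) ne1 by auto
  obtain y1 where y1: "y1 \<in> lattice - {0}" and min1: "\<And>z. z \<in> lattice - {0} \<Longrightarrow> size y1 \<le> size z"
    by (rule lattice_minimum[OF sub1 ne_1]) (rule that)
  let ?S = "{y \<in> lattice. wedge y1 y \<noteq> 0}"
  have ne_2: "?S \<noteq> {}"
  proof
    assume "?S = {}"
    hence "wedge y1 (traceless k) = 0" "wedge y1 (traceless (k ^ 2)) = 0" using L by auto
    hence "wedge (traceless k) (traceless (k^2)) * y1 = 0"
      using cramer[of "traceless k" "traceless (k^2)" y1] by (simp add: wedge_def)
    thus False using y1 disc_root(1) by (simp add: disc_root_def)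
  qed
  have sub2: "?S \<subseteq> lattice" by auto
  obtain y2 where y2: "y2 \<in> ?S" and min2: "\<And>z. z \<in> ?S \<Longrightarrow> size y2 \<le> size z"
    by (rule lattice_minimum[OF sub2 ne_2]) (rule that)
  have y1L: "y1 \<in> lattice" "y1 \<noteq> 0" and y2L: "y2 \<in> lattice" "wedge y1 y2 \<noteq> 0" using y1 y2 by auto
  have K12: "y1 \<in> K" "y2 \<in> K" using y1L y2L lattice_K by auto
  have "wedge y1 0 = 0" by (simp add: wedge_def gal_0[OF s])
  hence y20: "y2 \<noteq> 0" using y2L by auto
  have le: "size y1 \<le> size y2" using min1 y2L y20 by auto
  define B where "B = Re (herm y1 y2)"
  \<comment> \<open>Replacing y2 by its sum or difference with y1 does not shorten it.\<close>
  have B: "2 * \<bar>B\<bar> \<le> size y1"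
  proof -
    have le_n: "size y2 \<le> size (y2 - of_int n * y1)" for n
    proof (rule min2)
      have "wedge y1 (of_int (-n) * y1 + 1 * y2) = of_int (-n) * wedge y1 y1 + 1 * wedge y1 y2"
        using K12 by (intro wedge_linear) auto
      hence "wedge y1 (y2 - of_int n * y1) = wedge y1 y2" by (simp add: wedge_self)
      thus "y2 - of_int n * y1 \<in> ?S" using lattice_combination[OF y2L(1) y1L(1)] y2L by simp
    qed
    have eq_n: "size (y2 - of_int n * y1) = (real_of_int n)\<^sup>2 * size y1 - 2 * real_of_int n * B + size y2" for n
      using size_combination[OF K12, of "of_int (-n)" 1] by (simp add: B_def)
    show ?thesis using le_n[of 1] le_n[of "-1"] unfolding eq_n by simp
  qed
  have pos: "size y1 > 0" using size_pos y1L by simp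
  have gram: "3 * (cmod (wedge y1 y2))\<^sup>2 = size y1 * size y2 - B\<^sup>2"
    unfolding B_def using K12 lattice_tr y1L y2L by (intro gram_wedge) auto
  have "B\<^sup>2 \<le> (size y1 / 2)\<^sup>2" using B pos by (intro abs_le_square_iff[THEN iffD1]) simp
  moreover have "size y1 * size y1 \<le> size y1 * size y2" using le pos by (intro mult_left_mono) auto
  ultimately have bound: "(size y1)\<^sup>2 \<le> 4 * (cmod (wedge y1 y2))\<^sup>2"
    using gram by (simp add: power2_eq_square field_simps)
  have span: "\<exists>m n :: int. y = of_int m * y1 + of_int n * y2" if y: "y \<in> lattice" for y
  proof -
    obtain r where r: "r \<in> \<rat>" "wedge y y2 = r * disc_root" using lattice_wedge[OF y y2L(1)] .
    obtain r' where r': "r' \<in> \<rat>" "wedge y1 y = r' * disc_root" using lattice_wedge[OF y1L(1) y] .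
    obtain w where w: "w \<in> \<rat>" "wedge y1 y2 = w * disc_root" using lattice_wedge[OF y1L(1) y2L(1)] .
    have w0: "w \<noteq> 0" using w y2L by auto
    have "disc_root * (w * y) = disc_root * (r * y1 + r' * y2)"
      using cramer[of y1 y2 y] unfolding r(2) r'(2) w(2) by (simp add: algebra_simps)
    hence "w * y = r * y1 + r' * y2" using disc_root(1) by simp
    hence yab: "y = (r / w) * y1 + (r' / w) * y2" using w0 by (simp add: field_simps)
    have rat: "r / w \<in> \<rat>" "r' / w \<in> \<rat>" using r r' w by auto
    obtain a where a: "r / w = of_rat a" using rat(1) by (rule Rats_cases)
    obtain b where b: "r' / w = of_rat b" using rat(2) by (rule Rats_cases)
    note ab = a b
    define m n where "m = round a" and "n = round b"
    define a' b' where "a' = a - of_int m" and "b' = b - of_int n"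
    have abs: "\<bar>a'\<bar> \<le> 1/2" "\<bar>b'\<bar> \<le> 1/2"
      using of_int_round_abs_le[of a] of_int_round_abs_le[of b]
      by (auto simp: a'_def b'_def m_def n_def abs_minus_commute)
    define y' where "y' = y - of_int m * y1 - of_int n * y2"
    have y': "y' \<in> lattice" unfolding y'_def using y y1L y2L by (intro lattice_combination)
    have y'ab: "y' = of_rat a' * y1 + of_rat b' * y2"
      unfolding y'_def yab ab a'_def b'_def by (simp add: of_rat_diff algebra_simps)
    define u v where "u = real_of_rat a'" and "v = real_of_rat b'"
    have Re: "Re (of_rat q) = real_of_rat q" for q
      by (cases q) (simp add: of_rat_rat)
    have uv: "\<bar>u\<bar> \<le> 1/2" "\<bar>v\<bar> \<le> 1/2"
    proof -
      have h: "\<bar>real_of_rat q\<bar> \<le> 1/2" if "\<bar>q\<bar> \<le> 1/2" for q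
      proof -
        have "real_of_rat \<bar>q\<bar> \<le> real_of_rat (1/2)" using that by (simp only: of_rat_less_eq)
        thus ?thesis by (simp add: of_rat_divide)
      qed
      show "\<bar>u\<bar> \<le> 1/2" "\<bar>v\<bar> \<le> 1/2" unfolding u_def v_def using h abs by auto
    qed
    have sz: "size y' = u\<^sup>2 * size y1 + 2 * u * v * B + v\<^sup>2 * size y2"
      unfolding y'ab u_def v_def B_def Re[symmetric] using K12 by (intro size_combination) auto
    have sq: "u\<^sup>2 \<le> 1/4" "v\<^sup>2 \<le> 1/4"
      using abs_le_square_iff[of u "1/2"] abs_le_square_iff[of v "1/2"] uv by (simp_all add: power_divide)
    have v0: "v = 0"
    proof (rule ccontr)
      assume "v \<noteq> 0"
      hence b0: "b' \<noteq> 0" by (auto simp: v_def)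
      have "wedge y1 y' = of_rat a' * wedge y1 y1 + of_rat b' * wedge y1 y2"
        unfolding y'ab using K12 by (intro wedge_linear) auto
      hence "wedge y1 y' \<noteq> 0" using b0 y2L by (simp add: wedge_self)
      hence "size y2 \<le> size y'" using y' by (intro min2) simp
      also have "size y' \<le> 1/4 * size y1 + 1/4 * size y1 + 1/4 * size y2"
      proof -
        have "\<bar>u\<bar> * \<bar>v\<bar> \<le> 1/2 * (1/2)" using uv by (intro mult_mono) auto
        hence "(2 * \<bar>B\<bar>) * (\<bar>u\<bar> * \<bar>v\<bar>) \<le> size y1 * (1/4)" using B by (intro mult_mono) auto
        hence "2 * u * v * B \<le> 1/4 * size y1"
          using abs_ge_self[of "2 * u * v * B"] by (simp add: abs_mult mult_ac)
        moreover have "u\<^sup>2 * size y1 \<le> 1/4 * size y1" "v\<^sup>2 * size y2 \<le> 1/4 * size y2"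
          using sq pos le by (intro mult_right_mono; simp)+
        ultimately show ?thesis unfolding sz by linarith
      qed
      finally show False using le pos by linarith
    qed
    have "u = 0"
    proof (rule ccontr)
      assume "u \<noteq> 0"
      have b0: "b' = 0" "a' \<noteq> 0" using v0 \<open>u \<noteq> 0\<close> by (auto simp: v_def u_def)
      hence "y' \<noteq> 0" using y1L y'ab by auto
      hence "size y1 \<le> size y'" using y' min1 by simp
      also have "\<dots> = u\<^sup>2 * size y1" by (simp add: sz v0)
      also have "\<dots> \<le> 1/4 * size y1" using sq pos by (intro mult_right_mono) auto
      finally show False using pos by simp
    qed
    hence "y' = 0" using v0 y'ab by (simp add: u_def v_def)
    thus ?thesis unfolding y'_def by (intro exI[of _ m] exI[of _ n]) (simp add: algebra_simps)
  qed
  show ?thesis by (rule that[OF y1L(1) y2L(1) y1L(2) y2L(2) bound span])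
qed

text \<open>This is where composite rings differ from full rings of integers. An element a of the ring
  generated by A and OK has coordinates in A with respect to an integral basis of K, and so has its
  square. Hence the Vandermonde determinant of the three conjugates of a over F is an element of A
  times the determinant of the integral basis. A small height of a therefore bounds the
  discriminant of K, and a bounded discriminant forces a short vector in the lattice.\<close>

theorem small_element:
  assumes A: "is_ring A" "A \<subseteq> F" "\<And>x. x \<in> A \<Longrightarrow> algebraic_int x"
    and a: "a \<in> is_ring hull (A \<union> OK)" "a \<notin> A"
  obtains y where "y \<in> K" "y \<notin> F" "algebraic_int y" "card (cj y) \<le> 3"
    "\<And>u. u \<in> cj y \<Longrightarrow> cmod u ^ 4 \<le> 2304 * exp (12 * hm a)"
proof -
  obtain y1 y2 where y1: "y1 \<in> lattice" "y1 \<noteq> 0" and y2: "y2 \<in> lattice" and w0: "wedge y1 y2 \<noteq> 0"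
    and bound: "(size y1)\<^sup>2 \<le> 4 * (cmod (wedge y1 y2))\<^sup>2"
    and span: "\<And>y. y \<in> lattice \<Longrightarrow> \<exists>m n :: int. y = of_int m * y1 + of_int n * y2"
    by (rule reduced_basis) (rule that)
  define w where "w = wedge y1 y2"
  obtain g1 where g1: "g1 \<in> OK" "y1 = traceless g1" using y1(1) unfolding lattice_def by (elim imageE)
  obtain g2 where g2: "g2 \<in> OK" "y2 = traceless g2" using y2(1) unfolding lattice_def by (elim imageE)
  have basis: "\<exists>l m n :: int. x = of_int l + of_int m * g1 + of_int n * g2" if x: "x \<in> OK" for x
  proof -
    have "traceless x \<in> lattice" using x by (simp add: lattice_def)
    then obtain m n :: int where mn: "traceless x = of_int m * y1 + of_int n * y2" using span by blast
    define x' where "x' = x - of_int m * g1 - of_int n * g2"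
    have x': "x' \<in> OK" unfolding x'_def using x g1 g2 OK_ring by (intro ring_diff ring_mult ring_of_int)
    have "x' = (tr x - of_int m * tr g1 - of_int n * tr g2) / 3"
      using mn unfolding g1(2) g2(2) traceless_def x'_def by (simp add: field_simps)
    moreover have "\<dots> \<in> \<rat>" using tr_Rats x g1 g2 OK_K by auto
    ultimately have "x' \<in> \<int>" using OK_int[OF x'] by (metis rational_algebraic_int_is_int)
    then obtain l where "x' = of_int l" by (elim Ints_cases)
    hence "x = of_int l + of_int m * g1 + of_int n * g2" by (simp add: x'_def algebra_simps)
    thus ?thesis by blast
  qed
  define S where "S = {l + m * g1 + n * g2 | l m n. l \<in> A \<and> m \<in> A \<and> n \<in> A}"
  have SI: "l + m * g1 + n * g2 \<in> S" if "l \<in> A" "m \<in> A" "n \<in> A" for l m n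
    using that unfolding S_def by blast
  have S_OK: "x \<in> S" if x: "x \<in> OK" for x
  proof -
    obtain l m n :: int where "x = of_int l + of_int m * g1 + of_int n * g2" using basis[OF x] by blast
    thus ?thesis using SI[OF ring_of_int[OF A(1)] ring_of_int[OF A(1)] ring_of_int[OF A(1)]] by simp
  qed
  have S_diff: "x - y \<in> S" if xS: "x \<in> S" and yS: "y \<in> S" for x y
  proof -
    obtain l m n where x: "x = l + m * g1 + n * g2" "l \<in> A" "m \<in> A" "n \<in> A" using xS unfolding S_def by blast
    obtain l' m' n' where y: "y = l' + m' * g1 + n' * g2" "l' \<in> A" "m' \<in> A" "n' \<in> A" using yS unfolding S_def by blast
    have eq: "x - y = (l - l') + (m - m') * g1 + (n - n') * g2" by (simp add: x y algebra_simps)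
    show ?thesis unfolding eq using x y by (intro SI ring_diff[OF A(1)])
  qed
  have S_0: "0 \<in> S" using SI[of 0 0 0] ring_0[OF A(1)] by simp
  have S_add: "x + y \<in> S" if "x \<in> S" "y \<in> S" for x y
    using S_diff[OF that(1) S_diff[OF S_0 that(2)]] by simp
  have S_scale: "c * x \<in> S" if cA: "c \<in> A" and xS: "x \<in> S" for c x
  proof -
    obtain l m n where x: "x = l + m * g1 + n * g2" "l \<in> A" "m \<in> A" "n \<in> A" using xS unfolding S_def by blast
    have "c * x = c * l + (c * m) * g1 + (c * n) * g2" by (simp add: x algebra_simps)
    thus ?thesis using SI[of "c * l" "c * m" "c * n"] x cA ring_mult[OF A(1)] by simp
  qed
  have S_ring: "is_ring S"
    unfolding is_ring_def
  proof (intro conjI ballI)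
    show "1 \<in> S" using SI[of 1 0 0] ring_0[OF A(1)] ring_1[OF A(1)] by simp
    fix x y assume x: "x \<in> S" and y: "y \<in> S"
    show "x - y \<in> S" using S_diff x y .
    have gm: "g * y \<in> S" if g: "g \<in> OK" for g
    proof -
      obtain l m n where y': "y = l + m * g1 + n * g2" "l \<in> A" "m \<in> A" "n \<in> A" using y unfolding S_def by blast
      have "g * y = l * g + m * (g * g1) + n * (g * g2)" by (simp add: y' algebra_simps)
      thus ?thesis using y' g g1 g2 S_OK S_scale S_add ring_mult[OF OK_ring] by simp
    qed
    obtain l m n where x': "x = l + m * g1 + n * g2" "l \<in> A" "m \<in> A" "n \<in> A" using x unfolding S_def by blast
    have "x * y = l * y + m * (g1 * y) + n * (g2 * y)" by (simp add: x' algebra_simps)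
    thus "x * y \<in> S" using x' y gm[OF g1(1)] gm[OF g2(1)] S_scale S_add by simp
  qed
  have "A \<union> OK \<subseteq> S" using SI[OF _ ring_0[OF A(1)] ring_0[OF A(1)]] S_OK by auto
  hence "is_ring hull (A \<union> OK) \<subseteq> S" using S_ring by (rule hull_minimal)
  hence aS: "a \<in> S" using a(1) by auto
  hence a2S: "a ^ 2 \<in> S" by (rule ring_power[OF S_ring])
  obtain l m n where l: "a = l + m * g1 + n * g2" "l \<in> A" "m \<in> A" "n \<in> A" using aS unfolding S_def by blast
  obtain l' m' n' where l': "a ^ 2 = l' + m' * g1 + n' * g2" "l' \<in> A" "m' \<in> A" "n' \<in> A"
    using a2S unfolding S_def by blast
  obtain t1 where t1: "tr g1 = of_int t1" using tr_int[OF g1(1)] .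
  obtain t2 where t2: "tr g2 = of_int t2" using tr_int[OF g2(1)] .
  define e where "e = 3 * l + m * of_int t1 + n * of_int t2"
  define e' where "e' = 3 * l' + m' * of_int t1 + n' * of_int t2"
  have eA: "e \<in> A" "e' \<in> A" unfolding e_def e'_def using l l' A(1) by (auto intro!: ring_add ring_mult ring_numeral ring_of_int)
  have a3: "3 * a = e + m * y1 + n * y2" "3 * a ^ 2 = e' + m' * y1 + n' * y2"
    unfolding l'(1) unfolding l(1) g1(2) g2(2) traceless_def t1 t2 e_def e'_def by (simp_all add: algebra_simps)
  have fix_A: "s x = x" if "x \<in> A" for x using that A(2) fixF by blast
  have AQ: "x \<in> Qbar" if "x \<in> A" for x using algebraic_int_Qbar[OF A(3)[OF that]] .
  have aint: "algebraic_int a"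
    unfolding l(1) using A(3) l OK_int g1 g2 by (intro algebraic_int_add algebraic_int_mult) auto
  have aQ: "a \<in> Qbar" using algebraic_int_Qbar[OF aint] .
  have yQ: "y1 \<in> Qbar" "y2 \<in> Qbar" using y1 y2 lattice_K K_Qbar by auto
  have conj_a: "3 * s a = e + m * s y1 + n * s y2" "3 * s (s a) = e + m * s (s y1) + n * s (s y2)"
    "3 * s a ^ 2 = e' + m' * s y1 + n' * s y2" "3 * s (s a) ^ 2 = e' + m' * s (s y1) + n' * s (s y2)"
  proof -
    have 1: "3 * s a = e + m * s y1 + n * s y2" "3 * s a ^ 2 = e' + m' * s y1 + n' * s y2"
      using arg_cong[OF a3(1), of s] arg_cong[OF a3(2), of s] aQ yQ eA l(2-4) l'(2-4) AQ
      by (simp_all add: s_simps fix_A)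
    have 2: "3 * s (s a) = e + m * s (s y1) + n * s (s y2)" "3 * s (s a) ^ 2 = e' + m' * s (s y1) + n' * s (s y2)"
      using arg_cong[OF 1(1), of s] arg_cong[OF 1(2), of s] aQ yQ eA l(2-4) l'(2-4) AQ
      by (simp_all add: s_simps fix_A)
    show "3 * s a = e + m * s y1 + n * s y2" "3 * s (s a) = e + m * s (s y1) + n * s (s y2)"
      "3 * s a ^ 2 = e' + m' * s y1 + n' * s y2" "3 * s (s a) ^ 2 = e' + m' * s (s y1) + n' * s (s y2)"
      by (fact 1 2)+
  qed
  have ss: "s (s y1) = - y1 - s y1" "s (s y2) = - y2 - s y2"
    using y1 y2 lattice_tr by (auto intro: tr_zero)
  define d where "d = (s a - a) * (s (s a) - a) * (s (s a) - s a)"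
  define c where "c = m * n' - m' * n"
  have vandermonde: "3 * d = c * w"
  proof -
    have "9 * d = (3 * s a - 3 * a) * (3 * s (s a) ^ 2 - 3 * a ^ 2) - (3 * s (s a) - 3 * a) * (3 * s a ^ 2 - 3 * a ^ 2)"
      unfolding d_def by (simp add: power2_eq_square algebra_simps)
    also have "\<dots> = 3 * (c * w)"
      unfolding conj_a a3 ss c_def w_def wedge_def by (simp add: algebra_simps)
    finally show ?thesis by simp
  qed
  \<comment> \<open>Otherwise a is fixed by s, so its coordinates m and n vanish and a lies in A.\<close>
  have c0: "c \<noteq> 0"
  proof
    assume "c = 0"
    hence "d = 0" using vandermonde by simp
    hence eqs: "s a = a \<or> s (s a) = a \<or> s (s a) = s a" by (auto simp: d_def)
    have sss: "s (s (s a)) = a"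
    proof -
      have "3 * s (s (s a)) = e + m * s (s (s y1)) + n * s (s (s y2))"
        using arg_cong[OF conj_a(2), of s] aQ yQ eA l(2-4) AQ by (simp add: s_simps fix_A)
      also have "\<dots> = 3 * a" using a3(1) s3 lattice_K y1 y2 by simp
      finally show ?thesis by simp
    qed
    have sa: "s a = a" using eqs sss gal_inj[OF s] aQ sQ by (metis inj_onD)
    have 1: "m * (y1 - s y1) + n * (y2 - s y2) = 0"
      using a3(1) conj_a(1) sa by (simp add: algebra_simps)
    have 2: "m * (2 * y1 + s y1) + n * (2 * y2 + s y2) = 0"
      using a3(1) conj_a(2) sa unfolding ss by (simp add: algebra_simps)
    have 3: "m * y1 + n * y2 = 0"
    proof -
      have "3 * (m * y1 + n * y2) = (m * (y1 - s y1) + n * (y2 - s y2)) + (m * (2 * y1 + s y1) + n * (2 * y2 + s y2))"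
        by (simp add: algebra_simps)
      hence "3 * (m * y1 + n * y2) = 0" unfolding 1 2 by (simp only: add_0_left)
      thus ?thesis by (simp only: mult_eq_0_iff zero_neq_numeral[symmetric] simp_thms)
    qed
    have 4: "m * s y1 + n * s y2 = 0"
    proof -
      have "m * s y1 + n * s y2 = (m * y1 + n * y2) - (m * (y1 - s y1) + n * (y2 - s y2))"
        by (simp add: algebra_simps)
      thus ?thesis unfolding 1 3 by simp
    qed
    have "m * w = s y2 * (m * y1 + n * y2) - y2 * (m * s y1 + n * s y2)"
      "n * w = y1 * (m * s y1 + n * s y2) - s y1 * (m * y1 + n * y2)"
      unfolding w_def wedge_def by (simp_all add: algebra_simps)
    hence "m * w = 0" "n * w = 0" unfolding 3 4 by simp_all
    hence "m = 0" "n = 0" using w0 by (auto simp: w_def)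
    thus False using l a(2) by simp
  qed
  have cA: "c \<in> A" unfolding c_def using l l' A(1) by (intro ring_diff ring_mult)
  have cint: "algebraic_int c" using A(3)[OF cA] .
  have cQ: "c \<in> Qbar" using algebraic_int_Qbar[OF cint] .
  obtain r where r: "r \<in> \<rat>" "w = r * disc_root" using lattice_wedge[OF y1(1) y2] unfolding w_def by metis
  have w2: "w ^ 2 \<in> \<rat>" using r disc_root(2) by (simp add: power_mult_distrib)
  have wQ: "w \<in> Qbar" unfolding w_def wedge_def using yQ sQ by (intro Qbar_closed)
  have wpos: "cmod w > 0" using w0 by (simp add: w_def)
  \<comment> \<open>The square of w is rational, so w has the same absolute value in every embedding.\<close>
  have "0 \<le> (3 * ln 2 + ln 3 - ln (cmod w)) + 2 * (\<Sum>i<length [a, s a, s (s a)]. hm ([a, s a, s (s a)] ! i))"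
  proof (rule height_bound_by_averaging[OF cint c0])
    show "set [a, s a, s (s a)] \<subseteq> Qbar" using aQ sQ by simp
    fix t assume t: "t \<in> gal"
    have "(t w) ^ 2 = w ^ 2" using gal_power[OF t wQ, of 2] gal_Rats[OF t w2] by simp
    hence tw: "cmod (t w) = cmod w" by (metis norm_power power2_eq_iff_nonneg norm_ge_zero)
    have tc0: "t c \<noteq> 0" using gal_eq_0[OF t cQ] c0 by simp
    define x0 x1 x2 where "x0 = t a" and "x1 = t (s a)" and "x2 = t (s (s a))"
    have "t (3 * d) = 3 * ((x1 - x0) * (x2 - x0) * (x2 - x1))"
      unfolding d_def x0_def x1_def x2_def using aQ sQ t
      by (simp add: gal_mult gal_diff gal_numeral Qbar_closed)
    moreover have "t (3 * d) = t c * t w" unfolding vandermonde by (rule gal_mult[OF t cQ wQ])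
    ultimately have eq: "t c * t w = 3 * ((x1 - x0) * (x2 - x0) * (x2 - x1))" by simp
    have tw0: "t w \<noteq> 0" using tw wpos by auto
    hence ne: "x1 \<noteq> x0" "x2 \<noteq> x0" "x2 \<noteq> x1" using eq tc0 by auto
    have "cmod (t c) * cmod w = 3 * (cmod (x1 - x0) * cmod (x2 - x0) * cmod (x2 - x1))"
      using arg_cong[OF eq, of cmod] by (simp add: norm_mult tw)
    hence "ln (cmod (t c) * cmod w) = ln (3 * (cmod (x1 - x0) * cmod (x2 - x0) * cmod (x2 - x1)))" by simp
    hence "ln (cmod (t c)) + ln (cmod w) = ln 3 + ln (cmod (x1 - x0)) + ln (cmod (x2 - x0)) + ln (cmod (x2 - x1))"
      using tc0 wpos ne w0 by (simp add: ln_mult w_def)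
    also have "\<dots> \<le> ln 3 + 3 * ln 2 + 2 * (ln (max 1 (cmod x0)) + ln (max 1 (cmod x1)) + ln (max 1 (cmod x2)))"
    proof -
      define h where "h x = ln (max 1 (cmod x))" for x
      have "ln (cmod (x - y)) \<le> ln 2 + h x + h y" if "x \<noteq> y" for x y
        using ln_norm_diff_le[OF that] by (simp add: h_def)
      hence "ln (cmod (x1 - x0)) + ln (cmod (x2 - x0)) + ln (cmod (x2 - x1))
          \<le> (ln 2 + h x1 + h x0) + (ln 2 + h x2 + h x0) + (ln 2 + h x2 + h x1)"
        using ne by (intro add_mono) auto
      also have "\<dots> = 3 * ln 2 + 2 * (h x0 + h x1 + h x2)" by (simp add: algebra_simps)
      finally show ?thesis unfolding h_def[symmetric] by (simp add: add.assoc)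
    qed
    finally show "ln (cmod (t c)) \<le> (3 * ln 2 + ln 3 - ln (cmod w))
        + 2 * (\<Sum>i<length [a, s a, s (s a)]. ln (max 1 (cmod (t ([a, s a, s (s a)] ! i)))))"
      by (simp add: x0_def x1_def x2_def eval_nat_numeral lessThan_Suc)
  qed
  moreover have "hm (s a) = hm a" "hm (s (s a)) = hm a" using hm_gal[OF s] aQ sQ by simp_all
  ultimately have "ln (cmod w) \<le> 3 * ln 2 + ln 3 + 6 * hm a"
    by (simp add: eval_nat_numeral lessThan_Suc)
  also have "3 * ln 2 + ln 3 = ln (24 :: real)"
  proof -
    have "ln (24 :: real) = ln (2 * (2 * (2 * 3)))" by simp
    also have "\<dots> = ln 2 + (ln 2 + (ln 2 + ln 3))" by (simp only: ln_mult) simp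
    finally show ?thesis by simp
  qed
  finally have "exp (ln (cmod w)) \<le> exp (ln 24 + 6 * hm a)" by (simp only: exp_le_cancel_iff)
  hence "cmod w \<le> 24 * exp (6 * hm a)" using wpos by (simp add: exp_add)
  hence "(cmod w)\<^sup>2 \<le> (24 * exp (6 * hm a))\<^sup>2" by (intro power_mono) auto
  also have "\<dots> = 576 * exp (12 * hm a)" by (simp add: power_mult_distrib exp_double[symmetric] power2_eq_square exp_add[symmetric])
  \<comment> \<open>The constant is 4 times the square of 24.\<close>
  finally have sz: "(size y1)\<^sup>2 \<le> 2304 * exp (12 * hm a)" using bound by (simp add: w_def)
  show ?thesis
  proof (rule that[of y1])
    show "y1 \<in> K" using lattice_K[OF y1(1)] .
    show "algebraic_int y1" using lattice_int[OF y1(1)] .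
    show "card (cj y1) \<le> 3" using cj_K_card[OF lattice_K[OF y1(1)]] .
    show "y1 \<notin> F"
    proof
      assume "y1 \<in> F"
      hence "s y1 = y1" by (rule fixF)
      hence "- y1 - y1 = y1" using ss(1) by simp
      hence "3 * y1 = 0" by (simp add: algebra_simps)
      thus False using y1(2) by simp
    qed
    fix u assume u: "u \<in> cj y1"
    have "cmod u ^ 4 = ((cmod u)\<^sup>2)\<^sup>2" by simp
    also have "\<dots> \<le> (size y1)\<^sup>2" using cj_K_size[OF lattice_K[OF y1(1)] u] by (intro power_mono) auto
    finally show "cmod u ^ 4 \<le> 2304 * exp (12 * hm a)" using sz by simp
  qed
qed

end

section \<open>Subrings, subfields and degrees\<close>

lemma complex_ring_simps [simp]:
  "carrier complex_ring = UNIV" "x \<otimes>\<^bsub>complex_ring\<^esub> y = x * y" "\<one>\<^bsub>complex_ring\<^esub> = 1"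
  "\<zero>\<^bsub>complex_ring\<^esub> = 0" "x \<oplus>\<^bsub>complex_ring\<^esub> y = x + y"
  by (simp_all add: ring_of_type_algebra_def)

lemma complex_ring_field: "field complex_ring" by (rule field_from_type_algebra)

lemma complex_ring_ring: "ring complex_ring" by (rule ring_from_type_algebra)

lemma complex_ring_minus [simp]: "\<ominus>\<^bsub>complex_ring\<^esub> x = - x"
proof -
  interpret ring complex_ring by (rule complex_ring_ring)
  show ?thesis using minus_equality[of "-x" x] by simp
qed

lemma complex_ring_inv [simp]: "x \<noteq> 0 \<Longrightarrow> inv\<^bsub>complex_ring\<^esub> x = inverse x"
proof -
  assume x: "x \<noteq> 0"
  interpret field complex_ring by (rule complex_ring_field)
  show ?thesis using comm_inv_char[of x "inverse x"] x by simp
qed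

lemma subring_iff_is_ring: "subring R complex_ring \<longleftrightarrow> is_ring R"
proof
  assume "subring R complex_ring"
  note R = subringE[OF this, simplified]
  have "x - y \<in> R" if "x \<in> R" "y \<in> R" for x y
    using R(7)[OF that(1) R(5)[OF that(2)]] by simp
  thus "is_ring R" using R by (simp add: is_ring_def)
next
  assume R: "is_ring R"
  interpret ring complex_ring by (rule complex_ring_ring)
  show "subring R complex_ring" by (rule subringI) (simp_all add: ring_closed[OF R])
qed

lemma subfield_iff_is_field: "subfield F complex_ring \<longleftrightarrow> is_field F"
proof
  assume F: "subfield F complex_ring"
  interpret ring complex_ring by (rule complex_ring_ring)
  have R: "is_ring F" using subfieldE(1)[OF F] by (simp add: subring_iff_is_ring)
  have "inverse x \<in> F" if "x \<in> F" for x
  proof (cases "x = 0")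
    case False thus ?thesis using subfield_m_inv(1)[OF F, of x] that by simp
  qed (use ring_0[OF R] in simp)
  thus "is_field F" using R by (simp add: is_field_def)
next
  assume F: "is_field F"
  interpret field complex_ring by (rule complex_ring_field)
  show "subfield F complex_ring"
    by (rule subfieldI') (use F in \<open>auto simp: subring_iff_is_ring field_inverse\<close>)
qed

lemma generate_field_hull: "generate_field complex_ring S = is_field hull S"
proof -
  interpret field complex_ring by (rule complex_ring_field)
  show ?thesis
  proof
    show "generate_field complex_ring S \<subseteq> is_field hull S"
      by (rule generate_field_min_subfield1)
        (auto simp: subfield_iff_is_field is_field_hull intro: field_hull_inc)
    have "S \<subseteq> generate_field complex_ring S" by (auto intro: generate_field.incl)
    moreover have "is_field (generate_field complex_ring S)"
      using generate_field_is_subfield[of S] by (simp add: subfield_iff_is_field)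
    ultimately show "is_field hull S \<subseteq> generate_field complex_ring S" by (rule field_hull_minimal)
  qed
qed

lemma generate_ring_hull: "generate_ring complex_ring S = is_ring hull S"
proof -
  interpret ring complex_ring by (rule complex_ring_ring)
  have sub: "S \<subseteq> generate_ring complex_ring S" by (auto intro: generate_ring.incl)
  have ring: "is_ring (generate_ring complex_ring S)"
    using generate_ring_is_subring[of S] by (simp add: subring_iff_is_ring)
  have "generate_ring complex_ring S \<subseteq> R" if "is_ring R" "S \<subseteq> R" for R
    by (rule generate_ring_min_subring1) (use that in \<open>auto simp: subring_iff_is_ring\<close>)
  thus ?thesis using sub ring by (intro hull_unique[symmetric])
qed

lemma subfield_Rats: "subfield \<rat> complex_ring"
  by (simp add: subfield_iff_is_field is_field_Rats)

text \<open>The powers of a below the number of its conjugates span, because cpoly is monic with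
  rational coefficients.\<close>

lemma field_degree_adjoin:
  assumes a: "a \<in> Qbar"
  shows "0 < field_degree (adjoin \<rat> a)" "field_degree (adjoin \<rat> a) \<le> card (cj a)"
    "ring.finite_dimension complex_ring \<rat> (adjoin \<rat> a)"
proof -
  interpret ring complex_ring by (rule complex_ring_ring)
  define m where "m = card (cj a)"
  define Us where "Us = map (\<lambda>i. a ^ i) [0..<m]"
  have U: "set Us \<subseteq> carrier complex_ring" by simp
  have sub: "Span \<rat> Us \<subseteq> UNIV" "0 \<in> Span \<rat> Us" "\<And>x y. x \<in> Span \<rat> Us \<Longrightarrow> y \<in> Span \<rat> Us \<Longrightarrow> x + y \<in> Span \<rat> Us"
    using Span_subgroup_props(2,3)[OF subfield_Rats U] by (simp_all del: Span.simps)
  have scale: "c * x \<in> Span \<rat> Us" if "c \<in> \<rat>" "x \<in> Span \<rat> Us" for c x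
    using Span_smult_closed[OF subfield_Rats U that] by (simp del: Span.simps)
  have sums: "(\<Sum>i\<in>I. f i) \<in> Span \<rat> Us" if "\<And>i. i \<in> I \<Longrightarrow> f i \<in> Span \<rat> Us" for f and I :: "nat set"
    using that by (induction I rule: infinite_finite_induct) (auto simp: sub simp del: Span.simps)
  have small: "a ^ i \<in> Span \<rat> Us" if "i < m" for i
    using Span_base_incl[OF subfield_Rats U] that by (auto simp: Us_def simp del: Span.simps)
  have top: "a ^ m \<in> Span \<rat> Us"
  proof -
    have "0 = poly (cpoly a) a" using poly_cpoly[OF a] cj_self by simp
    also have "\<dots> = (\<Sum>i\<le>m. Polynomial.coeff (cpoly a) i * a ^ i)"
      unfolding poly_altdef degree_cpoly[OF a] m_def by simp
    also have "\<dots> = a ^ m + (\<Sum>i<m. Polynomial.coeff (cpoly a) i * a ^ i)"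
      using cpoly_lead[of a] by (simp add: degree_cpoly[OF a] m_def lessThan_Suc_atMost[symmetric])
    finally have "a ^ m = (\<Sum>i<m. - Polynomial.coeff (cpoly a) i * a ^ i)"
      by (simp add: sum_negf eq_neg_iff_add_eq_0)
    also have "\<dots> \<in> Span \<rat> Us"
      using cpoly_Rats[OF a] by (intro sums scale small) (auto simp: polys_def)
    finally show ?thesis .
  qed
  have mult_a: "a * x \<in> Span \<rat> Us" if hx: "x \<in> Span \<rat> Us" for x
  proof -
    obtain Ks where Ks: "set Ks \<subseteq> \<rat>" "length Ks = length Us" "x = combine Ks Us"
      using hx Span_mem_iff_length_version[OF subfield_Rats U, of x] by blast
    have "a * combine Ks Vs \<in> Span \<rat> Us" if "set Ks \<subseteq> \<rat>" "set Vs \<subseteq> set Us" for Ks Vs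
      using that
    proof (induction Ks Vs rule: combine.induct)
      case (1 k Ks v Vs)
      obtain i where i: "i < m" "v = a ^ i" using 1(3) by (auto simp: Us_def)
      have "a * v \<in> Span \<rat> Us"
      proof (cases "Suc i < m")
        case True thus ?thesis using small[OF True] i by (simp del: Span.simps)
      next
        case False
        hence "Suc i = m" using i by simp
        thus ?thesis using top i by (metis power_Suc)
      qed
      moreover have "k \<in> \<rat>" "a * combine Ks Vs \<in> Span \<rat> Us" using 1 by (simp_all del: Span.simps)
      ultimately have "k * (a * v) + a * combine Ks Vs \<in> Span \<rat> Us"
        by (intro sub(3)[OF scale])
      thus ?case by (simp add: algebra_simps del: Span.simps)
    qed (simp_all add: sub del: Span.simps)
    from this[OF Ks(1), of Us] show ?thesis by (simp add: Ks(3) del: Span.simps)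
  qed
  have m0: "m > 0" unfolding m_def by (rule card_cj_pos[OF a])
  have "poly q a \<in> Span \<rat> Us" if "q \<in> polys \<rat>" for q
    using that
  proof (induction q)
    case 0 thus ?case using sub(2) by (simp del: Span.simps)
  next
    case (pCons c q)
    have c: "c \<in> \<rat>" "q \<in> polys \<rat>"
      using pCons.prems by (auto simp: polys_def coeff_pCons split: nat.splits)
    have "c * a ^ 0 + a * poly q a \<in> Span \<rat> Us"
      by (rule sub(3)[OF scale[OF c(1) small[OF m0]] mult_a[OF pCons.IH[OF c(2)]]])
    thus ?case by (simp del: Span.simps)
  qed
  hence le: "adjoin \<rat> a \<subseteq> Span \<rat> Us" unfolding adjoin_def by blast
  have "Span \<rat> Us \<subseteq> adjoin \<rat> a"
  proof
    fix x assume "x \<in> Span \<rat> Us"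
    then obtain Ks where Ks: "set Ks \<subseteq> \<rat>" "x = combine Ks Us"
      using Span_mem_iff_length_version[OF subfield_Rats U, of x] by blast
    note adj = adjoin_field[OF is_field_Rats Rats_Qbar a]
    have R: "is_ring (adjoin \<rat> a)" using adj(1) by auto
    have "combine Ks Vs \<in> adjoin \<rat> a" if "set Ks \<subseteq> \<rat>" "set Vs \<subseteq> set Us" for Ks Vs
      using that
    proof (induction Ks Vs rule: combine.induct)
      case (1 k Ks v Vs)
      obtain i where i: "i < m" "v = a ^ i" using 1(3) by (auto simp: Us_def)
      have "k * v + combine Ks Vs \<in> adjoin \<rat> a"
        using 1 i adj(2,3) by (intro ring_add[OF R] ring_mult[OF R]) (auto intro: ring_power[OF R])
      thus ?case by simp
    qed (simp_all add: ring_0[OF R])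
    thus "x \<in> adjoin \<rat> a" using Ks by auto
  qed
  hence eq: "Span \<rat> Us = adjoin \<rat> a" using le by (rule subset_antisym)
  have "\<exists>n\<le>length Vs. dimension n \<rat> (Span \<rat> Vs)" for Vs
  proof (induction Vs)
    case Nil
    have "Span \<rat> [] = {\<zero>\<^bsub>complex_ring\<^esub>}" by simp
    thus ?case using zero_dim by (metis le_zero_eq list.size(3))
  next
    case (Cons u Vs)
    then obtain n where n: "n \<le> length Vs" "dimension n \<rat> (Span \<rat> Vs)" by blast
    show ?case
    proof (cases "u \<in> Span \<rat> Vs")
      case True
      have V: "set Vs \<subseteq> carrier complex_ring" "set (u # Vs) \<subseteq> carrier complex_ring" by simp_all
      have "set (u # Vs) \<subseteq> Span \<rat> Vs" using True Span_base_incl[OF subfield_Rats V(1)] by simp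
      hence "Span \<rat> (u # Vs) \<subseteq> Span \<rat> Vs"
        by (intro subalgebra_Span_incl[OF subfield_Rats Span_is_subalgebra[OF subfield_Rats V(1)]])
      moreover have "Span \<rat> Vs \<subseteq> Span \<rat> (u # Vs)" by (rule mono_Span[OF subfield_Rats V(1)]) simp
      ultimately have "Span \<rat> (u # Vs) = Span \<rat> Vs" by (rule subset_antisym)
      thus ?thesis using n by (metis le_SucI length_Cons)
    next
      case False
      have "dimension (Suc n) \<rat> (line_extension \<rat> u (Span \<rat> Vs))"
        using False n(2) by (intro Suc_dim) simp_all
      moreover have "line_extension \<rat> u (Span \<rat> Vs) = Span \<rat> (u # Vs)" by simp
      ultimately show ?thesis using n(1) by (metis Suc_le_mono length_Cons)
    qed
  qed
  then obtain n where n: "n \<le> length Us" "dimension n \<rat> (adjoin \<rat> a)" using eq by metis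
  hence "field_degree (adjoin \<rat> a) = n"
    using dimI[OF subfield_Rats n(2)] by (simp add: field_degree_def over_def)
  hence dim: "dimension (field_degree (adjoin \<rat> a)) \<rat> (adjoin \<rat> a)"
    and "field_degree (adjoin \<rat> a) \<le> length Us" using n by auto
  moreover have "field_degree (adjoin \<rat> a) \<noteq> 0"
  proof
    assume "field_degree (adjoin \<rat> a) = 0"
    hence "adjoin \<rat> a = {0}" using dimension_zero[OF subfield_Rats] dim by simp
    moreover have "1 \<in> adjoin \<rat> a" using ring_1[OF is_field_imp_ring[OF adjoin_field(1)[OF is_field_Rats Rats_Qbar a]]] .
    ultimately show False by simp
  qed
  ultimately show "0 < field_degree (adjoin \<rat> a)" "field_degree (adjoin \<rat> a) \<le> card (cj a)"
    by (simp_all add: m_def Us_def)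
  show "finite_dimension \<rat> (adjoin \<rat> a)" by (rule finite_dimensionI[OF dim])
qed

lemma number_field_dependent:
  assumes K: "number_field K" and d: "field_degree K < length Us" and U: "set Us \<subseteq> K"
  obtains Ks where "length Ks = length Us" "set Ks \<subseteq> \<rat>" "set Ks \<noteq> {0}"
    "ring.combine complex_ring Ks Us = 0"
proof -
  interpret ring complex_ring by (rule complex_ring_ring)
  have dim: "dimension (field_degree K) \<rat> K"
    using K finite_dimensionE[OF subfield_Rats] by (simp add: number_field_def field_degree_def over_def)
  have "dependent \<rat> Us"
    using independent_length_le_dimension[OF subfield_Rats dim _ U] d by auto
  then obtain Ks where "length Ks = length Us" "combine Ks Us = 0" "set Ks \<subseteq> \<rat>" "set Ks \<noteq> {0}"
    using dependent_imp_non_trivial_combine[OF subfield_Rats, of Us] by auto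
  thus ?thesis using that by blast
qed

section \<open>Local degrees at archimedean places\<close>

lemma cauchy_seqs_embedding:
  assumes K: "is_field K" "K \<subseteq> Qbar" and s: "s \<in> gal" and v: "\<And>y. y \<in> K \<Longrightarrow> v y = cmod (s y)"
  shows "x \<in> cauchy_seqs K v \<longleftrightarrow> (\<forall>n. x n \<in> K) \<and> convergent (\<lambda>n. s (x n))"
proof -
  have "v (x m - x n) = dist (s (x m)) (s (x n))" if "\<forall>n. x n \<in> K" for m n
  proof -
    have "x m \<in> K" "x n \<in> K" using that by auto
    hence "x m - x n \<in> K" "x m \<in> Qbar" "x n \<in> Qbar" using K by (auto intro: ring_diff)
    thus ?thesis using v gal_diff[OF s] by (simp add: dist_norm)
  qed
  thus ?thesis unfolding cauchy_seqs_def Cauchy_convergent_iff[symmetric] Cauchy_def by auto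
qed

lemma ring_iso_restrict_dimension:
  fixes R :: "('a, 'b) ring_scheme" and S :: "('c, 'd) ring_scheme"
  assumes R: "ring R" and S: "ring S" and f: "f \<in> ring_iso R S" and E: "E \<subseteq> carrier R"
    and sub: "subfield (f ` E) S" and one: "\<one>\<^bsub>R\<^esub> \<noteq> \<zero>\<^bsub>R\<^esub>"
    and dim: "ring.dimension S n (f ` E) (carrier S)"
  shows "ring.dim R E (carrier R) = n"
proof -
  interpret R: ring R by fact
  interpret S: ring S by fact
  define g where "g = inv_into (carrier R) f"
  have g: "g \<in> ring_iso S R" unfolding g_def by (rule ring_iso_set_sym[OF R f])
  have bij: "bij_betw f (carrier R) (carrier S)" using f by (simp add: ring_iso_def)
  have hom: "ring_hom_ring S R g" using g by (intro ring_hom_ringI2[OF S R]) (simp add: ring_iso_def)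
  have gE: "g ` f ` E = E" unfolding g_def using bij E by (intro inv_into_image_cancel) (auto simp: bij_betw_def)
  have gS: "g ` carrier S = carrier R" using g by (simp add: ring_iso_def bij_betw_def)
  have inj: "inj_on g (carrier S)" using g by (simp add: ring_iso_def bij_betw_def)
  have "R.dimension n (g ` f ` E) (g ` carrier S)"
    by (rule ring_hom_ring.inj_hom_dimension[OF hom sub one inj dim])
  hence dimR: "R.dimension n E (carrier R)" unfolding gE gS .
  have "subfield (g ` f ` E) R" by (rule ring_hom_ring.img_is_subfield(2)[OF hom sub one])
  hence "subfield E R" unfolding gE .
  thus ?thesis using R.dimI[OF _ dimR] by (simp add: over_def)
qed

lemma rational_approximation:
  fixes r :: real
  obtains q :: "nat \<Rightarrow> rat" where "(\<lambda>n. complex_of_real (of_rat (q n))) \<longlonglongrightarrow> complex_of_real r"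
proof -
  have "\<exists>q::rat. r < of_rat q \<and> of_rat q < r + 1 / Suc n" for n
    using of_rat_dense[of r "r + 1 / Suc n"] by auto
  then obtain q :: "nat \<Rightarrow> rat" where q: "\<And>n. r < of_rat (q n) \<and> of_rat (q n) < r + 1 / Suc n" by metis
  have "(\<lambda>n. real_of_rat (q n)) \<longlonglongrightarrow> r"
  proof (rule tendsto_sandwich)
    show "(\<lambda>n. r) \<longlonglongrightarrow> r" by simp
    show "(\<lambda>n. r + 1 / Suc n) \<longlonglongrightarrow> r"
      using tendsto_add[OF tendsto_const[of r] LIMSEQ_inverse_real_of_nat] by (simp add: inverse_eq_divide)
  qed (use q in \<open>auto intro!: always_eventually less_imp_le\<close>)
  thus ?thesis using that tendsto_of_real by blast
qed

lemma of_real_of_rat: "complex_of_real (of_rat q) = of_rat q"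
  by (cases q) (simp add: of_rat_rat)

lemma limit_of_reals:
  fixes f :: "nat \<Rightarrow> complex"
  assumes "\<And>n. f n \<in> \<real>" "f \<longlonglongrightarrow> z" shows "z \<in> \<real>"
proof -
  have "(\<lambda>n. Im (f n)) \<longlonglongrightarrow> Im z" using assms(2) by (rule tendsto_Im)
  moreover have "(\<lambda>n. Im (f n)) = (\<lambda>n. 0)" using assms(1) by (simp add: complex_is_Real_iff)
  ultimately have "Im z = 0" by (simp add: LIMSEQ_const_iff)
  thus ?thesis by (simp add: complex_is_Real_iff)
qed

lemma is_field_Reals: "is_field \<real>"
  by (auto simp: is_field_def is_ring_def)

lemma complex_dimension: "ring.dimension complex_ring 2 \<real> UNIV"
proof -
  interpret ring complex_ring by (rule complex_ring_ring)
  have sub: "subfield \<real> complex_ring" using is_field_Reals by (simp add: subfield_iff_is_field)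
  have line: "line_extension \<real> \<i> \<real> = UNIV"
  proof (rule UNIV_eq_I[symmetric])
    fix z
    have "z = complex_of_real (Im z) * \<i> + complex_of_real (Re z)" by (simp add: complex_eq_iff)
    thus "z \<in> line_extension \<real> \<i> \<real>"
      unfolding line_extension_mem_iff complex_ring_simps by (intro bexI) auto
  qed
  have "\<i> \<notin> \<real>" by (simp add: complex_is_Real_iff)
  hence "dimension (Suc 1) \<real> (line_extension \<real> \<i> \<real>)"
    using dimension_one[OF sub] by (intro Suc_dim) simp_all
  thus ?thesis unfolding line by (simp add: numeral_2_eq_2)
qed

text \<open>The limit map identifies the completion at an embedding with the closure of the image,
  which is the real line or the complex plane; in either case the degree is positive.\<close>

lemma local_degree_pos:
  assumes K: "is_field K" "K \<subseteq> Qbar" and s: "s \<in> gal" and v: "\<And>y. y \<in> K \<Longrightarrow> v y = cmod (s y)"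
  shows "local_degree K v \<ge> 1"
proof -
  have R: "is_ring K" using K by auto
  have cs: "x \<in> cauchy_seqs K v \<longleftrightarrow> (\<forall>n. x n \<in> K) \<and> convergent (\<lambda>n. s (x n))" for x
    by (rule cauchy_seqs_embedding[OF K s]) (rule v)
  have KQ: "x \<in> Qbar" if "x \<in> K" for x using that K by auto
  note s_simps = gal_add[OF s] gal_mult[OF s] gal_minus[OF s] gal_0[OF s] gal_1[OF s] KQ ring_closed[OF R]
  let ?C = "cauchy_ring K v"
  have C_simps: "carrier ?C = cauchy_seqs K v" "x \<otimes>\<^bsub>?C\<^esub> y = (\<lambda>n. x n * y n)" "\<one>\<^bsub>?C\<^esub> = (\<lambda>n. 1)"
    "\<zero>\<^bsub>?C\<^esub> = (\<lambda>n. 0)" "x \<oplus>\<^bsub>?C\<^esub> y = (\<lambda>n. x n + y n)" for x y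
    by (simp_all add: cauchy_ring_def)
  have ringC: "ring ?C"
  proof (rule ringI)
    show "abelian_group ?C"
    proof (rule abelian_groupI, unfold C_simps)
      fix x y assume "x \<in> cauchy_seqs K v" "y \<in> cauchy_seqs K v"
      thus "(\<lambda>n. x n + y n) \<in> cauchy_seqs K v"
        by (simp add: cs s_simps convergent_add)
    next
      show "(\<lambda>n. 0) \<in> cauchy_seqs K v" by (simp add: cs s_simps convergent_const)
    next
      fix x assume x: "x \<in> cauchy_seqs K v"
      show "\<exists>y\<in>cauchy_seqs K v. (\<lambda>n. y n + x n) = (\<lambda>n. 0)"
        by (rule bexI[of _ "\<lambda>n. - x n"]) (use x in \<open>auto simp: cs s_simps convergent_minus_iff[symmetric]\<close>)
    qed (simp_all add: algebra_simps)
    show "Group.monoid ?C"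
    proof (rule monoidI, unfold C_simps)
      fix x y assume "x \<in> cauchy_seqs K v" "y \<in> cauchy_seqs K v"
      thus "(\<lambda>n. x n * y n) \<in> cauchy_seqs K v"
        by (simp add: cs s_simps convergent_mult)
    next
      show "(\<lambda>n. 1) \<in> cauchy_seqs K v" by (simp add: cs s_simps convergent_const)
    qed (simp_all add: algebra_simps)
  qed (simp_all add: C_simps algebra_simps)
  define h where "h x = lim (\<lambda>n. s (x n))" for x :: "nat \<Rightarrow> complex"
  have h: "(\<lambda>n. s (x n)) \<longlonglongrightarrow> h x" if "x \<in> cauchy_seqs K v" for x
    using that cs by (simp add: h_def convergent_LIMSEQ_iff)
  have hI: "x \<in> cauchy_seqs K v \<and> h x = z" if "\<And>n. x n \<in> K" "(\<lambda>n. s (x n)) \<longlonglongrightarrow> z" for x z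
    using that cs[of x] limI[OF that(2)] by (auto simp: h_def convergent_def)
  have xK: "x n \<in> K" if "x \<in> cauchy_seqs K v" for x n using that cs by blast
  define T where "T = h ` cauchy_seqs K v"
  have homC: "ring_hom_ring ?C complex_ring h"
  proof (rule ring_hom_ringI2[OF ringC complex_ring_ring ring_hom_memI], unfold C_simps complex_ring_simps)
    fix x y assume x: "x \<in> cauchy_seqs K v" and y: "y \<in> cauchy_seqs K v"
    show "h (\<lambda>n. x n * y n) = h x * h y"
      using hI[of "\<lambda>n. x n * y n" "h x * h y"] xK[OF x] xK[OF y] tendsto_mult[OF h[OF x] h[OF y]]
      by (simp add: s_simps)
    show "h (\<lambda>n. x n + y n) = h x + h y"
      using hI[of "\<lambda>n. x n + y n" "h x + h y"] xK[OF x] xK[OF y] tendsto_add[OF h[OF x] h[OF y]]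
      by (simp add: s_simps)
  next
    show "h (\<lambda>n. 1) = 1" using hI[of "\<lambda>n. 1" 1] by (simp add: s_simps)
  qed simp
  have kernel: "a_kernel ?C complex_ring h = null_seqs K v"
  proof -
    have "x \<in> null_seqs K v \<longleftrightarrow> x \<in> cauchy_seqs K v \<and> h x = 0" for x
    proof
      assume "x \<in> null_seqs K v"
      hence x: "\<And>n. x n \<in> K" "(\<lambda>n. v (x n)) \<longlonglongrightarrow> 0" by (auto simp: null_seqs_def)
      have "(\<lambda>n. s (x n)) \<longlonglongrightarrow> 0" using x v by (simp add: tendsto_norm_zero_iff)
      thus "x \<in> cauchy_seqs K v \<and> h x = 0" using hI x(1) by blast
    next
      assume x: "x \<in> cauchy_seqs K v \<and> h x = 0"
      hence "(\<lambda>n. s (x n)) \<longlonglongrightarrow> 0" using h[of x] by simp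
      hence "(\<lambda>n. cmod (s (x n))) \<longlonglongrightarrow> 0" by (simp add: tendsto_norm_zero_iff)
      thus "x \<in> null_seqs K v" using x xK[of x] v by (simp add: null_seqs_def)
    qed
    thus ?thesis by (auto simp: a_kernel_def' C_simps)
  qed
  define Q where "Q = completion K v"
  have Q: "Q = ?C Quot (a_kernel ?C complex_ring h)" by (simp add: Q_def completion_def kernel)
  define f where "f = (\<lambda>Y. the_elem (h ` Y))"
  have iso: "f \<in> ring_iso Q (complex_ring \<lparr> carrier := T \<rparr>)"
    unfolding Q f_def T_def using ring_hom_ring.FactRing_iso_set_aux[OF homC] by (simp add: C_simps)
  interpret H: ring_hom_ring ?C complex_ring h by (rule homC)
  have ideal: "ideal (null_seqs K v) ?C" using H.kernel_is_ideal kernel by simp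
  have ringQ: "ring Q" unfolding Q by (rule ideal.quotient_is_ring[OF H.kernel_is_ideal])
  define E where "E = rational_completion K v"
  have f_coset: "f (null_seqs K v +>\<^bsub>?C\<^esub> x) = h x" if x: "x \<in> cauchy_seqs K v" for x
  proof -
    have "null_seqs K v +>\<^bsub>?C\<^esub> x = {y \<in> carrier ?C. h y = h x}"
      unfolding kernel[symmetric] using x by (intro H.rcos_eq_homeq) (simp add: C_simps)
    hence "h ` (null_seqs K v +>\<^bsub>?C\<^esub> x) = {h x}" using x by (auto simp: C_simps)
    thus ?thesis by (simp add: f_def)
  qed
  have ratK: "\<rat> \<subseteq> K" using field_Rats[OF K(1)] by auto
  have csQ: "x \<in> cauchy_seqs \<rat> v \<longleftrightarrow> (\<forall>n. x n \<in> \<rat>) \<and> convergent (\<lambda>n. s (x n))" for x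
    using ratK v by (intro cauchy_seqs_embedding[OF is_field_Rats Rats_Qbar s]) auto
  have subC: "cauchy_seqs \<rat> v \<subseteq> cauchy_seqs K v" using cs csQ ratK by auto
  have s_rat: "s x = x" if "x \<in> \<rat>" for x using gal_Rats[OF s that] .
  have E_carrier: "E \<subseteq> carrier Q"
    unfolding E_def rational_completion_def Q_def completion_def FactRing_simps
    using subC by (auto simp: C_simps a_r_coset_def)
  have "f ` E = h ` cauchy_seqs \<rat> v"
    unfolding E_def rational_completion_def image_image using f_coset subC by (intro image_cong) auto
  also have "\<dots> = \<real>"
  proof
    show "h ` cauchy_seqs \<rat> v \<subseteq> \<real>"
    proof
      fix z assume "z \<in> h ` cauchy_seqs \<rat> v"
      then obtain x where x: "x \<in> cauchy_seqs \<rat> v" "z = h x" by (elim imageE)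
      have "s (x n) \<in> \<real>" for n
      proof -
        have xn: "x n \<in> \<rat>" using x csQ by blast
        then obtain q where "x n = of_rat q" by (rule Rats_cases)
        thus ?thesis using s_rat[OF xn] by (simp add: of_real_of_rat[symmetric])
      qed
      moreover have "(\<lambda>n. s (x n)) \<longlonglongrightarrow> z" using h[of x] x subC by auto
      ultimately show "z \<in> \<real>" by (rule limit_of_reals)
    qed
    show "\<real> \<subseteq> h ` cauchy_seqs \<rat> v"
    proof
      fix z :: complex assume "z \<in> \<real>"
      then obtain r where r: "z = complex_of_real r" by (elim Reals_cases)
      obtain q :: "nat \<Rightarrow> rat" where q: "(\<lambda>n. complex_of_real (of_rat (q n))) \<longlonglongrightarrow> complex_of_real r"
        using rational_approximation[of r] .
      let ?x = "\<lambda>n. of_rat (q n) :: complex"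
      have "(\<lambda>n. s (?x n)) \<longlonglongrightarrow> z" using q by (simp add: s_rat r of_real_of_rat)
      moreover have "?x n \<in> \<rat>" "?x n \<in> K" for n using ratK by auto
      ultimately have "?x \<in> cauchy_seqs \<rat> v" "h ?x = z"
        using csQ[of ?x] hI[of ?x z] by (simp_all add: convergentI)
      thus "z \<in> h ` cauchy_seqs \<rat> v" by blast
    qed
  qed
  finally have fE: "f ` E = \<real>" .
  note fieldR = is_field_Reals
  have oneQ: "\<one>\<^bsub>Q\<^esub> \<noteq> \<zero>\<^bsub>Q\<^esub>"
  proof
    assume "\<one>\<^bsub>Q\<^esub> = \<zero>\<^bsub>Q\<^esub>"
    hence "null_seqs K v +>\<^bsub>?C\<^esub> \<one>\<^bsub>?C\<^esub> = null_seqs K v"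
      by (simp add: Q_def completion_def FactRing_def)
    hence "\<one>\<^bsub>?C\<^esub> \<in> null_seqs K v"
      using ideal.rcos_const_imp_mem[OF ideal] H.R.one_closed by blast
    hence "(\<lambda>n. v 1) \<longlonglongrightarrow> 0" by (simp add: null_seqs_def C_simps)
    hence "v 1 = 0" by (simp add: LIMSEQ_const_iff)
    thus False using v[of 1] by (simp add: s_simps)
  qed
  have T_real: "\<real> \<subseteq> T"
  proof -
    have "\<real> = h ` cauchy_seqs \<rat> v" using \<open>h ` cauchy_seqs \<rat> v = \<real>\<close> by simp
    thus ?thesis unfolding T_def using subC by blast
  qed
  show ?thesis
  proof (cases "\<forall>y\<in>K. s y \<in> \<real>")
    case True
    have "h x \<in> \<real>" if "x \<in> cauchy_seqs K v" for x
      by (rule limit_of_reals[OF _ h[OF that]]) (use xK[OF that] True in blast)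
    hence T: "T = \<real>" using T_real by (auto simp: T_def)
    let ?S = "complex_ring \<lparr> carrier := \<real> \<rparr>"
    have fS: "field ?S" using ring.subfield_iff(2)[OF complex_ring_ring] fieldR by (simp add: subfield_iff_is_field)
    interpret S: field ?S by (rule fS)
    have sub: "subfield \<real> ?S" using S.carrier_is_subfield by simp
    have "S.dimension 1 \<real> \<real>" using S.dimension_one[OF sub] .
    hence "ring.dim Q E (carrier Q) = 1"
      using iso unfolding T
      by (intro ring_iso_restrict_dimension[OF ringQ S.ring_axioms _ E_carrier _ oneQ, of f]) (simp_all add: fE sub)
    thus ?thesis by (simp add: local_degree_def Q_def E_def)
  next
    case False
    then obtain y where y: "y \<in> K" "s y \<notin> \<real>" by blast
    have T: "T = UNIV"
    proof (rule UNIV_eq_I[symmetric])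
      fix z :: complex
      have Im: "Im (s y) \<noteq> 0" using y(2) by (simp add: complex_is_Real_iff)
      define b where "b = Im z / Im (s y)"
      define a where "a = Re z - b * Re (s y)"
      have z: "z = complex_of_real a + complex_of_real b * s y"
        using Im by (simp add: complex_eq_iff a_def b_def)
      obtain q :: "nat \<Rightarrow> rat" where q: "(\<lambda>n. complex_of_real (of_rat (q n))) \<longlonglongrightarrow> complex_of_real a"
        using rational_approximation[of a] .
      obtain q' :: "nat \<Rightarrow> rat" where q': "(\<lambda>n. complex_of_real (of_rat (q' n))) \<longlonglongrightarrow> complex_of_real b"
        using rational_approximation[of b] .
      let ?x = "\<lambda>n. of_rat (q n) + of_rat (q' n) * y :: complex"
      have rK: "of_rat r \<in> K" for r using ratK by auto
      have "s (?x n) = complex_of_real (of_rat (q n)) + complex_of_real (of_rat (q' n)) * s y" for n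
        using y(1) rK by (simp add: s_simps s_rat of_real_of_rat)
      hence "(\<lambda>n. s (?x n)) \<longlonglongrightarrow> z"
        unfolding z using q q' by (simp only:) (intro tendsto_add tendsto_mult tendsto_const)
      hence "?x \<in> cauchy_seqs K v \<and> h ?x = z" using y(1) rK by (intro hI) (auto simp: s_simps)
      thus "z \<in> T" unfolding T_def by blast
    qed
    have sub: "subfield \<real> complex_ring" using fieldR by (simp add: subfield_iff_is_field)
    note dim = complex_dimension
    have same: "complex_ring \<lparr> carrier := UNIV \<rparr> = complex_ring" by (simp add: ring_of_type_algebra_def)
    have "ring.dim Q E (carrier Q) = 2"
      using iso unfolding T same
      by (intro ring_iso_restrict_dimension[OF ringQ complex_ring_ring _ E_carrier _ oneQ, of f])
        (simp_all add: fE sub dim)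
    thus ?thesis by (simp add: local_degree_def Q_def E_def)
  qed
qed

section \<open>Absolute values\<close>

context
  fixes K v assumes K: "is_field K" and av: "absolute_value_on K v"
begin

lemma av_nonneg: "x \<in> K \<Longrightarrow> v x \<ge> 0"
  and av_eq_0: "x \<in> K \<Longrightarrow> v x = 0 \<longleftrightarrow> x = 0"
  and av_mult: "x \<in> K \<Longrightarrow> y \<in> K \<Longrightarrow> v (x * y) = v x * v y"
  and av_add: "x \<in> K \<Longrightarrow> y \<in> K \<Longrightarrow> v (x + y) \<le> v x + v y"
  using av by (auto simp: absolute_value_on_def)

lemmas K_closed = ring_closed[OF is_field_imp_ring[OF K]]

lemma av_1: "v 1 = 1"
  using av_mult[of 1 1] av_eq_0[of 1] K_closed by simp

lemma av_pos: "x \<in> K \<Longrightarrow> x \<noteq> 0 \<Longrightarrow> v x > 0"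
  using av_nonneg[of x] av_eq_0[of x] by simp

lemma av_minus: assumes x: "x \<in> K" shows "v (- x) = v x"
proof -
  have "v (- 1) * v (- 1) = 1" using av_mult[of "-1" "-1"] K_closed av_1 by simp
  hence "v (- 1) ^ 2 = 1" by (simp add: power2_eq_square)
  hence "v (- 1) = 1" using av_nonneg[of "-1"] K_closed by (auto simp: power2_eq_1_iff)
  thus ?thesis using av_mult[of "-1" x] K_closed x by simp
qed

lemma av_diff_lower: assumes "x \<in> K" "y \<in> K" shows "v (x + y) \<ge> v x - v y"
  using av_add[of "x + y" "- y"] av_minus[OF assms(2)] K_closed assms by simp

lemma av_power: "x \<in> K \<Longrightarrow> v (x ^ n) = v x ^ n"
  by (induction n) (simp_all add: av_1 av_mult K_closed)

lemma av_divide: assumes "x \<in> K" "y \<in> K" "y \<noteq> 0" shows "v (x / y) = v x / v y"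
proof -
  have "v (x / y) * v y = v x"
    using av_mult[OF field_divide[OF K assms(1,2)] assms(2)] assms(3) by simp
  thus ?thesis using assms av_eq_0[of y] by (simp add: field_simps)
qed

lemma av_sum:
  assumes "\<And>i. i \<in> A \<Longrightarrow> f i \<in> K" shows "v (sum f A) \<le> (\<Sum>i\<in>A. v (f i))"
  using assms
proof (induction A rule: infinite_finite_induct)
  case (insert a A)
  have "v (f a + sum f A) \<le> v (f a) + v (sum f A)"
    by (intro av_add ring_sum[OF is_field_imp_ring[OF K]]) (use insert.prems in auto)
  thus ?case using insert by fastforce
qed (use av_eq_0[of 0] K_closed in auto)

text \<open>Cauchy's bound for the roots of a monic polynomial.\<close>

lemma av_root_bound:
  fixes B :: real
  assumes KQ: "K \<subseteq> Qbar" and y: "y \<in> K" "v y > 1"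
    and B: "\<And>i. i < card (cj y) \<Longrightarrow> v (Polynomial.coeff (cpoly y) i) \<le> B"
  shows "v y \<le> card (cj y) * B"
proof -
  have yQ: "y \<in> Qbar" using y KQ by auto
  define m where "m = card (cj y)"
  have m: "m > 0" unfolding m_def by (rule card_cj_pos[OF yQ])
  have cK: "Polynomial.coeff (cpoly y) i \<in> K" for i
    using cpoly_Rats[OF yQ] field_Rats[OF K] by (simp add: polys_def)
  have "0 = poly (cpoly y) y" using poly_cpoly[OF yQ] cj_self by simp
  also have "\<dots> = (\<Sum>i\<le>m. Polynomial.coeff (cpoly y) i * y ^ i)"
    unfolding poly_altdef degree_cpoly[OF yQ] m_def by simp
  also have "\<dots> = y ^ m + (\<Sum>i<m. Polynomial.coeff (cpoly y) i * y ^ i)"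
    using cpoly_lead[of y] by (simp add: degree_cpoly[OF yQ] m_def lessThan_Suc_atMost[symmetric])
  finally have eq: "y ^ m = - (\<Sum>i<m. Polynomial.coeff (cpoly y) i * y ^ i)"
    by (simp add: eq_neg_iff_add_eq_0)
  have terms: "Polynomial.coeff (cpoly y) i * y ^ i \<in> K" for i using cK y by (simp add: K_closed)
  have "v y ^ m = v (\<Sum>i<m. Polynomial.coeff (cpoly y) i * y ^ i)"
    using terms y by (subst av_power[symmetric]) (simp_all add: eq av_minus ring_sum[OF is_field_imp_ring[OF K]])
  also have "\<dots> \<le> (\<Sum>i<m. v (Polynomial.coeff (cpoly y) i * y ^ i))" using terms by (rule av_sum)
  also have "\<dots> \<le> (\<Sum>i<m. B * v y ^ (m - 1))"
  proof (rule sum_mono)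
    fix i assume "i \<in> {..<m}"
    hence i: "i < m" by simp
    have B0: "0 \<le> B" using B[of i] i av_nonneg[OF cK, of i] unfolding m_def by linarith
    have "v (Polynomial.coeff (cpoly y) i * y ^ i) = v (Polynomial.coeff (cpoly y) i) * v y ^ i"
      using cK y by (simp add: av_mult av_power K_closed)
    also have "\<dots> \<le> B * v y ^ (m - 1)"
      using B[of i] i y B0 by (intro mult_mono power_increasing) (auto simp: m_def)
    finally show "v (Polynomial.coeff (cpoly y) i * y ^ i) \<le> B * v y ^ (m - 1)" .
  qed
  also have "\<dots> = m * B * v y ^ (m - 1)" by simp
  finally have "v y * v y ^ (m - 1) \<le> m * B * v y ^ (m - 1)" using m by (simp add: power_eq_if)
  thus ?thesis using y by (simp add: m_def)
qed

end

lemma card_cj_power: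
  assumes "y \<in> Qbar" shows "cj (y ^ n) = (\<lambda>x. x ^ n) ` cj y" "card (cj (y ^ n)) \<le> card (cj y)"
proof -
  show eq: "cj (y ^ n) = (\<lambda>x. x ^ n) ` cj y"
    unfolding cj_def image_image by (rule image_cong[OF refl]) (rule gal_power[OF _ assms])
  show "card (cj (y ^ n)) \<le> card (cj y)" unfolding eq by (rule card_image_le[OF finite_cj[OF assms]])
qed

text \<open>Each term of a coefficient below the leading one contains at least one root as a factor.\<close>

lemma coeff_prod_linear_small:
  fixes A :: "complex set"
  assumes "finite A" "\<And>y. y \<in> A \<Longrightarrow> cmod y \<le> r" "0 \<le> r" "r \<le> 1" "i < card A"
  shows "cmod (Polynomial.coeff (\<Prod>y\<in>A. [:-y, 1:]) i) \<le> r * 2 ^ card A"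
  using assms(1,2,5)
proof (induction A arbitrary: i rule: finite_induct)
  case (insert a A)
  define P where "P = (\<Prod>y\<in>A. [:-y, 1:])"
  have bnd: "cmod (Polynomial.coeff P j) \<le> 2 ^ card A" for j
  proof -
    have "cmod (Polynomial.coeff P j) \<le> (1 + r) ^ card A"
      unfolding P_def using insert assms(3) by (intro coeff_prod_linear_bound) auto
    also have "\<dots> \<le> 2 ^ card A" using assms(3,4) by (intro power_mono) auto
    finally show ?thesis .
  qed
  have eq: "[:-a, 1:] * P = pCons 0 P - Polynomial.smult a P" by simp
  have "cmod (Polynomial.coeff ([:-a, 1:] * P) i) \<le> cmod (Polynomial.coeff (pCons 0 P) i) + cmod (a * Polynomial.coeff P i)"
    unfolding eq coeff_diff coeff_smult by (rule norm_triangle_ineq4)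
  also have "\<dots> \<le> r * 2 ^ card A + r * 2 ^ card A"
  proof (rule add_mono)
    show "cmod (Polynomial.coeff (pCons 0 P) i) \<le> r * 2 ^ card A"
    proof (cases i)
      case (Suc j)
      hence "j < card A" using insert by simp
      thus ?thesis using insert.IH[of j] insert.prems Suc by (simp add: P_def)
    qed (use assms(3) in simp)
    show "cmod (a * Polynomial.coeff P i) \<le> r * 2 ^ card A"
      unfolding norm_mult using bnd insert.prems assms(3) by (intro mult_mono) auto
  qed
  also have "\<dots> = r * 2 ^ card (insert a A)" using insert by simp
  finally show ?case using insert by (simp add: P_def del: mult_pCons_left)
qed simp

text \<open>Boundedness on the integers forces an absolute value to be at most 1 on algebraic integers,
  because the powers of such a number satisfy monic equations of bounded degree.\<close>

lemma padic_integral_le_1: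
  assumes K: "is_field K" "K \<subseteq> Qbar" and av: "absolute_value_on K v"
    and int: "\<And>n :: int. v (of_int n) \<le> 1" and y: "y \<in> K" "algebraic_int y"
  shows "v y \<le> 1"
proof (rule ccontr)
  assume "\<not> v y \<le> 1"
  hence gt: "v y > 1" by simp
  define M where "M = card (cj y)"
  have yQ: "y \<in> Qbar" using y K by auto
  have "v y ^ n \<le> M" if n: "n > 0" for n
  proof -
    have yn: "y ^ n \<in> K" using y by (intro ring_power[OF is_field_imp_ring[OF K(1)]])
    have gtn: "v (y ^ n) > 1" using gt n by (simp add: av_power[OF K(1) av y(1)])
    have "v (y ^ n) \<le> real (card (cj (y ^ n))) * 1"
    proof (rule av_root_bound[OF K(1) av K(2) yn gtn])
      fix i
      have "Polynomial.coeff (cpoly (y ^ n)) i \<in> \<int>"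
        using cpoly_Ints[OF algebraic_int_power[OF y(2)]] by (simp add: polys_def)
      then obtain c where "Polynomial.coeff (cpoly (y ^ n)) i = of_int c" by (elim Ints_cases)
      thus "v (Polynomial.coeff (cpoly (y ^ n)) i) \<le> 1" using int by simp
    qed
    also have "\<dots> \<le> M" using card_cj_power(2)[OF yQ] by (simp add: M_def)
    finally show ?thesis by (simp add: av_power[OF K(1) av y(1)])
  qed
  moreover obtain n where "real M < v y ^ n" using real_arch_pow[OF gt] by blast
  moreover have "real M < v y ^ Suc n"
    using \<open>real M < v y ^ n\<close> gt power_increasing[of n "Suc n" "v y"] by linarith
  ultimately show False by (metis not_le zero_less_Suc)
qed

text \<open>The minimal polynomials of the powers of y have bounded degree, and their coefficients below
  the leading one tend to 0. If y had absolute value above 1, Cauchy's bound would fail for a high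
  power.\<close>

lemma archimedean_spectral_bound:
  assumes K: "is_field K" "K \<subseteq> Qbar" and av: "absolute_value_on K v"
    and arch: "\<And>q. v (of_rat q) = \<bar>of_rat q\<bar>" and y: "y \<in> K" and small: "\<And>x. x \<in> cj y \<Longrightarrow> cmod x < 1"
  shows "v y \<le> 1"
proof (rule ccontr)
  assume "\<not> v y \<le> 1"
  hence gt: "v y > 1" by simp
  define M where "M = card (cj y)"
  have yQ: "y \<in> Qbar" using y K by auto
  define r where "r = Max (cmod ` cj y)"
  have fin: "finite (cmod ` cj y)" using finite_cj[OF yQ] by simp
  have "r \<in> cmod ` cj y" unfolding r_def using fin cj_self[of y] by (intro Max_in) auto
  hence r: "0 \<le> r" "r < 1" using small by auto
  have le_r: "cmod x \<le> r" if "x \<in> cj y" for x unfolding r_def using fin that by (intro Max_ge) auto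
  have bound: "1 < M * (r ^ n * 2 ^ M)" if n: "n > 0" for n
  proof -
    have yn: "y ^ n \<in> K" using y by (intro ring_power[OF is_field_imp_ring[OF K(1)]])
    have ynQ: "y ^ n \<in> Qbar" using yn K by auto
    have gtn: "v (y ^ n) > 1" using gt n by (simp add: av_power[OF K(1) av y(1)])
    have cM: "card (cj (y ^ n)) \<le> M" using card_cj_power(2)[OF yQ] by (simp add: M_def)
    have "v (y ^ n) \<le> card (cj (y ^ n)) * (r ^ n * 2 ^ M)"
    proof (rule av_root_bound[OF K(1) av K(2) yn gtn])
      fix i assume i: "i < card (cj (y ^ n))"
      have "Polynomial.coeff (cpoly (y ^ n)) i \<in> \<rat>" using cpoly_Rats[OF ynQ] by (simp add: polys_def)
      then obtain q where q: "Polynomial.coeff (cpoly (y ^ n)) i = of_rat q" by (rule Rats_cases)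
      have "v (Polynomial.coeff (cpoly (y ^ n)) i) = cmod (Polynomial.coeff (cpoly (y ^ n)) i)"
        unfolding q arch by (simp add: of_real_of_rat[symmetric])
      also have "\<dots> \<le> r ^ n * 2 ^ card (cj (y ^ n))"
        unfolding cpoly_def
      proof (rule coeff_prod_linear_small[OF finite_cj[OF ynQ]])
        fix x assume "x \<in> cj (y ^ n)"
        then obtain z where "z \<in> cj y" "x = z ^ n" using card_cj_power(1)[OF yQ] by auto
        thus "cmod x \<le> r ^ n" using le_r by (simp add: norm_power power_mono)
      qed (use r i in \<open>auto intro: power_le_one\<close>)
      also have "\<dots> \<le> r ^ n * 2 ^ M" using cM r by (intro mult_left_mono power_increasing) auto
      finally show "v (Polynomial.coeff (cpoly (y ^ n)) i) \<le> r ^ n * 2 ^ M" .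
    qed
    also have "\<dots> \<le> M * (r ^ n * 2 ^ M)" using cM r by (intro mult_right_mono) auto
    finally show ?thesis using gtn by simp
  qed
  have "(\<lambda>n. M * (r ^ n * 2 ^ M)) \<longlonglongrightarrow> real M * (0 * 2 ^ M)"
    using r by (intro tendsto_intros LIMSEQ_power_zero) auto
  hence "eventually (\<lambda>n. M * (r ^ n * 2 ^ M) < 1) sequentially"
    by (intro order_tendstoD) auto
  then obtain N where "\<And>n. n \<ge> N \<Longrightarrow> M * (r ^ n * 2 ^ M) < 1" by (auto simp: eventually_sequentially)
  from this[of "Suc N"] bound[of "Suc N"] show False by simp
qed

text \<open>The approximation theorem of Artin and Whaples. To treat one more absolute value w, a solution y
  for the others is combined with some y' that separates v from w. If y is small or of size 1
  at w, a high power of y times y' works; otherwise the power is replaced by its quotient by 1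
  plus itself, which is close to 1 where y is large and close to 0 where y is small.\<close>

lemma weak_approximation:
  assumes K: "is_field K" and v: "absolute_value_on K v" and fin: "finite V"
    and w: "\<And>w. w \<in> V \<Longrightarrow> absolute_value_on K w"
    and sep: "\<And>w. w \<in> V \<Longrightarrow> \<exists>y\<in>K. v y > 1 \<and> w y < 1"
    and one: "\<exists>y\<in>K. v y > 1"
  shows "\<exists>y\<in>K. v y > 1 \<and> (\<forall>w\<in>V. w y < 1)"
  using fin w sep
proof (induction V rule: finite_induct)
  case empty
  thus ?case using one by simp
next
  case (insert w V)
  have avw: "absolute_value_on K w" and avu: "\<And>u. u \<in> V \<Longrightarrow> absolute_value_on K u" using insert.prems by auto
  note R = is_field_imp_ring[OF K]
  obtain y where y: "y \<in> K" "v y > 1" "\<And>u. u \<in> V \<Longrightarrow> u y < 1" using insert by auto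
  obtain y' where y': "y' \<in> K" "v y' > 1" "w y' < 1" using insert.prems by auto
  show ?case
  proof (cases "w y \<le> 1")
    case True
    define z where "z n = y ^ n * y'" for n
    have zK: "z n \<in> K" for n unfolding z_def using y y' by (intro ring_mult[OF R] ring_power[OF R])
    have val: "u (z n) = u y ^ n * u y'" if "absolute_value_on K u" for u n
      unfolding z_def using y y' ring_power[OF R] by (simp add: av_mult[OF K that] av_power[OF K that])
    have vz: "v (z n) > 1" for n
    proof -
      have "1 \<le> v y ^ n" using y by simp
      hence "1 * v y' \<le> v y ^ n * v y'" using y' by (intro mult_right_mono) auto
      thus ?thesis unfolding val[OF v] using y' by linarith
    qed
    have wz: "w (z n) < 1" for n
    proof -
      have "w y ^ n \<le> 1" using True av_nonneg[OF K avw y(1)] by (intro power_le_one)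
      hence "w y ^ n * w y' \<le> 1 * w y'" using av_nonneg[OF K avw y'(1)] by (intro mult_right_mono)
      thus ?thesis unfolding val[OF avw] using y' by linarith
    qed
    have "eventually (\<lambda>n. u (z n) < 1) sequentially" if u: "u \<in> V" for u
    proof -
      have "(\<lambda>n. u y ^ n * u y') \<longlonglongrightarrow> 0 * u y'"
        using y(3)[OF u] av_nonneg[OF K avu[OF u] y(1)] by (intro tendsto_intros LIMSEQ_power_zero) auto
      thus ?thesis unfolding val[OF avu[OF u]] by (intro order_tendstoD) auto
    qed
    hence "eventually (\<lambda>n. \<forall>u\<in>V. u (z n) < 1) sequentially"
      using insert.hyps(1) by (simp add: eventually_ball_finite)
    then obtain n where "\<forall>u\<in>V. u (z n) < 1" by (auto simp: eventually_sequentially)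
    thus ?thesis using zK[of n] vz[of n] wz[of n] by auto
  next
    case False
    define z where "z n = y ^ n / (1 + y ^ n) * y'" for n
    have yn: "y ^ n \<in> K" "1 + y ^ n \<in> K" for n using y by (auto intro!: ring_add[OF R] ring_power[OF R] ring_1[OF R])
    have large: "u (z n) = u y ^ n / u (1 + y ^ n) * u y'" if "absolute_value_on K u" "1 + y ^ n \<noteq> 0" for u n
    proof -
      have "u (z n) = u (y ^ n / (1 + y ^ n)) * u y'"
        unfolding z_def using that(1) y' yn by (intro av_mult[OF K] field_divide[OF K])
      also have "u (y ^ n / (1 + y ^ n)) = u (y ^ n) / u (1 + y ^ n)"
        by (rule av_divide[OF K that(1) yn that(2)])
      finally show ?thesis using y by (simp add: av_power[OF K that(1)])
    qed
    have nz: "1 + y ^ n \<noteq> 0" if "n > 0" for n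
    proof
      assume "1 + y ^ n = 0"
      hence "v (y ^ n + 1) = 0" using av_eq_0[OF K v ring_0[OF R]] by (simp add: add.commute)
      moreover have "v (y ^ n + 1) \<ge> v (y ^ n) - v 1" using yn ring_1[OF R] by (intro av_diff_lower[OF K v])
      moreover have "v (y ^ n) > 1" using y that by (simp add: av_power[OF K v])
      ultimately show False by (simp add: av_1[OF K v])
    qed
    have zK: "z n \<in> K" for n unfolding z_def using y' yn by (intro ring_mult[OF R] field_divide[OF K])
    have lower: "u (1 + y ^ n) \<ge> u y ^ n - 1" "u (1 + y ^ n) \<ge> 1 - u y ^ n" "u (1 + y ^ n) \<le> 1 + u y ^ n"
      if u: "absolute_value_on K u" for u n
      using av_diff_lower[OF K u yn(1) ring_1[OF R], of n] av_diff_lower[OF K u ring_1[OF R] yn(1), of n]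
        av_add[OF K u ring_1[OF R] yn(1), of n] y(1) by (simp_all add: av_1[OF K u] av_power[OF K u] add.commute)
    have inv_lim: "(\<lambda>n. (1 / a) ^ n) \<longlonglongrightarrow> 0" if "a > 1" for a :: real
      using that by (intro LIMSEQ_power_zero) auto
    have v_ev: "eventually (\<lambda>n. v (z n) > 1) sequentially"
    proof -
      have "(\<lambda>n. 1 / (1 + (1 / v y) ^ n) * v y') \<longlonglongrightarrow> 1 / (1 + 0) * v y'"
        using y(2) by (intro tendsto_intros inv_lim) auto
      hence "eventually (\<lambda>n. 1 < 1 / (1 + (1 / v y) ^ n) * v y') sequentially"
        using y'(2) by (intro order_tendstoD) auto
      moreover have "eventually (\<lambda>n. n > (0 :: nat)) sequentially" by (rule eventually_gt_at_top)
      ultimately show ?thesis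
      proof eventually_elim
        case (elim n)
        have p: "v y ^ n > 0" using y(2) by simp
        have "v (1 + y ^ n) > 0" using av_pos[OF K v yn(2)[of n] nz[OF elim(2)]] .
        hence "v y ^ n / (1 + v y ^ n) \<le> v y ^ n / v (1 + y ^ n)"
          using lower(3)[OF v, of n] p by (intro divide_left_mono) auto
        moreover have "1 / (1 + (1 / v y) ^ n) = v y ^ n / (1 + v y ^ n)"
          using p y(2) by (simp add: power_divide field_simps)
        ultimately have "1 / (1 + (1 / v y) ^ n) * v y' \<le> v (z n)"
          unfolding large[OF v nz[OF elim(2)]] using y' by (intro mult_right_mono) auto
        thus ?case using elim by linarith
      qed
    qed
    have w_ev: "eventually (\<lambda>n. w (z n) < 1) sequentially"
    proof -
      have wy: "w y > 1" using False by simp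
      have "(\<lambda>n. 1 / (1 - (1 / w y) ^ n) * w y') \<longlonglongrightarrow> 1 / (1 - 0) * w y'"
        using wy by (intro tendsto_intros inv_lim) auto
      hence "eventually (\<lambda>n. 1 / (1 - (1 / w y) ^ n) * w y' < 1) sequentially"
        using y'(3) by (intro order_tendstoD) auto
      moreover have "eventually (\<lambda>n. n > (0 :: nat)) sequentially" by (rule eventually_gt_at_top)
      ultimately show ?thesis
      proof eventually_elim
        case (elim n)
        have p: "w y ^ n > 1" using wy elim by simp
        hence "w y ^ n / w (1 + y ^ n) \<le> w y ^ n / (w y ^ n - 1)"
          using lower(1)[OF avw, of n] by (intro divide_left_mono) auto
        moreover have "1 / (1 - (1 / w y) ^ n) = w y ^ n / (w y ^ n - 1)"
          using p wy by (simp add: power_divide field_simps)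
        ultimately have "w (z n) \<le> 1 / (1 - (1 / w y) ^ n) * w y'"
          unfolding large[OF avw nz[OF elim(2)]] using av_nonneg[OF K avw y'(1)] by (intro mult_right_mono) auto
        thus ?case using elim by linarith
      qed
    qed
    have "eventually (\<lambda>n. u (z n) < 1) sequentially" if u: "u \<in> V" for u
    proof -
      note avu = avu[OF u]
      have uy: "0 \<le> u y" "u y < 1" using y(3)[OF u] av_nonneg[OF K avu y(1)] by auto
      have "(\<lambda>n. u y ^ n / (1 - u y ^ n) * u y') \<longlonglongrightarrow> 0 / (1 - 0) * u y'"
        using uy by (intro tendsto_intros LIMSEQ_power_zero) auto
      hence "eventually (\<lambda>n. u y ^ n / (1 - u y ^ n) * u y' < 1) sequentially"
        by (intro order_tendstoD) auto
      moreover have "eventually (\<lambda>n. n > (0 :: nat)) sequentially" by (rule eventually_gt_at_top)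
      ultimately show ?thesis
      proof eventually_elim
        case (elim n)
        have "u y ^ n \<le> u y ^ 1" using uy elim by (intro power_decreasing) auto
        hence p: "u y ^ n < 1" "0 \<le> u y ^ n" using uy by auto
        hence "u y ^ n / u (1 + y ^ n) \<le> u y ^ n / (1 - u y ^ n)"
          using lower(2)[OF avu, of n] by (intro divide_left_mono) auto
        hence "u (z n) \<le> u y ^ n / (1 - u y ^ n) * u y'"
          unfolding large[OF avu nz[OF elim(2)]] using av_nonneg[OF K avu y'(1)] by (intro mult_right_mono) auto
        thus ?case using elim by linarith
      qed
    qed
    hence "eventually (\<lambda>n. \<forall>u\<in>V. u (z n) < 1) sequentially"
      using insert.hyps(1) by (simp add: eventually_ball_finite)
    with v_ev w_ev have "eventually (\<lambda>n. 1 < v (z n) \<and> w (z n) < 1 \<and> (\<forall>u\<in>V. u (z n) < 1)) sequentially"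
      by eventually_elim blast
    then obtain n where "1 < v (z n)" "w (z n) < 1" "\<forall>u\<in>V. u (z n) < 1" by (auto simp: eventually_sequentially)
    thus ?thesis using zK[of n] by auto
  qed
qed

text \<open>Two such absolute values agree on the rationals, so a rational number between the values at y
  rescales y suitably.\<close>

lemma archimedean_separation:
  assumes K: "is_field K" and v: "absolute_value_on K v" "\<And>q. v (of_rat q) = \<bar>of_rat q\<bar>"
    and w: "absolute_value_on K w" "\<And>q. w (of_rat q) = \<bar>of_rat q\<bar>"
    and ne: "y \<in> K" "v y \<noteq> w y"
  shows "\<exists>z\<in>K. v z > 1 \<and> w z < 1"
proof -
  have y0: "y \<noteq> 0" using ne av_eq_0[OF K v(1) ne(1)] av_eq_0[OF K w(1) ne(1)] by auto
  have qK: "of_rat q \<in> K" for q using field_Rats[OF K] by auto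
  have pos: "v y > 0" "w y > 0" using av_pos[OF K v(1) ne(1) y0] av_pos[OF K w(1) ne(1) y0] .
  show ?thesis
  proof (cases "w y < v y")
    case True
    then obtain q where q: "w y < of_rat q" "of_rat q < v y" using of_rat_dense by blast
    have q0: "real_of_rat q > 0" using q pos by linarith
    hence "(of_rat q :: complex) \<noteq> 0" by (metis of_rat_eq_0_iff less_irrefl)
    hence "v (y / of_rat q) = v y / of_rat q" "w (y / of_rat q) = w y / of_rat q"
      using ne(1) qK q0 by (simp_all add: av_divide[OF K v(1)] av_divide[OF K w(1)] v(2) w(2))
    thus ?thesis using q q0 field_divide[OF K ne(1) qK[of q]] by (intro bexI[of _ "y / of_rat q"]) auto
  next
    case False
    hence "v y < w y" using ne by simp
    then obtain q where q: "v y < of_rat q" "of_rat q < w y" using of_rat_dense by blast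
    have q0: "real_of_rat q > 0" using q pos by linarith
    have "v (of_rat q / y) = of_rat q / v y" "w (of_rat q / y) = of_rat q / w y"
      using ne(1) qK q0 y0 by (simp_all add: av_divide[OF K v(1)] av_divide[OF K w(1)] v(2) w(2))
    thus ?thesis using q q0 pos field_divide[OF K qK[of q] ne(1)] by (intro bexI[of _ "of_rat q / y"]) auto
  qed
qed

lemma padic_abs_int: assumes "Factorial_Ring.prime p" shows "padic_abs p (of_int n) \<le> 1"
proof -
  have p: "real p \<ge> 1" using assms prime_ge_1_nat by auto
  have "real p powi (- int (multiplicity (int p) n)) \<le> 1"
    using p by (simp add: power_int_minus field_simps)
  thus ?thesis by (simp add: padic_abs_def)
qed

section \<open>Comparison with the Weil height\<close>

definition embedding_place :: "complex set \<Rightarrow> (complex \<Rightarrow> complex) \<Rightarrow> complex \<Rightarrow> real" where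
  "embedding_place K s = restrict (\<lambda>y. cmod (s y)) K"

lemma embedding_place_av:
  assumes "is_field K" "K \<subseteq> Qbar" "s \<in> gal"
  shows "absolute_value_on K (embedding_place K s)" "embedding_place K s (of_rat q) = \<bar>of_rat q\<bar>"
proof -
  have R: "is_ring K" using assms by auto
  have Q: "x \<in> Qbar" if "x \<in> K" for x using assms that by auto
  have "cmod (s (x + y)) \<le> cmod (s x) + cmod (s y)" if "x \<in> K" "y \<in> K" for x y
    using gal_add[OF assms(3) Q[OF that(1)] Q[OF that(2)]] by (simp add: norm_triangle_ineq)
  thus "absolute_value_on K (embedding_place K s)"
    unfolding absolute_value_on_def embedding_place_def
    using assms(3) Q ring_closed[OF R] by (auto simp: gal_eq_0 gal_mult norm_mult)
  have "of_rat q \<in> K" using field_Rats[OF assms(1)] by auto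
  thus "embedding_place K s (of_rat q) = \<bar>of_rat q\<bar>"
    using gal_Rats[OF assms(3)] by (simp add: embedding_place_def) (simp add: of_real_of_rat[symmetric])
qed

lemma embedding_place_in_places:
  assumes "is_field K" "K \<subseteq> Qbar" "s \<in> gal"
  shows "embedding_place K s \<in> places K"
  using embedding_place_av[OF assms] unfolding places_def by (auto simp: embedding_place_def)

text \<open>An absolute value different from all those given by embeddings would, by approximation, be
  large at an element that is small in every embedding. The product defining the height is
  thereby a finite one; with infinitely many factors its value would be 1 by convention.\<close>

lemma archimedean_place_is_embedding:
  assumes K: "is_field K" "K \<subseteq> Qbar" and fin: "finite (embedding_place K ` gal)"
    and v: "v \<in> extensional K" "absolute_value_on K v" "\<And>q. v (of_rat q) = \<bar>of_rat q\<bar>"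
    and gt: "a \<in> K" "v a > 1"
  shows "v \<in> embedding_place K ` gal"
proof (rule ccontr)
  assume no: "v \<notin> embedding_place K ` gal"
  have "\<exists>y\<in>K. v y > 1 \<and> (\<forall>w\<in>embedding_place K ` gal. w y < 1)"
  proof (rule weak_approximation[OF K(1) v(2) fin])
    fix w assume "w \<in> embedding_place K ` gal"
    then obtain s where s: "s \<in> gal" "w = embedding_place K s" by (elim imageE)
    show av: "absolute_value_on K w" unfolding s(2) by (rule embedding_place_av(1)[OF K s(1)])
    have "v \<noteq> w" using no s by auto
    moreover have "w \<in> extensional K" unfolding s(2) embedding_place_def by simp
    ultimately obtain y where y: "y \<in> K" "v y \<noteq> w y" using v(1) extensionalityI by metis
    have "\<And>q. w (of_rat q) = \<bar>of_rat q\<bar>" unfolding s(2) by (rule embedding_place_av(2)[OF K s(1)])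
    thus "\<exists>y\<in>K. 1 < v y \<and> w y < 1" by (rule archimedean_separation[OF K(1) v(2,3) av _ y])
  next
    show "\<exists>y\<in>K. 1 < v y" using gt by blast
  qed
  then obtain y where y: "y \<in> K" "v y > 1" "\<And>w. w \<in> embedding_place K ` gal \<Longrightarrow> w y < 1" by blast
  have "v y \<le> 1"
  proof (rule archimedean_spectral_bound[OF K v(2,3) y(1)])
    fix x assume "x \<in> cj y"
    then obtain s where s: "s \<in> gal" "x = s y" unfolding cj_def by (elim imageE)
    have "embedding_place K s y < 1" by (rule y(3)[OF imageI[OF s(1)]])
    thus "cmod x < 1" using y(1) s(2) by (simp add: embedding_place_def)
  qed
  thus False using y(2) by simp
qed

text \<open>An archimedean place comes from at most two embeddings, whence the factor 2, and its local degree
  is at least 1. The places above primes do not see algebraic integers.\<close>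

theorem hm_le_log_height:
  assumes a: "algebraic_int a"
  shows "hm a \<le> 2 * log_height a"
proof -
  have aQ: "a \<in> Qbar" by (rule algebraic_int_Qbar[OF a])
  define K where "K = adjoin \<rat> a"
  note adj = adjoin_field[OF is_field_Rats Rats_Qbar aQ, folded K_def]
  have K: "is_field K" "K \<subseteq> Qbar" and aK: "a \<in> K" using adj by auto
  have genK: "generate_field complex_ring {a} = K"
    unfolding generate_field_hull
  proof
    show "is_field hull {a} \<subseteq> K" using aK K by (intro field_hull_minimal) auto
    have "poly q a \<in> is_field hull {a}" if "q \<in> polys \<rat>" for q
      using that polys_mono[of \<rat> "is_field hull {a}"] field_Rats[OF is_field_hull]
      by (intro poly_closed[OF is_field_imp_ring[OF is_field_hull]] field_hull_inc) auto
    thus "K \<subseteq> is_field hull {a}" by (auto simp: K_def adjoin_def)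
  qed
  define d where "d = field_degree K"
  have d: "0 < d" "d \<le> card (cj a)" using field_degree_adjoin(1,2)[OF aQ] by (simp_all add: d_def K_def)
  have agree: "s y = t y" if st: "s \<in> gal" "t \<in> gal" "s a = t a" and y: "y \<in> K" for s t y
  proof -
    obtain q where q: "q \<in> polys \<rat>" "y = poly q a" using y unfolding K_def adjoin_def by (elim imageE)
    show ?thesis unfolding q(2) using gal_poly_Rats[OF st(1) q(1) aQ] gal_poly_Rats[OF st(2) q(1) aQ] st(3) by simp
  qed
  define e where "e x = (SOME s. s \<in> gal \<and> s a = x)" for x
  have e: "e x \<in> gal \<and> e x a = x" if x: "x \<in> cj a" for x
  proof -
    obtain s where s: "s \<in> gal" "x = s a" using x unfolding cj_def by (elim imageE)
    show ?thesis unfolding e_def by (rule someI[of _ s]) (use s in simp)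
  qed
  define W where "W x = embedding_place K (e x)" for x
  have places_W: "embedding_place K s = W (s a)" if s: "s \<in> gal" for s
  proof -
    have es: "e (s a) \<in> gal" "e (s a) a = s a" using e[OF gal_in_cj[OF s]] by auto
    show ?thesis unfolding W_def embedding_place_def
      by (rule restrict_ext, rule arg_cong[where f = cmod], rule agree[OF s es(1) es(2)[symmetric]])
  qed
  have "embedding_place K ` gal \<subseteq> W ` cj a"
  proof (rule image_subsetI)
    fix s assume s: "s \<in> gal"
    show "embedding_place K s \<in> W ` cj a" unfolding places_W[OF s] by (rule imageI[OF gal_in_cj[OF s]])
  qed
  hence finV: "finite (embedding_place K ` gal)" using finite_cj[OF aQ] finite_subset by blast
  define S where "S = {v. v \<in> places K \<and> v a > 1}"
  have "S \<subseteq> embedding_place K ` gal"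
  proof
    fix v assume v: "v \<in> S"
    hence ext: "v \<in> extensional K" and av: "absolute_value_on K v" and gt: "v a > 1" by (auto simp: S_def places_def)
    consider "\<And>q. v (of_rat q) = \<bar>of_rat q\<bar>" | p where "Factorial_Ring.prime p" "\<And>q. v (of_rat q) = padic_abs p q"
      using v unfolding S_def places_def by blast
    thus "v \<in> embedding_place K ` gal"
    proof cases
      case 1
      thus ?thesis using archimedean_place_is_embedding[OF K finV ext av _ aK gt] by blast
    next
      case 2
      have "v (of_int n) \<le> 1" for n using 2(2)[of "of_int n"] padic_abs_int[OF 2(1), of n] by simp
      hence "v a \<le> 1" by (rule padic_integral_le_1[OF K av _ aK a])
      thus ?thesis using gt by simp
    qed
  qed
  hence finS: "finite S" using finV finite_subset by blast
  have lh: "log_height a = (\<Sum>v\<in>S. (local_degree K v / d) * ln (v a))"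
  proof -
    have "log_height a = ln (\<Prod>v\<in>S. max 1 (v a) powr (local_degree K v / d))"
      by (simp add: log_height_def weil_height_def weil_height_in_def genK d_def S_def)
    also have "\<dots> = (\<Sum>v\<in>S. ln (max 1 (v a) powr (local_degree K v / d)))"
      using finS by (intro ln_prod) (auto simp: powr_gt_zero)
    also have "\<dots> = (\<Sum>v\<in>S. (local_degree K v / d) * ln (v a))"
      by (intro sum.cong refl) (auto simp: S_def ln_powr max_def)
    finally show ?thesis .
  qed
  define C where "C = {x \<in> cj a. cmod x > 1}"
  have finC: "finite C" using finite_cj[OF aQ] by (simp add: C_def)
  have Wa: "W x a = cmod x" if "x \<in> cj a" for x using e[OF that] aK by (simp add: W_def embedding_place_def)
  have WS: "W ` C \<subseteq> S"
  proof (rule image_subsetI)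
    fix x assume x: "x \<in> C"
    hence xc: "x \<in> cj a" by (simp add: C_def)
    have "W x \<in> places K" unfolding W_def using e[OF xc] by (intro embedding_place_in_places[OF K]) auto
    thus "W x \<in> S" using x Wa[OF xc] by (simp add: S_def C_def)
  qed
  have fibre: "card {y \<in> C. W y = w} \<le> 2" for w
  proof (cases "{y \<in> C. W y = w} = {}")
    case True
    thus ?thesis by (simp only: card.empty)
  next
    case False
    then obtain x where x: "x \<in> C" "W x = w" by blast
    have "{y \<in> C. W y = w} \<subseteq> {x, cnj x}"
    proof
      fix y assume "y \<in> {y \<in> C. W y = w}"
      hence y: "y \<in> cj a" "W y = W x" and xc: "x \<in> cj a" using x by (auto simp: C_def)
      have a1: "a - 1 \<in> K" using aK by (intro ring_diff[OF is_field_imp_ring[OF K(1)]] ring_1[OF is_field_imp_ring[OF K(1)]])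
      have v1: "W z (a - 1) = cmod (z - 1)" if "z \<in> cj a" for z
      proof -
        have "e z \<in> gal" "e z a = z" using e[OF that] by auto
        thus ?thesis using a1 aQ by (simp add: W_def embedding_place_def gal_diff gal_1 Qbar_closed)
      qed
      have "cmod y = cmod x" using Wa[OF y(1)] Wa[OF xc] y(2) by simp
      hence 1: "(Re y)\<^sup>2 + (Im y)\<^sup>2 = (Re x)\<^sup>2 + (Im x)\<^sup>2" by (simp add: cmod_def)
      have "cmod (y - 1) = cmod (x - 1)" using v1[OF y(1)] v1[OF xc] y(2) by simp
      hence 2: "(Re y - 1)\<^sup>2 + (Im y)\<^sup>2 = (Re x - 1)\<^sup>2 + (Im x)\<^sup>2" by (simp add: cmod_def)
      have re: "Re y = Re x" using 1 2 by (simp add: power2_eq_square algebra_simps)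
      hence "Im y = Im x \<or> Im y = - Im x" using 1 by (simp add: power2_eq_iff)
      thus "y \<in> {x, cnj x}" using re by (auto simp: complex_eq_iff)
    qed
    hence "card {y \<in> C. W y = w} \<le> card {x, cnj x}" by (intro card_mono) auto
    also have "\<dots> \<le> 2" by (simp add: card_insert_if)
    finally show ?thesis .
  qed
  have pos: "ln (v a) \<ge> 0" if "v \<in> S" for v using that by (simp add: S_def)
  have "card (cj a) * hm a = (\<Sum>x\<in>cj a. ln (max 1 (cmod x)))" using card_cj_pos[OF aQ] by (simp add: hm_def)
  also have "\<dots> = (\<Sum>x\<in>C. ln (cmod x))"
    unfolding C_def using finite_cj[OF aQ] by (intro sum.mono_neutral_cong_right) (auto simp: max_def, metis ln_one order_le_less)
  also have "\<dots> = (\<Sum>x\<in>C. ln (W x a))" using Wa by (intro sum.cong) (auto simp: C_def)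
  also have "\<dots> = (\<Sum>w\<in>W ` C. \<Sum>x | x \<in> C \<and> W x = w. ln (W x a))"
    using finC by (rule sum.image_gen)
  also have "\<dots> = (\<Sum>w\<in>W ` C. card {x \<in> C. W x = w} * ln (w a))"
    by (intro sum.cong refl) simp
  also have "\<dots> \<le> (\<Sum>w\<in>W ` C. 2 * (local_degree K w * ln (w a)))"
  proof (rule sum_mono)
    fix w assume w: "w \<in> W ` C"
    hence wS: "w \<in> S" using WS by blast
    obtain x where x: "x \<in> C" "w = W x" using w by blast
    have ex: "e x \<in> gal" using e[of x] x by (simp add: C_def)
    have "local_degree K w \<ge> 1"
      by (rule local_degree_pos[OF K ex]) (simp add: x(2) W_def embedding_place_def)
    hence "1 * ln (w a) \<le> local_degree K w * ln (w a)" using pos[OF wS] by (intro mult_right_mono) auto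
    moreover have "card {x \<in> C. W x = w} * ln (w a) \<le> 2 * ln (w a)"
      using fibre[of w] pos[OF wS] by (intro mult_right_mono) auto
    ultimately show "card {x \<in> C. W x = w} * ln (w a) \<le> 2 * (local_degree K w * ln (w a))" by linarith
  qed
  also have "\<dots> \<le> (\<Sum>w\<in>S. 2 * (local_degree K w * ln (w a)))"
    using finS WS pos by (intro sum_mono2) auto
  also have "\<dots> = 2 * d * log_height a"
    unfolding lh using d(1) by (simp add: sum_distrib_left)
  also have "\<dots> \<le> card (cj a) * (2 * log_height a)"
  proof -
    have "0 \<le> log_height a" unfolding lh using pos by (intro sum_nonneg mult_nonneg_nonneg) auto
    thus ?thesis using d(2) mult_right_mono[of "real d" "card (cj a)" "2 * log_height a"] by simp
  qed
  finally show ?thesis using card_cj_pos[OF aQ] by simp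
qed

section \<open>Quadratic and cubic number fields\<close>

lemma number_field_field: "number_field E \<Longrightarrow> is_field E" "number_field E \<Longrightarrow> E \<subseteq> Qbar"
  by (auto simp: number_field_def subfield_iff_is_field)

lemma number_field_adjoin: "x \<in> Qbar \<Longrightarrow> number_field (adjoin \<rat> x)"
  using adjoin_field[OF is_field_Rats Rats_Qbar] field_degree_adjoin(3)
  by (simp add: number_field_def subfield_iff_is_field)

lemma Q_upto_hull: "Q_upto d = is_field hull (\<Union>{E. number_field E \<and> field_degree E \<le> d})"
  by (simp add: Q_upto_def generate_field_hull)

lemma Q_upto_field: "is_field (Q_upto d)" "Q_upto d \<subseteq> Qbar"
proof -
  show "is_field (Q_upto d)" unfolding Q_upto_hull by (rule is_field_hull)
  have "\<Union>{E. number_field E \<and> field_degree E \<le> d} \<subseteq> Qbar" using number_field_field(2) by blast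
  thus "Q_upto d \<subseteq> Qbar" unfolding Q_upto_hull by (rule field_hull_Qbar)
qed

lemma low_degree_mem_Q_upto:
  assumes "x \<in> Qbar" "card (cj x) \<le> d" shows "x \<in> Q_upto d"
proof -
  have "field_degree (adjoin \<rat> x) \<le> d" using field_degree_adjoin(2)[OF assms(1)] assms(2) by simp
  moreover have "x \<in> adjoin \<rat> x" by (rule adjoin_field(3)[OF is_field_Rats Rats_Qbar assms(1)])
  ultimately show ?thesis unfolding Q_upto_hull using number_field_adjoin[OF assms(1)]
    by (intro field_hull_inc) blast
qed

lemma root_of_rat_quadratic:
  assumes "a \<in> \<rat>" "b \<in> \<rat>" "c \<in> \<rat>" "a \<noteq> 0 \<or> b \<noteq> 0 \<or> c \<noteq> 0" "a + b * x + c * x ^ 2 = 0"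
  shows "x \<in> Qbar" "card (cj x) \<le> 2"
proof -
  let ?p = "[:a, b, c:]"
  have p: "?p \<in> polys \<rat>" using assms by (auto simp: polys_def coeff_pCons split: nat.splits)
  have p0: "?p \<noteq> 0" using assms(4) by auto
  have r: "poly ?p x = 0" using assms(5) by (simp add: power2_eq_square algebra_simps)
  show xQ: "x \<in> Qbar" using p p0 r by (auto simp: Qbar_def algebraic_altdef polys_def)
  have "card (cj x) \<le> Polynomial.degree ?p" by (rule card_cj_le_degree[OF p p0 r xQ])
  also have "\<dots> \<le> 2" by simp
  finally show "card (cj x) \<le> 2" .
qed

lemma sqrt_mem_Q_upto_2:
  assumes "x ^ 2 \<in> \<rat>" shows "x \<in> Q_upto 2"
  using root_of_rat_quadratic[of "- (x ^ 2)" 0 1 x] assms by (intro low_degree_mem_Q_upto) auto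

definition rootfields :: "complex set \<Rightarrow> complex set" where
  "rootfields M = (\<Union>j. rootfield M j)"

lemma rootfields_field: "is_field (rootfields M)"
proof -
  have "\<exists>j. x \<in> rootfield M j \<and> y \<in> rootfield M j" 
    if xy: "x \<in> rootfields M" "y \<in> rootfields M" for x y
  proof -
    obtain i j where "x \<in> rootfield M i" "y \<in> rootfield M j" using xy by (auto simp: rootfields_def)
    thus ?thesis using rootfield_mono[of i "max i j" M] rootfield_mono[of j "max i j" M]
      by (intro exI[of _ "max i j"]) auto
  qed
  note pair = this
  have in1: "x \<in> rootfields M" if "x \<in> rootfield M j" for x j using that by (auto simp: rootfields_def)
  show ?thesis
    unfolding is_field_def is_ring_def
  proof (intro conjI ballI)
    show "1 \<in> rootfields M" by (rule in1[OF ring_1[OF is_field_imp_ring[OF rootfield_field[of M 0]]]])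
    fix x assume x: "x \<in> rootfields M"
    obtain j where "x \<in> rootfield M j" using x by (auto simp: rootfields_def)
    thus "inverse x \<in> rootfields M" by (rule in1[OF field_inverse[OF rootfield_field]])
    fix y assume y: "y \<in> rootfields M"
    obtain j where j: "x \<in> rootfield M j" "y \<in> rootfield M j" using pair[OF x y] by blast
    note R = is_field_imp_ring[OF rootfield_field[of M j]]
    show "x - y \<in> rootfields M" "x * y \<in> rootfields M"
      using in1[OF ring_diff[OF R j]] in1[OF ring_mult[OF R j]] .
  qed
qed

lemma sq_rootfields: "sq n \<in> rootfields M"
  unfolding rootfields_def rootfield_def by (rule UN_I[of n]) (auto intro: field_hull_inc)

lemma gen_rootfields: "x \<in> M \<Longrightarrow> x \<in> rootfields M"
  unfolding rootfields_def rootfield_def by (rule UN_I[of 0]) (auto intro: field_hull_inc)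

lemma sqrt_mem_rootfields:
  assumes i: "\<i> \<in> M" and x: "x ^ 2 \<in> \<rat>"
  shows "x \<in> rootfields M"
proof -
  note F = rootfields_field[of M]
  note R = is_field_imp_ring[OF F]
  obtain u w :: int where w: "w > 0" "x ^ 2 = of_int u / of_int w" using x by (elim Rats_cases') auto
  define n where "n = u * w"
  define z where "z = of_int w * x"
  have "z ^ 2 = of_int w ^ 2 * (of_int u / of_int w)" unfolding z_def power_mult_distrib w(2) ..
  also have "\<dots> = of_int n" using w(1) by (simp add: n_def power2_eq_square)
  finally have z2: "z ^ 2 = of_int n" .
  obtain y where y: "y \<in> rootfields M" "y ^ 2 = of_int n"
  proof (cases "n \<ge> 0")
    case True
    hence "sq (nat n) ^ 2 = of_int n" by (simp add: sq_squared)
    thus ?thesis using that sq_rootfields by blast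
  next
    case False
    hence "(\<i> * sq (nat (- n))) ^ 2 = of_int n" by (simp add: sq_squared power_mult_distrib)
    moreover have "\<i> * sq (nat (- n)) \<in> rootfields M"
      by (intro ring_mult[OF R] gen_rootfields i sq_rootfields)
    ultimately show ?thesis using that by blast
  qed
  have "z = y \<or> z = - y" using z2 y(2) by (metis power2_eq_iff)
  hence "z \<in> rootfields M" using y(1) ring_minus[OF R] by auto
  hence "z / of_int w \<in> rootfields M" by (intro field_divide[OF F] ring_of_int[OF R])
  thus ?thesis using w(1) by (simp add: z_def)
qed

lemma list_length3: "length xs = 3 \<Longrightarrow> \<exists>a b c. xs = [a, b, c]"
  by (auto simp: numeral_3_eq_3 length_Suc_conv)

lemma list_length4: "length xs = 4 \<Longrightarrow> \<exists>a b c d. xs = [a, b, c, d]"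
  by (auto simp: eval_nat_numeral length_Suc_conv)

lemma combine_complex [simp]:
  "ring.combine complex_ring (k # Ks) (u # Us) = k * u + ring.combine complex_ring Ks Us"
  "ring.combine complex_ring [] [] = 0"
  using ring.combine.simps[OF complex_ring_ring] by simp_all

text \<open>The quadratic formula.\<close>

lemma Q_upto_2_rootfields:
  assumes i: "\<i> \<in> M" shows "Q_upto 2 \<subseteq> rootfields M"
  unfolding Q_upto_hull
proof (rule field_hull_minimal[OF _ rootfields_field], safe)
  fix x E assume E: "number_field E" "field_degree E \<le> 2" and x: "x \<in> E"
  note F = rootfields_field[of M]
  note R = is_field_imp_ring[OF F]
  note RE = is_field_imp_ring[OF number_field_field(1)[OF E(1)]]
  have Us: "set [1, x, x ^ 2] \<subseteq> E" using x RE by (simp add: ring_1 ring_power)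
  obtain Ks where Ks: "length Ks = length [1, x, x ^ 2]" "set Ks \<subseteq> \<rat>" "set Ks \<noteq> {0}"
    "ring.combine complex_ring Ks [1, x, x ^ 2] = 0"
    using number_field_dependent[OF E(1) _ Us] E(2) by auto
  then obtain a b c where K3: "Ks = [a, b, c]" using list_length3[of Ks] by auto
  have rat: "a \<in> \<rat>" "b \<in> \<rat>" "c \<in> \<rat>" using Ks(2) by (auto simp: K3)
  have eq: "a + b * x + c * x ^ 2 = 0" using Ks(4) by (simp add: K3 algebra_simps)
  have nz: "a \<noteq> 0 \<or> b \<noteq> 0 \<or> c \<noteq> 0" using Ks(3) by (auto simp: K3)
  have ratF: "r \<in> rootfields M" if "r \<in> \<rat>" for r using field_Rats[OF F that] .
  show "x \<in> rootfields M"
  proof (cases "c = 0")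
    case True
    have "b \<noteq> 0" using True eq nz by auto
    hence "x = - a / b" using eq True by (simp add: field_simps eq_neg_iff_add_eq_0 add.commute)
    thus ?thesis using ratF rat by auto
  next
    case False
    have "(2 * c * x + b) ^ 2 = b ^ 2 - 4 * a * c + 4 * c * (a + b * x + c * x ^ 2)"
      by (simp add: power2_eq_square algebra_simps)
    hence "(2 * c * x + b) ^ 2 = b ^ 2 - 4 * a * c" using eq by simp
    hence "(2 * c * x + b) ^ 2 \<in> \<rat>" using rat by simp
    hence "2 * c * x + b \<in> rootfields M" by (rule sqrt_mem_rootfields[OF i])
    hence "((2 * c * x + b) - b) / (2 * c) \<in> rootfields M"
      using ratF rat by (intro field_divide[OF F] ring_diff[OF R]) auto
    thus ?thesis using False by simp
  qed
qed

text \<open>Numbers of degree at most 2 lie in F, so an element of a cubic field outside F has degree 3,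
  and then generates the field because any fourth element depends on its powers.\<close>

lemma cubic_generator:
  assumes E: "number_field E" "field_degree E = 3" and F: "is_field F" "Q_upto 2 \<subseteq> F" and new: "\<not> E \<subseteq> F"
  obtains k where "algebraic_int k" "k \<notin> F" "card (cj k) = 3" "adjoin \<rat> k = E"
proof -
  have fE: "is_field E" "E \<subseteq> Qbar" using number_field_field E(1) by auto
  note RE = is_field_imp_ring[OF fE(1)]
  obtain x where x: "x \<in> E" "x \<notin> F" using new by blast
  have "algebraic x" using x fE by (auto simp: Qbar_def)
  then obtain c :: int where c: "c \<noteq> 0" "algebraic_int (of_int c * x)" using algebraic_multiple_integral by blast
  define k where "k = of_int c * x"
  have kE: "k \<in> E" unfolding k_def using x(1) by (intro ring_mult[OF RE] ring_of_int[OF RE])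
  have kF: "k \<notin> F"
  proof
    assume "k \<in> F"
    hence "k / of_int c \<in> F" by (intro field_divide[OF F(1)] ring_of_int[OF is_field_imp_ring[OF F(1)]])
    thus False using x(2) c(1) by (simp add: k_def)
  qed
  have kint: "algebraic_int k" using c(2) by (simp add: k_def)
  have kQ: "k \<in> Qbar" using kint by (rule algebraic_int_Qbar)
  have ge: "\<not> card (cj k) \<le> 2" using low_degree_mem_Q_upto[OF kQ] kF F(2) by blast
  have "card (cj k) \<le> 3"
  proof -
    have Us: "set [1, k, k ^ 2, k ^ 3] \<subseteq> E" using kE RE by (simp add: ring_1 ring_power)
    obtain Ks where Ks: "length Ks = length [1, k, k ^ 2, k ^ 3]" "set Ks \<subseteq> \<rat>" "set Ks \<noteq> {0}"
      "ring.combine complex_ring Ks [1, k, k ^ 2, k ^ 3] = 0"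
      using number_field_dependent[OF E(1) _ Us] E(2) by auto
    then obtain a b c d where K4: "Ks = [a, b, c, d]" using list_length4[of Ks] by auto
    let ?p = "[:a, b, c, d:]"
    have p: "?p \<in> polys \<rat>" using Ks(2) by (auto simp: K4 polys_def coeff_pCons split: nat.splits)
    have p0: "?p \<noteq> 0" using Ks(3) by (auto simp: K4)
    have r: "poly ?p k = 0" using Ks(4) by (simp add: K4 eval_nat_numeral algebra_simps)
    have "card (cj k) \<le> Polynomial.degree ?p" by (rule card_cj_le_degree[OF p p0 r kQ])
    also have "\<dots> \<le> 3" by simp
    finally show ?thesis .
  qed
  hence deg: "card (cj k) = 3" using ge by simp
  note adj = adjoin_field[OF is_field_Rats Rats_Qbar kQ]
  have "adjoin \<rat> k = E"
  proof
    show "adjoin \<rat> k \<subseteq> E"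
      unfolding adjoin_def using poly_closed[OF RE _ kE] polys_mono[of "\<rat>" E] field_Rats[OF fE(1)] by blast
    show "E \<subseteq> adjoin \<rat> k"
    proof
      fix y assume y: "y \<in> E"
      have Us: "set [y, 1, k, k ^ 2] \<subseteq> E" using y kE RE by (simp add: ring_1 ring_power)
      obtain Ks where Ks: "length Ks = length [y, 1, k, k ^ 2]" "set Ks \<subseteq> \<rat>" "set Ks \<noteq> {0}"
        "ring.combine complex_ring Ks [y, 1, k, k ^ 2] = 0"
        using number_field_dependent[OF E(1) _ Us] E(2) by auto
      then obtain d a b c where K4: "Ks = [d, a, b, c]" using list_length4[of Ks] by auto
      have rat: "d \<in> \<rat>" "a \<in> \<rat>" "b \<in> \<rat>" "c \<in> \<rat>" using Ks(2) by (auto simp: K4)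
      have eq: "d * y + (a + b * k + c * k ^ 2) = 0" using Ks(4) by (simp add: K4 algebra_simps)
      have d0: "d \<noteq> 0"
      proof
        assume "d = 0"
        hence "a \<noteq> 0 \<or> b \<noteq> 0 \<or> c \<noteq> 0" "a + b * k + c * k ^ 2 = 0" using Ks(3) eq by (auto simp: K4)
        thus False using root_of_rat_quadratic(2)[OF rat(2-4)] ge by blast
      qed
      have "d * y = - (a + b * k + c * k ^ 2)" using eq by (simp only: eq_neg_iff_add_eq_0)
      hence "y = - (a + b * k + c * k ^ 2) / d" using d0 by (simp add: field_simps)
      moreover have "r \<in> adjoin \<rat> k" if "r \<in> \<rat>" for r using field_Rats[OF adj(1) that] .
      ultimately show "y \<in> adjoin \<rat> k"
        using rat adj(3) is_field_imp_ring[OF adj(1)]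
        by (simp add: field_divide[OF adj(1)] ring_closed)
    qed
  qed
  thus ?thesis using that kint kF deg by blast
qed

section \<open>The composite ring\<close>

lemma algebraic_ints_ring: "is_ring {x. algebraic_int x}"
  by (auto simp: is_ring_def)

lemma is_ring_hull: "is_ring (is_ring hull S)"
  unfolding hull_def is_ring_def[of "\<Inter> _"] by (simp add: ring_closed)

lemma ring_hull_minimal: "S \<subseteq> R \<Longrightarrow> is_ring R \<Longrightarrow> is_ring hull S \<subseteq> R"
  by (rule hull_minimal)

theorem mainTheorem4:
  fixes K L :: "nat \<Rightarrow> complex set"
  assumes "L 0 = Q_upto 2"
    and "\<And>n. n \<ge> 1 \<Longrightarrow> number_field (K n) \<and> field_degree (K n) = 3"
    and "Q_upto 3 = composite_ring (insert (L 0) (K ` {1..}))"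
    and "\<And>n. n \<ge> 1 \<Longrightarrow> L n = composite_ring {L (n - 1), K n}"
    and "\<And>n. n \<ge> 1 \<Longrightarrow> L (n - 1) \<subset> L n"
  shows "northcott
    (composite_ring (insert (ring_of_integers (L 0)) ((\<lambda>n. ring_of_integers (K n)) ` {1..})))"
proof -
  have LS: "L (Suc n) = is_ring hull (L n \<union> K (Suc n))" for n
    using assms(4)[of "Suc n"] by (simp add: composite_ring_def generate_ring_hull)
  have Lsub: "L n \<subset> L (Suc n)" for n using assms(5)[of "Suc n"] by simp
  have nf: "number_field (K (Suc n))" "field_degree (K (Suc n)) = 3" for n using assms(2)[of "Suc n"] by simp_all
  have Lfield: "is_field (L n) \<and> L n \<subseteq> Qbar" for n
  proof (induction n)
    case 0
    show ?case unfolding assms(1) using Q_upto_field by blast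
  next
    case (Suc n)
    have Q: "L (Suc n) \<subseteq> Qbar"
      unfolding LS using Suc number_field_field(2)[OF nf(1)] Qbar_ring by (intro ring_hull_minimal) auto
    have "\<rat> \<subseteq> L (Suc n)" using Lsub[of n] field_Rats Suc by blast
    moreover have "is_ring (L (Suc n))" unfolding LS by (rule is_ring_hull)
    ultimately show ?case using algebraic_ring_is_field Q by blast
  qed
  have Lmono: "L m \<subseteq> L n" if "m \<le> n" for m n
    using lift_Suc_mono_le[of L, OF _ that] Lsub by blast
  have L0: "Q_upto 2 \<subseteq> L n" for n using Lmono[of 0 n] assms(1) by simp
  have "\<not> K (Suc n) \<subseteq> L n" for n
  proof
    assume "K (Suc n) \<subseteq> L n"
    hence "L (Suc n) \<subseteq> L n" unfolding LS using Lfield by (intro ring_hull_minimal) auto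
    thus False using Lsub by blast
  qed
  hence "\<exists>k. algebraic_int k \<and> k \<notin> L n \<and> card (cj k) = 3 \<and> adjoin \<rat> k = K (Suc n)" for n
    using cubic_generator[OF nf _ L0, of n n] Lfield by metis
  then obtain k where k: "\<And>n. algebraic_int (k n)" "\<And>n. k n \<notin> L n" "\<And>n. card (cj (k n)) = 3"
    "\<And>n. adjoin \<rat> (k n) = K (Suc n)" by metis
  have kQ: "k n \<in> Qbar" for n using k(1) by (rule algebraic_int_Qbar)
  define R where "R n = is_ring hull (ring_of_integers (L 0) \<union> (\<Union>i<n. ring_of_integers (K (Suc i))))" for n
  have R_ring: "is_ring (R n)" for n unfolding R_def by (rule is_ring_hull)
  have KL: "K (Suc i) \<subseteq> L (Suc i)" for i unfolding LS by (rule order.trans[OF Un_upper2 hull_subset])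
  have R_L: "R n \<subseteq> L n" for n
  proof -
    have "ring_of_integers (K (Suc i)) \<subseteq> L n" if "i < n" for i
      using KL[of i] Lmono[of "Suc i" n] that by (auto simp: ring_of_integers_def)
    moreover have "ring_of_integers (L 0) \<subseteq> L n" using Lmono[of 0 n] by (auto simp: ring_of_integers_def)
    ultimately show ?thesis unfolding R_def using Lfield[of n] by (intro ring_hull_minimal) auto
  qed
  have R_int: "algebraic_int x" if "x \<in> R n" for x n
  proof -
    have "R n \<subseteq> {x. algebraic_int x}" unfolding R_def
      by (rule ring_hull_minimal[OF _ algebraic_ints_ring]) (auto simp: ring_of_integers_def)
    thus ?thesis using that by blast
  qed
  have R_mono: "R m \<subseteq> R n" if "m \<le> n" for m n
    unfolding R_def using that by (intro hull_mono Un_mono UN_mono) auto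
  have R_Suc: "R (Suc n) \<subseteq> is_ring hull (R n \<union> ring_of_integers (K (Suc n)))" for n
  proof -
    let ?H = "is_ring hull (R n \<union> ring_of_integers (K (Suc n)))"
    have "R n \<union> ring_of_integers (K (Suc n)) \<subseteq> ?H" by (rule hull_subset)
    moreover have "ring_of_integers (L 0) \<union> (\<Union>i<n. ring_of_integers (K (Suc i))) \<subseteq> R n"
      unfolding R_def by (rule hull_subset)
    ultimately have "ring_of_integers (L 0) \<union> (\<Union>i<Suc n. ring_of_integers (K (Suc i))) \<subseteq> ?H"
      unfolding lessThan_Suc by auto
    thus ?thesis unfolding R_def[of "Suc n"] by (rule ring_hull_minimal[OF _ is_ring_hull])
  qed
  define S where "S = composite_ring (insert (ring_of_integers (L 0)) ((\<lambda>n. ring_of_integers (K n)) ` {1..}))"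
  have S_R: "S \<subseteq> (\<Union>n. R n)"
  proof -
    have "is_ring (\<Union>n. R n)"
      unfolding is_ring_def
    proof (intro conjI ballI)
      show "1 \<in> (\<Union>n. R n)" using ring_1[OF R_ring[of 0]] by blast
      fix x y assume "x \<in> (\<Union>n. R n)" "y \<in> (\<Union>n. R n)"
      then obtain m n where "x \<in> R m" "y \<in> R n" by blast
      hence xy: "x \<in> R (max m n)" "y \<in> R (max m n)" using R_mono[of m "max m n"] R_mono[of n "max m n"] by auto
      show "x - y \<in> (\<Union>n. R n)" "x * y \<in> (\<Union>n. R n)"
        using ring_diff[OF R_ring xy] ring_mult[OF R_ring xy] by blast+
    qed
    moreover have "ring_of_integers (K n) \<subseteq> (\<Union>n. R n)" if "n \<ge> 1" for n
    proof -
      obtain i where i: "n = Suc i" using \<open>n \<ge> 1\<close> by (cases n) auto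
      have "ring_of_integers (K n) \<subseteq> R (Suc i)" unfolding R_def i
        by (rule order.trans[OF _ hull_subset]) auto
      thus ?thesis by blast
    qed
    moreover have "ring_of_integers (L 0) \<subseteq> R 0" unfolding R_def by (rule order.trans[OF _ hull_subset]) auto
    hence "ring_of_integers (L 0) \<subseteq> (\<Union>n. R n)" by blast
    ultimately show ?thesis unfolding S_def composite_ring_def generate_ring_hull
      by (intro ring_hull_minimal) auto
  qed
  have step: "\<exists>y. y \<in> L (Suc n) \<and> y \<notin> L n \<and> algebraic_int y \<and> card (cj y) \<le> 3 \<and>
      (\<forall>u\<in>cj y. cmod u ^ 4 \<le> 2304 * exp (12 * hm a))"
    if a: "a \<in> R (Suc n)" "a \<notin> R n" for a n
  proof -
    have F: "is_field (L n)" "L n \<subseteq> Qbar" using Lfield by auto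
    obtain s where s: "emb Qbar s" "\<And>x. x \<in> L n \<Longrightarrow> s x = x" "s (k n) \<noteq> k n"
      using emb_moving[OF F kQ k(2)] by metis
    interpret C: cubic_step "L n" "k n" s
      using F k(1,3) s sqrt_mem_Q_upto_2 L0[of n] by unfold_locales (auto simp: gal_def)
    have K_eq: "C.K = K (Suc n)" unfolding C.K_def by (rule k(4))
    have "C.OK = ring_of_integers (K (Suc n))" unfolding C.OK_def ring_of_integers_def K_eq ..
    hence aH: "a \<in> is_ring hull (R n \<union> C.OK)" using R_Suc[of n] a(1) by auto
    obtain y where "y \<in> C.K" "y \<notin> L n" "algebraic_int y" "card (cj y) \<le> 3"
      "\<And>u. u \<in> cj y \<Longrightarrow> cmod u ^ 4 \<le> 2304 * exp (12 * hm a)"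
      by (rule C.small_element[OF R_ring R_L _ aH a(2)]) (rule R_int, assumption, rule that)
    thus ?thesis unfolding K_eq using KL by blast
  qed
  have fin: "finite {a \<in> S. hm a \<le> B}" for B
  proof -
    define r where "r = max 1 (2304 * exp (12 * B))"
    define Y where "Y = {y. algebraic_int y \<and> card (cj y) \<le> 3 \<and> (\<forall>u\<in>cj y. cmod u \<le> r)}"
    have finY: "finite Y" unfolding Y_def by (rule finite_bounded_conjugates)
    \<comment> \<open>The steps at which elements of small height appear. Each yields a small element of the
      cubic field that is new at this step, so that different steps yield different elements.\<close>
    define Bad where "Bad = {n. \<exists>a. a \<in> R (Suc n) \<and> a \<notin> R n \<and> hm a \<le> B}"
    have "\<exists>y. y \<in> L (Suc n) \<and> y \<notin> L n \<and> y \<in> Y" if "n \<in> Bad" for n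
    proof -
      obtain a where a: "a \<in> R (Suc n)" "a \<notin> R n" "hm a \<le> B" using \<open>n \<in> Bad\<close> by (auto simp: Bad_def)
      obtain y where y: "y \<in> L (Suc n)" "y \<notin> L n" "algebraic_int y" "card (cj y) \<le> 3"
        "\<forall>u\<in>cj y. cmod u ^ 4 \<le> 2304 * exp (12 * hm a)" using step[OF a(1,2)] by blast
      have "cmod u \<le> r" if "u \<in> cj y" for u
      proof (cases "cmod u \<le> 1")
        case False
        have "cmod u ^ 1 \<le> cmod u ^ 4" using False by (intro power_increasing) auto
        also have "\<dots> \<le> 2304 * exp (12 * hm a)" using y(5) that by blast
        also have "\<dots> \<le> 2304 * exp (12 * B)" using a(3) by simp
        finally show ?thesis by (simp add: r_def)
      qed (simp add: r_def)
      thus ?thesis using y by (auto simp: Y_def)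
    qed
    then obtain y where y: "\<And>n. n \<in> Bad \<Longrightarrow> y n \<in> L (Suc n) \<and> y n \<notin> L n \<and> y n \<in> Y" by metis
    have ne: "y m \<noteq> y n" if "m < n" "m \<in> Bad" "n \<in> Bad" for m n
      using y[OF that(2)] y[OF that(3)] Lmono[of "Suc m" n] that(1) by (metis Suc_leI subsetD)
    have "inj_on y Bad"
    proof (rule inj_onI)
      fix m n assume "m \<in> Bad" "n \<in> Bad" "y m = y n"
      thus "m = n" using ne[of m n] ne[of n m] by (cases m n rule: linorder_cases) auto
    qed
    moreover have "y ` Bad \<subseteq> Y" using y by blast
    ultimately have "finite Bad" using finY by (rule inj_on_finite)
    then obtain N where N: "\<And>n. n \<in> Bad \<Longrightarrow> n < N" by (metis finite_nat_bounded lessThan_iff subsetD)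
    have RN: "a \<in> R N" if a: "a \<in> S" "hm a \<le> B" for a
    proof -
      obtain n where n: "a \<in> R n" using S_R a(1) by blast
      define m where "m = (LEAST m. a \<in> R m)"
      have m: "a \<in> R m" unfolding m_def using n by (rule LeastI)
      have "m \<le> N"
      proof (cases m)
        case (Suc j)
        have "a \<notin> R j" using not_less_Least[of j "\<lambda>m. a \<in> R m"] Suc by (simp add: m_def)
        hence "j \<in> Bad" using m Suc a(2) by (auto simp: Bad_def)
        thus ?thesis using N[of j] Suc by simp
      qed simp
      thus ?thesis using m R_mono by blast
    qed
    define M where "M = insert \<i> (k ` {..<N})"
    have LM: "L n \<subseteq> rootfields M" if "n \<le> N" for n
      using that
    proof (induction n)
      case 0
      show ?case unfolding assms(1) by (rule Q_upto_2_rootfields) (simp add: M_def)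
    next
      case (Suc n)
      have "K (Suc n) \<subseteq> rootfields M"
      proof -
        have "k n \<in> rootfields M" using Suc.prems by (intro gen_rootfields) (simp add: M_def)
        thus ?thesis unfolding k(4)[symmetric] adjoin_def
          using poly_closed[OF is_field_imp_ring[OF rootfields_field]] polys_mono[of "\<rat>" "rootfields M"]
            field_Rats[OF rootfields_field] by blast
      qed
      thus ?case unfolding LS using Suc is_field_imp_ring[OF rootfields_field]
        by (intro ring_hull_minimal) auto
    qed
    have "finite M" "\<And>x. x \<in> M \<Longrightarrow> algebraic_int x" using k(1) by (auto simp: M_def)
    hence "finite {a. algebraic_int a \<and> (\<exists>j. a \<in> rootfield M j) \<and> hm a \<le> B}"
      by (rule finite_bounded_height_rootfield)
    moreover have "{a \<in> S. hm a \<le> B} \<subseteq> {a. algebraic_int a \<and> (\<exists>j. a \<in> rootfield M j) \<and> hm a \<le> B}"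
    proof
      fix a assume "a \<in> {a \<in> S. hm a \<le> B}"
      hence a: "a \<in> R N" "hm a \<le> B" using RN by auto
      have "a \<in> rootfields M" using a(1) R_L LM[of N] by blast
      thus "a \<in> {a. algebraic_int a \<and> (\<exists>j. a \<in> rootfield M j) \<and> hm a \<le> B}"
        using a R_int by (auto simp: rootfields_def)
    qed
    ultimately show ?thesis by (rule rev_finite_subset)
  qed
  have S_int: "algebraic_int a" if "a \<in> S" for a using that S_R R_int by blast
  have "northcott S"
    unfolding northcott_def
  proof (intro conjI allI impI)
    show "S \<subseteq> Qbar" using S_int algebraic_int_Qbar by blast
    fix B :: real
    have "{a \<in> S. log_height a \<le> B} \<subseteq> {a \<in> S. hm a \<le> 2 * B}"
    proof
      fix a assume a: "a \<in> {a \<in> S. log_height a \<le> B}"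
      hence "hm a \<le> 2 * log_height a" using hm_le_log_height S_int by blast
      thus "a \<in> {a \<in> S. hm a \<le> 2 * B}" using a by simp
    qed
    thus "finite {a \<in> S. log_height a \<le> B}" using fin finite_subset by blast
  qed
  thus ?thesis unfolding S_def .
qed

end
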